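(* Let $\beta_0<\beta_2<\beta_1$ and $n\ge 1$. If $\beta_2>\tilde d_n(\beta_1)$, then the shape process $H^k$ (with parameter $\beta$) is ergodic for every $2\le k\le n+2$.
   Context: For $m\ge1$ and $\beta=(\beta_0,\beta_1,\beta_2)\in(0,\infty)^3$: for $x\in\mathbb{N}^m$, with zero boundary convention $x(0)=x(m+1)=0$, let $V_j(x)=\mathbf 1_{\{x(j-1)>x(j)\}}+\mathbf 1_{\{x(j+1)>x(j)\}}$. The crystal process $X^m$ with parameter $\beta$ is the continuous-time Markov chain on $\mathbb{N}^m$ jumping from $x$ to $x+e_j$ at rate $\beta_{V_j(x)}$, no other transitions; its shape process is $H^m_t=(X^m_t(1)-X^m_t(2),\dots,X^m_t(m-1)-X^m_t(m))\in\mathbb{Z}^{m-1}$, a Markov chain; "ergodic" means positive recurrent. $\tilde X^m$ denotes the crystal process with $m$ sites and parameter $(\tilde\beta_0,\tilde\beta_1,\tilde\beta_2)=(\beta_0,\beta_1,\beta_1)$, and $\mathbb{P}_{\mathbf 0}$ the law from the zero configuration. For $\beta_1>\beta_0$ define $\tilde d_m(\beta_1)=\inf\{d>0:\ \exists C,\alpha>0,\ \forall t\ge0,\ \mathbb{P}_{\mathbf 0}(\tilde X^m_t(m)\ge dt)\le Ce^{-\alpha t}\}$. *)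

theory Defs
  imports "HOL-Analysis.Analysis"
begin

text \<open>A chain on a type 'a is given by its off-diagonal jump rates R x y (x \<noteq> y).
  Diagonal values of R are ignored.\<close>

definition exit_rate :: "('a \<Rightarrow> 'a \<Rightarrow> real) \<Rightarrow> 'a \<Rightarrow> real" where
  "exit_rate R x = (\<Sum>\<^sub>\<infinity> z \<in> - {x}. R x z)"

text \<open>Generator (Q-matrix), its powers, and the transition function P(t) = exp(tQ)
  (the chains considered here have bounded rates, so this is the law of the chain).\<close>

definition ctmc_gen :: "('a \<Rightarrow> 'a \<Rightarrow> real) \<Rightarrow> 'a \<Rightarrow> 'a \<Rightarrow> real" where
  "ctmc_gen R x y = (if y = x then - exit_rate R x else R x y)"

fun gen_pow :: "('a \<Rightarrow> 'a \<Rightarrow> real) \<Rightarrow> nat \<Rightarrow> 'a \<Rightarrow> 'a \<Rightarrow> real" where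
  "gen_pow R 0 x y = (if x = y then 1 else 0)"
| "gen_pow R (Suc n) x y = (\<Sum>\<^sub>\<infinity> z. ctmc_gen R x z * gen_pow R n z y)"

definition trans_fun :: "('a \<Rightarrow> 'a \<Rightarrow> real) \<Rightarrow> real \<Rightarrow> 'a \<Rightarrow> 'a \<Rightarrow> real" where
  "trans_fun R t x y = (\<Sum>n. t ^ n / fact n * gen_pow R n x y)"

definition jump_prob :: "('a \<Rightarrow> 'a \<Rightarrow> real) \<Rightarrow> 'a \<Rightarrow> 'a \<Rightarrow> real" where
  "jump_prob R y z = (if z = y then 0 else R y z / exit_rate R y)"

fun first_hit_prob :: "('a \<Rightarrow> 'a \<Rightarrow> real) \<Rightarrow> 'a \<Rightarrow> nat \<Rightarrow> 'a \<Rightarrow> real" where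
  "first_hit_prob R i 0 y = (if y = i then 1 else 0)"
| "first_hit_prob R i (Suc n) y =
     (if y = i then 0 else (\<Sum>\<^sub>\<infinity> z. jump_prob R y z * first_hit_prob R i n z))"

text \<open>first_hit_time R i n y: expectation of the (continuous) time spent before the
  first visit to i, restricted to the event that this first visit happens at jump n
  (mean holding time in y is 1 / exit_rate R y, holding times independent of the
  jump chain).\<close>
fun first_hit_time :: "('a \<Rightarrow> 'a \<Rightarrow> real) \<Rightarrow> 'a \<Rightarrow> nat \<Rightarrow> 'a \<Rightarrow> real" where
  "first_hit_time R i 0 y = 0"
| "first_hit_time R i (Suc n) y =
     (if y = i then 0 else (\<Sum>\<^sub>\<infinity> z. jump_prob R y z *
        (first_hit_prob R i n z / exit_rate R y + first_hit_time R i n z)))"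

definition return_prob :: "('a \<Rightarrow> 'a \<Rightarrow> real) \<Rightarrow> 'a \<Rightarrow> real" where
  "return_prob R i = (\<Sum>n. \<Sum>\<^sub>\<infinity> z. jump_prob R i z * first_hit_prob R i n z)"

definition return_time_term :: "('a \<Rightarrow> 'a \<Rightarrow> real) \<Rightarrow> 'a \<Rightarrow> nat \<Rightarrow> real" where
  "return_time_term R i n = (\<Sum>\<^sub>\<infinity> z. jump_prob R i z *
      (first_hit_prob R i n z / exit_rate R i + first_hit_time R i n z))"

definition positive_recurrent :: "('a \<Rightarrow> 'a \<Rightarrow> real) \<Rightarrow> 'a \<Rightarrow> bool" where
  "positive_recurrent R i \<longleftrightarrow> exit_rate R i = 0 \<or>
     (return_prob R i = 1 \<and> summable (return_time_term R i))"

text \<open>Configurations x \<in> \<nat>^m are functions nat \<Rightarrow> nat supported on {1..m};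
  hence x 0 = x (m+1) = 0 (zero boundary convention).
  The parameter \<beta> = (\<beta>0,\<beta>1,\<beta>2) is a function nat \<Rightarrow> real, \<beta> i = \<beta>_i.\<close>

definition crystal_config :: "nat \<Rightarrow> (nat \<Rightarrow> nat) \<Rightarrow> bool" where
  "crystal_config m x \<longleftrightarrow> (\<forall>j. (j = 0 \<or> m < j) \<longrightarrow> x j = 0)"

definition Vn :: "nat \<Rightarrow> (nat \<Rightarrow> nat) \<Rightarrow> nat" where
  "Vn j x = (if x (j - 1) > x j then 1 else 0) + (if x (j + 1) > x j then 1 else 0)"

definition crystal_rate :: "nat \<Rightarrow> (nat \<Rightarrow> real) \<Rightarrow> (nat \<Rightarrow> nat) \<Rightarrow> (nat \<Rightarrow> nat) \<Rightarrow> real" where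
  "crystal_rate m \<beta> x y = (\<Sum>j\<in>{1..m}. if y = x(j := Suc (x j)) then \<beta> (Vn j x) else 0)"

definition crystal_tail :: "nat \<Rightarrow> (nat \<Rightarrow> real) \<Rightarrow> real \<Rightarrow> real \<Rightarrow> real" where
  "crystal_tail m \<beta> t d =
     (\<Sum>\<^sub>\<infinity> y \<in> {y. real (y m) \<ge> d * t}. trans_fun (crystal_rate m \<beta>) t (\<lambda>_. 0) y)"

definition tilde_param :: "(nat \<Rightarrow> real) \<Rightarrow> (nat \<Rightarrow> real)" where
  "tilde_param \<beta> = \<beta>(2 := \<beta> 1)"

definition tilde_d :: "nat \<Rightarrow> (nat \<Rightarrow> real) \<Rightarrow> real" where
  "tilde_d m \<beta> = Inf {d. d > 0 \<and> (\<exists>C \<alpha>. C > 0 \<and> \<alpha> > 0 \<and>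
      (\<forall>t\<ge>0. crystal_tail m (tilde_param \<beta>) t d \<le> C * exp (- \<alpha> * t)))}"

definition shape :: "nat \<Rightarrow> (nat \<Rightarrow> nat) \<Rightarrow> (nat \<Rightarrow> int)" where
  "shape m x = (\<lambda>i. if 1 \<le> i \<and> i < m then int (x i) - int (x (Suc i)) else 0)"

definition shape_space :: "nat \<Rightarrow> (nat \<Rightarrow> int) set" where
  "shape_space m = {h. \<forall>i. \<not> (1 \<le> i \<and> i < m) \<longrightarrow> h i = 0}"

text \<open>Jump rates of the shape process (the image chain): from shape h, pick any
  configuration x with shape h; rate to h' is the total crystal rate of the moves
  x \<rightarrow> x + e_j whose resulting shape is h'.\<close>
definition shape_rate :: "nat \<Rightarrow> (nat \<Rightarrow> real) \<Rightarrow> (nat \<Rightarrow> int) \<Rightarrow> (nat \<Rightarrow> int) \<Rightarrow> real" where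
  "shape_rate m \<beta> h h' =
     (let x = (SOME x. crystal_config m x \<and> shape m x = h)
      in \<Sum>j\<in>{1..m}. if h' = shape m (x(j := Suc (x j))) then \<beta> (Vn j x) else 0)"

definition shape_ergodic :: "nat \<Rightarrow> (nat \<Rightarrow> real) \<Rightarrow> bool" where
  "shape_ergodic m \<beta> \<longleftrightarrow> (\<forall>h \<in> shape_space m. positive_recurrent (shape_rate m \<beta>) h)"

end

theory Submission
  imports Defs
begin

text \<open>
  After uniformization with a clock of rate \<open>\<Lambda>\<close> everything happens in discrete time, where one step
  moves each height by at most one. Take a configuration in which the spread (maximal minus
  minimal height) is large compared with a fixed number \<open>M\<close> of steps. By pigeonhole the sites split
  into low and high ones which stay separated during the next \<open>M\<close> steps. A low site next to a
  higher neighbour grows at rate at least \<open>\<beta> 2\<close>, which forces all low sites to grow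
  with speed almost \<open>\<beta> 2\<close>. A maximal block of high sites only sees lower outside neighbours. If it
  has at most \<open>n\<close> sites, it is therefore dominated by the attractive process with parameter
  \<open>tilde_param \<beta>\<close> on \<open>n\<close> sites started from a flat configuration, and its speed is less than \<open>\<beta> 2\<close>.
  The only larger block occurs when the low set is a single end site; but such a site grows at rate
  \<open>\<beta> 1\<close>, while a high block is always slower than \<open>\<beta> 1\<close> because its top site grows at rate \<open>\<beta> 0\<close>.
  The two speeds are compared through the exponential moments of the heights, and
  \<open>ln u \<le> u - 1\<close> turns them into a negative \<open>M\<close>-step drift \<open>P\<^sup>M g - g \<le> -1\<close> of a multiple \<open>g\<close> of the spread.
  Then \<open>g + P g + \<dots> + P\<^sup>M\<^sup>-\<^sup>1 g\<close> is a one-step Lyapunov function for Foster's criterion.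
\<close>

section \<open>Positive recurrence from a Lyapunov function\<close>

text \<open>Since \<open>\<beta> 2 < \<beta> 1\<close>, a second higher neighbour slows a site down,
  and the process itself is not attractive. Monotonicity is available only after raising
  \<open>\<beta> 2\<close> to \<open>\<beta> 1\<close>, which bounds high sites from above; the
  lower bound for low sites needs its own argument. The limit \<open>n + 2\<close> is a count:
  unless the low set is one end site, every high block leaves out at least two sites. Exponential
  moments are what the exponential tails in \<open>tilde_d\<close> control. With them a maximum over
  sites is replaced by a sum at the price of a constant factor. Such factors are harmless only
  against a geometric gain, hence many steps instead of one. High and low heights are dependent, but
  logarithms separate their moments, so no joint law is needed. Moment growth rates approximate
  speeds only for small \<open>\<theta>\<close>; the bound for the attractive process is therefore
  proved for all small \<open>\<theta>\<close>. There is no path space: expectations are iterates of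
  a positive operator on functions, and staying separated for \<open>M\<close> steps becomes a
  predicate that counts down.\<close>

lemma infsum_finite_support:
  fixes f :: "'a \<Rightarrow> real"
  assumes "finite F" "\<And>x. x \<in> A - F \<Longrightarrow> f x = 0" "F \<subseteq> A"
  shows "infsum f A = sum f F"
proof -
  have "infsum f A = infsum f F"
    by (rule infsum_cong_neutral) (use assms in auto)
  then show ?thesis using assms(1) by simp
qed

text \<open>Turns a sum over states into a sum over jumps. Jumps with the same target add up in the
  row of the rate matrix, as they do on the right.\<close>

lemma infsum_finite_jumps:
  fixes c f :: "_ \<Rightarrow> real"
  assumes "finite J" "\<And>j. j \<in> J \<Longrightarrow> t j \<in> A"
  shows "(\<Sum>\<^sub>\<infinity>z\<in>A. (\<Sum>j\<in>J. if z = t j then c j else 0) * f z) = (\<Sum>j\<in>J. c j * f (t j))"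
proof -
  have "(\<Sum>\<^sub>\<infinity>z\<in>A. (\<Sum>j\<in>J. if z = t j then c j else 0) * f z)
      = (\<Sum>z\<in>t ` J. (\<Sum>j\<in>J. if z = t j then c j else 0) * f z)"
  proof (rule infsum_finite_support)
    fix x assume "x \<in> A - t ` J"
    then have "(\<Sum>j\<in>J. if x = t j then c j else 0) = 0"
      by (intro sum.neutral) auto
    then show "(\<Sum>j\<in>J. if x = t j then c j else 0) * f x = 0" by simp
  qed (use assms in auto)
  also have "\<dots> = (\<Sum>z\<in>t ` J. \<Sum>j\<in>J. if z = t j then c j * f (t j) else 0)"
    by (simp only: sum_distrib_right) (intro sum.cong refl, auto)
  also have "\<dots> = (\<Sum>j\<in>J. \<Sum>z\<in>t ` J. if z = t j then c j * f (t j) else 0)"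
    by (rule sum.swap)
  also have "\<dots> = (\<Sum>j\<in>J. c j * f (t j))"
    using assms(1) by (intro sum.cong refl) (simp add: sum.delta)
  finally show ?thesis .
qed

lemma exit_rate_finite_jumps:
  assumes "finite J" "\<And>j. j \<in> J \<Longrightarrow> t j \<noteq> y"
    and R: "\<And>z. R y z = (\<Sum>j\<in>J. if z = t j then c j else 0)"
  shows "exit_rate R y = (\<Sum>j\<in>J. c j)"
  using infsum_finite_jumps[of J t "- {y}" c "\<lambda>_. 1"] assms(1,2)
  by (simp add: exit_rate_def R)

lemma jump_prob_finite_jumps:
  assumes "finite J" "\<And>j. j \<in> J \<Longrightarrow> t j \<noteq> y"
    and R: "\<And>z. R y z = (\<Sum>j\<in>J. if z = t j then c j else 0)"
  shows "(\<Sum>\<^sub>\<infinity>z. jump_prob R y z * f z) = (\<Sum>j\<in>J. c j / exit_rate R y * f (t j))"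
proof -
  have R0: "(\<Sum>j\<in>J. if y = t j then c j else 0) = 0"
    using assms(2) by (intro sum.neutral) auto
  have "jump_prob R y z * f z
      = (\<Sum>j\<in>J. if z = t j then c j / exit_rate R y else 0) * f z" for z
  proof -
    have "(\<Sum>j\<in>J. if z = t j then c j / exit_rate R y else 0) = R y z / exit_rate R y"
      unfolding R sum_divide_distrib by (intro sum.cong) auto
    then show ?thesis using R0 R[of y] by (auto simp: jump_prob_def)
  qed
  then have "(\<Sum>\<^sub>\<infinity>z. jump_prob R y z * f z)
      = (\<Sum>\<^sub>\<infinity>z. (\<Sum>j\<in>J. if z = t j then c j / exit_rate R y else 0) * f z)"
    by (rule infsum_cong)
  also have "\<dots> = (\<Sum>j\<in>J. c j / exit_rate R y * f (t j))"
    by (rule infsum_finite_jumps) (use assms(1) in auto)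
  finally show ?thesis .
qed

text \<open>The diagonal entry is minus the total rate, so it can be distributed over the jumps as
  the terms \<open>- c j * f y\<close>.\<close>

lemma gen_finite_jumps:
  assumes "finite J" "\<And>j. j \<in> J \<Longrightarrow> t j \<noteq> y"
    and R: "\<And>z. R y z = (\<Sum>j\<in>J. if z = t j then c j else 0)"
  shows "(\<Sum>\<^sub>\<infinity>z. ctmc_gen R y z * f z) = (\<Sum>j\<in>J. c j * (f (t j) - f y))"
proof -
  let ?F = "insert y (t ` J)"
  have "(\<Sum>\<^sub>\<infinity>z. ctmc_gen R y z * f z) = (\<Sum>z\<in>?F. ctmc_gen R y z * f z)"
  proof (rule infsum_finite_support)
    fix x assume "x \<in> UNIV - ?F"
    then have "R y x = 0" "x \<noteq> y" unfolding R by (auto intro!: sum.neutral)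
    then show "ctmc_gen R y x * f x = 0" by (simp add: ctmc_gen_def)
  qed (use assms in auto)
  also have "\<dots> = - exit_rate R y * f y + (\<Sum>z\<in>t ` J. ctmc_gen R y z * f z)"
    using assms(1,2) by (subst sum.insert) (auto simp: ctmc_gen_def)
  also have "(\<Sum>z\<in>t ` J. ctmc_gen R y z * f z) = (\<Sum>z\<in>t ` J. R y z * f z)"
    using assms(2) by (intro sum.cong) (auto simp: ctmc_gen_def)
  also have "\<dots> = (\<Sum>\<^sub>\<infinity>z\<in>t ` J. (\<Sum>j\<in>J. if z = t j then c j else 0) * f z)"
    using assms(1) by (simp add: R)
  also have "\<dots> = (\<Sum>j\<in>J. c j * f (t j))"
    by (rule infsum_finite_jumps) (use assms in auto)
  also have "exit_rate R y = (\<Sum>j\<in>J. c j)"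
    by (rule exit_rate_finite_jumps) (use assms in auto)
  finally show ?thesis
    by (simp add: algebra_simps sum_subtractf sum_distrib_left)
qed

section \<open>Hitting probabilities of the embedded jump chain and Foster's criterion\<close>

locale finite_jump_chain =
  fixes R :: "'a \<Rightarrow> 'a \<Rightarrow> real" and S :: "'a set" and J :: "'j set"
    and p :: "'a \<Rightarrow> 'j \<Rightarrow> real" and nxt :: "'a \<Rightarrow> 'j \<Rightarrow> 'a" and l :: real
  assumes finite_J: "finite J"
    and jump_sum: "\<And>y f. y \<in> S \<Longrightarrow>
      (\<Sum>\<^sub>\<infinity>z. jump_prob R y z * f z) = (\<Sum>j\<in>J. p y j * f (nxt y j))"
    and p_nonneg: "\<And>y j. y \<in> S \<Longrightarrow> j \<in> J \<Longrightarrow> 0 \<le> p y j"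
    and p_sum: "\<And>y. y \<in> S \<Longrightarrow> (\<Sum>j\<in>J. p y j) = 1"
    and nxt_closed: "\<And>y j. y \<in> S \<Longrightarrow> j \<in> J \<Longrightarrow> nxt y j \<in> S"
    and l_pos: "0 < l"
    and exit_ge: "\<And>y. y \<in> S \<Longrightarrow> l \<le> exit_rate R y"
begin

definition avg :: "('a \<Rightarrow> real) \<Rightarrow> 'a \<Rightarrow> real" where
  "avg f y = (\<Sum>j\<in>J. p y j * f (nxt y j))"

lemma avg_mono: "y \<in> S \<Longrightarrow> (\<And>z. z \<in> S \<Longrightarrow> f z \<le> g z) \<Longrightarrow> avg f y \<le> avg g y"
  unfolding avg_def by (intro sum_mono mult_left_mono p_nonneg) (auto simp: nxt_closed)

lemma avg_const: "y \<in> S \<Longrightarrow> avg (\<lambda>_. c) y = c"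
  by (simp add: avg_def p_sum flip: sum_distrib_right)

lemma avg_add: "avg (\<lambda>z. f z + g z) y = avg f y + avg g y"
  by (simp add: avg_def ring_distribs sum.distrib)

lemma avg_diff: "avg (\<lambda>z. f z - g z) y = avg f y - avg g y"
  by (simp add: avg_def ring_distribs sum_subtractf)

lemma avg_scale: "avg (\<lambda>z. c * f z) y = c * avg f y"
  by (simp add: avg_def sum_distrib_left mult_ac)

lemma avg_sum: "avg (\<lambda>z. \<Sum>n\<in>A. f n z) y = (\<Sum>n\<in>A. avg (f n) y)"
  unfolding avg_def sum_distrib_left by (rule sum.swap)

lemma avg_nonneg: "y \<in> S \<Longrightarrow> (\<And>z. z \<in> S \<Longrightarrow> 0 \<le> f z) \<Longrightarrow> 0 \<le> avg f y"
  unfolding avg_def by (intro sum_nonneg mult_nonneg_nonneg p_nonneg) (auto simp: nxt_closed)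

lemma first_hit_prob_Suc:
  "y \<in> S \<Longrightarrow> first_hit_prob R i (Suc n) y = (if y = i then 0 else avg (first_hit_prob R i n) y)"
  by (simp add: jump_sum avg_def)

lemma first_hit_prob_nonneg: "y \<in> S \<Longrightarrow> 0 \<le> first_hit_prob R i n y"
proof (induction n arbitrary: y)
  case (Suc n)
  then show ?case using avg_nonneg[of y "first_hit_prob R i n"]
    by (simp only: first_hit_prob_Suc) simp
qed simp

definition hit_within :: "'a \<Rightarrow> nat \<Rightarrow> 'a \<Rightarrow> real" where
  "hit_within i N y = (\<Sum>n\<le>N. first_hit_prob R i n y)"

lemma hit_within_0: "hit_within i 0 y = (if y = i then 1 else 0)"
  by (simp add: hit_within_def)

lemma hit_within_Suc:
  assumes "y \<in> S"
  shows "hit_within i (Suc N) y = (if y = i then 1 else avg (hit_within i N) y)"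
proof -
  have "hit_within i (Suc N) y = first_hit_prob R i 0 y + (\<Sum>n\<le>N. first_hit_prob R i (Suc n) y)"
    unfolding hit_within_def by (rule sum.atMost_Suc_shift)
  also have "\<dots> = (if y = i then 1 else (\<Sum>n\<le>N. avg (first_hit_prob R i n) y))"
    using assms by (simp only: first_hit_prob_Suc) simp
  finally show ?thesis
    by (simp add: hit_within_def[abs_def] avg_sum)
qed

lemma hit_within_nonneg: "y \<in> S \<Longrightarrow> 0 \<le> hit_within i N y"
  unfolding hit_within_def by (intro sum_nonneg first_hit_prob_nonneg)

lemma hit_within_le_1: "y \<in> S \<Longrightarrow> hit_within i N y \<le> 1"
proof (induction N arbitrary: y)
  case (Suc N)
  have "avg (hit_within i N) y \<le> avg (\<lambda>_. 1) y" using Suc by (intro avg_mono) auto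
  then show ?case using Suc.prems by (simp add: hit_within_Suc avg_const)
qed (simp add: hit_within_0)

lemma hit_within_mono: "y \<in> S \<Longrightarrow> M \<le> N \<Longrightarrow> hit_within i M y \<le> hit_within i N y"
  unfolding hit_within_def by (intro sum_mono2 first_hit_prob_nonneg) auto

text \<open>A first visit at jump \<open>n\<close> takes \<open>n\<close> holding times, each with
  mean at most \<open>1 / l\<close>. Expected times are thus controlled by expected numbers of
  jumps.\<close>

lemma first_hit_time_bounds:
  "y \<in> S \<Longrightarrow> 0 \<le> first_hit_time R i n y \<and> first_hit_time R i n y \<le> real n / l * first_hit_prob R i n y"
proof (induction n arbitrary: y)
  case (Suc n)
  let ?h = "first_hit_prob R i n"
  have eq: "first_hit_time R i (Suc n) y =
      (if y = i then 0 else avg (\<lambda>z. ?h z / exit_rate R y + first_hit_time R i n z) y)"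
    using Suc.prems by (simp add: jump_sum avg_def)
  have ex: "0 < l" "l \<le> exit_rate R y" using l_pos exit_ge Suc.prems by auto
  have nonneg: "0 \<le> avg (\<lambda>z. ?h z / exit_rate R y + first_hit_time R i n z) y"
    using Suc ex by (intro avg_nonneg add_nonneg_nonneg divide_nonneg_nonneg first_hit_prob_nonneg) auto
  have "avg (\<lambda>z. ?h z / exit_rate R y + first_hit_time R i n z) y \<le> avg (\<lambda>z. real (Suc n) / l * ?h z) y"
  proof (rule avg_mono[OF Suc.prems])
    fix z assume z: "z \<in> S"
    have "?h z / exit_rate R y \<le> ?h z / l"
      using ex first_hit_prob_nonneg[OF z] by (intro divide_left_mono) auto
    then show "?h z / exit_rate R y + first_hit_time R i n z \<le> real (Suc n) / l * ?h z"
      using Suc.IH[OF z] by (simp add: add_divide_distrib ring_distribs)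
  qed
  then show ?case using nonneg Suc.prems
    by (simp only: eq first_hit_prob_Suc avg_scale) simp
qed simp

context
  fixes i W
  assumes i_S: "i \<in> S" and W_nonneg: "\<And>y. y \<in> S \<Longrightarrow> 0 \<le> W y"
    and W_drift: "\<And>y. y \<in> S \<Longrightarrow> y \<noteq> i \<Longrightarrow> avg W y \<le> W y - 1"
begin

text \<open>Truncated mean number of jumps until \<open>i\<close>. Conditioning on the first jump
  adds one unit, weighted by a probability at most 1; the drift of \<open>W\<close> pays for
  it.\<close>

lemma sum_time_le: "y \<in> S \<Longrightarrow> (\<Sum>n\<le>N. real n * first_hit_prob R i n y) \<le> W y"
proof (induction N arbitrary: y)
  case (Suc N)
  show ?case
  proof (cases "y = i")
    case True
    have "real n * first_hit_prob R i n y = 0" for n using True by (cases n) auto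
    then show ?thesis using W_nonneg[OF Suc.prems] by (simp only: sum.neutral_const)
  next
    case False
    have "(\<Sum>n\<le>Suc N. real n * first_hit_prob R i n y)
        = (\<Sum>n\<le>N. real (Suc n) * first_hit_prob R i (Suc n) y)"
      by (subst sum.atMost_Suc_shift) simp
    also have "\<dots> = avg (\<lambda>z. (\<Sum>n\<le>N. real n * first_hit_prob R i n z) + hit_within i N z) y"
      using False Suc.prems
      by (simp only: first_hit_prob_Suc avg_add avg_sum avg_scale hit_within_def if_False)
         (simp add: sum.distrib ring_distribs add.commute)
    also have "\<dots> \<le> avg (\<lambda>z. W z + 1) y"
      using Suc.IH hit_within_le_1 by (intro avg_mono Suc.prems add_mono) auto
    also have "\<dots> \<le> W y"
      using W_drift[OF Suc.prems False] Suc.prems by (simp add: avg_add avg_const)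
    finally show ?thesis .
  qed
qed (simp add: W_nonneg)

text \<open>Summing the probabilities of a miss is the other formula for a mean hitting time. The
  previous bound sees only paths that do hit; this one excludes that mass escapes.\<close>

lemma sum_miss_le: "y \<in> S \<Longrightarrow> (\<Sum>n<N. 1 - hit_within i n y) \<le> W y"
proof (induction N arbitrary: y)
  case (Suc N)
  show ?case
  proof (cases "y = i")
    case True
    have "1 - hit_within i n y = 0" for n
      using True Suc.prems by (cases n) (auto simp: hit_within_0 hit_within_Suc)
    then show ?thesis using W_nonneg[OF Suc.prems] by simp
  next
    case False
    have "(\<Sum>n<Suc N. 1 - hit_within i n y) = 1 + (\<Sum>n<N. 1 - hit_within i (Suc n) y)"
      using False by (subst sum.lessThan_Suc_shift) (simp add: hit_within_0)
    also have "\<dots> = avg (\<lambda>z. (\<Sum>n<N. 1 - hit_within i n z) + 1) y"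
      using False Suc.prems
      by (simp add: hit_within_Suc avg_add avg_sum avg_diff avg_const)
    also have "\<dots> \<le> avg (\<lambda>z. W z + 1) y"
      using Suc.IH by (intro avg_mono Suc.prems add_mono) auto
    also have "\<dots> \<le> W y"
      using W_drift[OF Suc.prems False] Suc.prems by (simp add: avg_add avg_const)
    finally show ?thesis .
  qed
qed (simp add: W_nonneg)

text \<open>The probabilities of a miss decrease in \<open>n\<close> and their partial sums stay
  below \<open>W y\<close>, so the one at \<open>N\<close> is at most
  \<open>W y / (N + 1)\<close>.\<close>

lemma hit_within_tendsto_1: 
  assumes y: "y \<in> S" shows "(\<lambda>N. hit_within i N y) \<longlonglongrightarrow> 1"
proof -
  have ge: "1 - W y / real (Suc N) \<le> hit_within i N y" for N
  proof -
    have "real (Suc N) * (1 - hit_within i N y) = (\<Sum>n<Suc N. 1 - hit_within i N y)" by simp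
    also have "\<dots> \<le> (\<Sum>n<Suc N. 1 - hit_within i n y)"
      by (intro sum_mono diff_left_mono hit_within_mono y) auto
    also have "\<dots> \<le> W y" by (rule sum_miss_le[OF y])
    finally show ?thesis by (simp add: field_simps)
  qed
  have lim: "(\<lambda>N. 1 - W y / real (Suc N)) \<longlonglongrightarrow> 1"
    using tendsto_diff[OF tendsto_const[of 1] LIMSEQ_Suc[OF lim_const_over_n[of "W y"]]] by simp
  show ?thesis
  proof (rule tendsto_sandwich[OF _ _ lim tendsto_const])
    show "\<forall>\<^sub>F N in sequentially. 1 - W y / real (Suc N) \<le> hit_within i N y"
      by (rule always_eventually) (use ge in blast)
    show "\<forall>\<^sub>F N in sequentially. hit_within i N y \<le> 1"
      by (rule always_eventually) (use hit_within_le_1[OF y] in blast)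
  qed
qed

lemma positive_recurrent_of_drift: "positive_recurrent R i"
proof -
  let ?h = "\<lambda>n. first_hit_prob R i n"
  have "(\<lambda>n. avg (?h n) i) sums avg (\<lambda>_. 1) i"
    unfolding avg_def
  proof (intro sums_sum sums_mult)
    fix j assume "j \<in> J"
    then have "nxt i j \<in> S" using i_S nxt_closed by auto
    then show "(\<lambda>n. ?h n (nxt i j)) sums 1"
      using hit_within_tendsto_1 by (simp add: sums_def_le hit_within_def)
  qed
  then have "return_prob R i = 1"
    using i_S by (simp add: return_prob_def jump_sum avg_const sums_iff flip: avg_def)
  moreover have "summable (return_time_term R i)"
  proof -
    have term_eq: "return_time_term R i n
        = (\<Sum>j\<in>J. p i j * (?h n (nxt i j) / exit_rate R i + first_hit_time R i n (nxt i j)))" for n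
      using i_S by (simp add: return_time_term_def jump_sum)
    have "summable (\<lambda>n. ?h n y / exit_rate R i + first_hit_time R i n y)" if y: "y \<in> S" for y
    proof (intro summable_add summable_divide)
      show "summable (\<lambda>n. ?h n y)"
        using hit_within_tendsto_1[OF y] by (auto simp: sums_def_le hit_within_def summable_def)
      have "summable (\<lambda>n. real n * ?h n y)"
      proof (rule bounded_imp_summable)
        show "0 \<le> real n * ?h n y" for n using first_hit_prob_nonneg[OF y] by simp
        show "(\<Sum>n\<le>N. real n * ?h n y) \<le> W y" for N by (rule sum_time_le[OF y])
      qed
      then have "summable (\<lambda>n. 1 / l * (real n * ?h n y))" by (rule summable_mult)
      then show "summable (\<lambda>n. first_hit_time R i n y)"
        by (rule summable_comparison_test') (use first_hit_time_bounds[OF y] in auto)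
    qed
    then show ?thesis unfolding term_eq
      by (intro summable_sum summable_mult) (use i_S nxt_closed in auto)
  qed
  ultimately show ?thesis by (simp add: positive_recurrent_def)
qed

end

text \<open>On the finite exceptional set the target is hit within \<open>L\<close> steps with probability at
  least \<open>\<delta>\<close>. Since \<open>U = (\<Sum>m<L. 1 - hit_within i m)\<close> decreases by exactly
  \<open>hit_within i L\<close> per step off the target, a large multiple of it repairs the drift there.\<close>

lemma positive_recurrent_of_finite_exception:
  fixes V :: "'a \<Rightarrow> real" and b :: real
  assumes i: "i \<in> S" and F: "finite F" "F \<subseteq> S" and V0: "\<And>y. y \<in> S \<Longrightarrow> 0 \<le> V y"
    and b: "0 \<le> b"
    and drift: "\<And>y. y \<in> S \<Longrightarrow> avg V y \<le> V y - 1 + (if y \<in> F then b else 0)"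
    and reach: "\<And>y. y \<in> S \<Longrightarrow> \<exists>L. 0 < hit_within i L y"
  shows "positive_recurrent R i"
proof -
  obtain Lf where Lf: "\<And>y. y \<in> S \<Longrightarrow> 0 < hit_within i (Lf y) y" using reach by metis
  define L where "L = (\<Sum>y\<in>F. Lf y)"
  have pos: "0 < hit_within i L y" if "y \<in> F" for y
  proof -
    have "Lf y \<le> L" unfolding L_def using that F by (intro member_le_sum) auto
    then show ?thesis using Lf[of y] hit_within_mono[of y "Lf y" L i] that F by force
  qed
  \<comment> \<open>The extra element 1 keeps the minimum meaningful when \<open>F\<close> is
    empty.\<close>
  define d where "d = Min (insert 1 (hit_within i L ` F))"
  have d: "0 < d" "\<And>y. y \<in> F \<Longrightarrow> d \<le> hit_within i L y"
    unfolding d_def using F pos by auto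
  define U where "U y = (\<Sum>m<L. 1 - hit_within i m y)" for y
  define W where "W y = V y + b / d * U y" for y
  have U0: "0 \<le> U y" if "y \<in> S" for y
    unfolding U_def using hit_within_le_1 that by (intro sum_nonneg) auto
  have U: "avg U y = U y - hit_within i L y" if y: "y \<in> S" "y \<noteq> i" for y
  proof -
    have "avg U y = (\<Sum>m<L. 1 - hit_within i (Suc m) y)"
      unfolding U_def using y by (simp add: avg_sum avg_diff avg_const hit_within_Suc)
    also have "\<dots> = U y - (hit_within i L y - hit_within i 0 y)"
      using sum_lessThan_telescope[of "\<lambda>m. hit_within i m y" L]
      by (simp add: U_def sum_subtractf)
    finally show ?thesis using y by (simp add: hit_within_0)
  qed
  show ?thesis
  proof (rule positive_recurrent_of_drift[OF i])
    show "0 \<le> W y" if "y \<in> S" for y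
      unfolding W_def using V0 U0 that b d by auto
    fix y assume y: "y \<in> S" "y \<noteq> i"
    have "(if y \<in> F then b else 0) \<le> b / d * hit_within i L y"
    proof (cases "y \<in> F")
      case True
      have "b / d * d \<le> b / d * hit_within i L y"
        using d b True by (intro mult_left_mono) auto
      then show ?thesis using True d by simp
    next
      case False
      then show ?thesis using d b hit_within_nonneg[OF y(1)] by simp
    qed
    moreover have "avg W y = avg V y + b / d * avg U y"
      unfolding W_def by (simp only: avg_add avg_scale)
    ultimately show "avg W y \<le> W y - 1"
      using drift[OF y(1)] U[OF y] by (simp add: W_def algebra_simps)
  qed
qed

end

section \<open>The uniformized crystal process\<close>

abbreviation grow :: "(nat \<Rightarrow> nat) \<Rightarrow> nat \<Rightarrow> nat \<Rightarrow> nat" where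
  "grow x j \<equiv> x(j := Suc (x j))"

text \<open>Expectation of \<open>f\<close> after one step of the chain embedded in a Poisson clock of rate \<open>\<Lambda>\<close>.\<close>

definition ustep :: "nat \<Rightarrow> (nat \<Rightarrow> real) \<Rightarrow> real \<Rightarrow> ((nat \<Rightarrow> nat) \<Rightarrow> real) \<Rightarrow> (nat \<Rightarrow> nat) \<Rightarrow> real" where
  "ustep m \<beta> \<Lambda> f x = f x + (\<Sum>j\<in>{1..m}. \<beta> (Vn j x) / \<Lambda> * (f (grow x j) - f x))"

lemma Vn_le_2: "Vn j x \<le> 2"
  by (simp add: Vn_def)

lemma ustep_const: "ustep m \<beta> \<Lambda> (\<lambda>_. c) x = c"
  by (simp add: ustep_def)

lemma ustep_add: "ustep m \<beta> \<Lambda> (\<lambda>y. f y + g y) x = ustep m \<beta> \<Lambda> f x + ustep m \<beta> \<Lambda> g x"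
  by (simp add: ustep_def algebra_simps sum.distrib sum_subtractf add_divide_distrib)

lemma ustep_scale: "ustep m \<beta> \<Lambda> (\<lambda>y. c * f y) x = c * ustep m \<beta> \<Lambda> f x"
  by (simp add: ustep_def algebra_simps sum_distrib_left sum_subtractf)

lemma ustep_sum:
  "ustep m \<beta> \<Lambda> (\<lambda>y. \<Sum>a\<in>A. f a y) x = (\<Sum>a\<in>A. ustep m \<beta> \<Lambda> (f a) x)"
  by (induction A rule: infinite_finite_induct) (simp_all add: ustep_const ustep_add)

lemma ustep_pow_const: "(ustep m \<beta> \<Lambda> ^^ N) (\<lambda>_. c) x = c"
proof -
  have "(ustep m \<beta> \<Lambda> ^^ N) (\<lambda>_. c) = (\<lambda>_. c)"
    by (induction N) (simp_all add: ustep_const)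
  then show ?thesis by simp
qed

lemma ustep_pow_add:
  "(ustep m \<beta> \<Lambda> ^^ N) (\<lambda>y. f y + g y) x = (ustep m \<beta> \<Lambda> ^^ N) f x + (ustep m \<beta> \<Lambda> ^^ N) g x"
proof -
  have "(ustep m \<beta> \<Lambda> ^^ N) (\<lambda>y. f y + g y) = (\<lambda>x. (ustep m \<beta> \<Lambda> ^^ N) f x + (ustep m \<beta> \<Lambda> ^^ N) g x)"
    by (induction N) (simp_all add: ustep_add)
  then show ?thesis by simp
qed

lemma ustep_pow_scale:
  "(ustep m \<beta> \<Lambda> ^^ N) (\<lambda>y. c * f y) x = c * (ustep m \<beta> \<Lambda> ^^ N) f x"
proof -
  have "(ustep m \<beta> \<Lambda> ^^ N) (\<lambda>y. c * f y) = (\<lambda>x. c * (ustep m \<beta> \<Lambda> ^^ N) f x)"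
    by (induction N) (simp_all add: ustep_scale)
  then show ?thesis by simp
qed

lemma ustep_pow_sum:
  "(ustep m \<beta> \<Lambda> ^^ N) (\<lambda>y. \<Sum>a\<in>A. f a y) x = (\<Sum>a\<in>A. (ustep m \<beta> \<Lambda> ^^ N) (f a) x)"
  by (induction A rule: infinite_finite_induct) (simp_all add: ustep_pow_const ustep_pow_add)

lemma ustep_exp_site:
  assumes "i \<in> {1..m}"
  shows "ustep m \<beta> \<Lambda> (\<lambda>y. exp (\<theta> * real (y i))) x
    = exp (\<theta> * real (x i)) + \<beta> (Vn i x) / \<Lambda> * (exp \<theta> - 1) * exp (\<theta> * real (x i))"
proof -
  have "(\<Sum>j\<in>{1..m}. \<beta> (Vn j x) / \<Lambda> * (exp (\<theta> * real (grow x j i)) - exp (\<theta> * real (x i))))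
      = (\<Sum>j\<in>{1..m}. if j = i then \<beta> (Vn i x) / \<Lambda> * (exp \<theta> - 1) * exp (\<theta> * real (x i)) else 0)"
    by (intro sum.cong refl) (auto simp: algebra_simps exp_add diff_divide_distrib)
  also have "\<dots> = \<beta> (Vn i x) / \<Lambda> * (exp \<theta> - 1) * exp (\<theta> * real (x i))"
    using assms by (simp add: sum.delta)
  finally show ?thesis by (simp add: ustep_def)
qed

text \<open>The bound by \<open>\<Lambda>\<close> leaves a nonnegative probability of not moving, so
  \<open>ustep\<close> is a positive averaging operator. It also provides the slack used in
  \<open>mono_ustep\<close>.\<close>

locale uniformized =
  fixes m :: nat and \<beta> :: "nat \<Rightarrow> real" and \<Lambda> :: real
  assumes \<Lambda>_pos: "0 < \<Lambda>"
    and rate_nonneg: "\<And>v. v \<le> 2 \<Longrightarrow> 0 \<le> \<beta> v"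
    and rate_le: "\<And>v. v \<le> 2 \<Longrightarrow> real m * \<beta> v \<le> \<Lambda>"
begin

lemma rates_sum_le: "(\<Sum>j\<in>{1..m}. \<beta> (Vn j x)) \<le> \<Lambda>"
proof -
  have "(\<Sum>j\<in>{1..m}. \<beta> (Vn j x)) \<le> (\<Sum>j\<in>{1..m}. \<Lambda> / real m)"
    using rate_le[OF Vn_le_2] by (intro sum_mono) (auto simp: field_simps)
  also have "\<dots> \<le> \<Lambda>" using \<Lambda>_pos by simp
  finally show ?thesis .
qed

lemma ustep_mono_at:
  assumes "f x \<le> g x" "\<And>j. j \<in> {1..m} \<Longrightarrow> f (grow x j) \<le> g (grow x j)"
  shows "ustep m \<beta> \<Lambda> f x \<le> ustep m \<beta> \<Lambda> g x"
proof -
  define c where "c = (\<lambda>j. \<beta> (Vn j x) / \<Lambda>)"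
  have c: "0 \<le> c j" for j unfolding c_def using rate_nonneg[OF Vn_le_2] \<Lambda>_pos by simp
  have c1: "(\<Sum>j\<in>{1..m}. c j) \<le> 1"
    unfolding c_def sum_divide_distrib[symmetric] using rates_sum_le \<Lambda>_pos by simp
  have eq: "ustep m \<beta> \<Lambda> f x = (1 - (\<Sum>j\<in>{1..m}. c j)) * f x + (\<Sum>j\<in>{1..m}. c j * f (grow x j))" for f
    unfolding ustep_def c_def by (simp add: algebra_simps sum_subtractf sum_distrib_left)
  show ?thesis unfolding eq using assms c c1 by (intro add_mono mult_left_mono sum_mono) auto
qed

text \<open>Comparison principle behind nearly all later bounds. \<open>Q s\<close> marks states
  that are good for \<open>s\<close> more steps; each step uses up one unit, and \<open>F\<close>
  has to be a supersolution only there. This replaces stopping the process when it leaves a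
  region.\<close>

lemma ustep_pow_le:
  assumes f: "\<And>y. Q 0 y \<Longrightarrow> f y \<le> F 0 y"
    and F: "\<And>s y. Q (Suc s) y \<Longrightarrow> ustep m \<beta> \<Lambda> (F s) y \<le> F (Suc s) y"
    and Q: "\<And>s y. Q (Suc s) y \<Longrightarrow> Q s y" "\<And>s y j. Q (Suc s) y \<Longrightarrow> j \<in> {1..m} \<Longrightarrow> Q s (grow y j)"
    and x: "Q N x"
  shows "(ustep m \<beta> \<Lambda> ^^ N) f x \<le> F N x"
  using x
proof (induction N arbitrary: x)
  case (Suc N)
  have "(ustep m \<beta> \<Lambda> ^^ Suc N) f x = ustep m \<beta> \<Lambda> ((ustep m \<beta> \<Lambda> ^^ N) f) x" by simp
  also have "\<dots> \<le> ustep m \<beta> \<Lambda> (F N) x"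
    by (intro ustep_mono_at Suc.IH Q(1)[OF Suc.prems] Q(2)[OF Suc.prems])
  also have "\<dots> \<le> F (Suc N) x" by (rule F[OF Suc.prems])
  finally show ?case .
qed (simp add: f)

lemma ustep_pow_mono:
  assumes "\<And>y. f y \<le> g y" shows "(ustep m \<beta> \<Lambda> ^^ N) f x \<le> (ustep m \<beta> \<Lambda> ^^ N) g x"
  using ustep_pow_le[where Q="\<lambda>_ _. True" and F="\<lambda>N. (ustep m \<beta> \<Lambda> ^^ N) g" and f=f] assms by simp

lemma ustep_pow_geometric:
  assumes "0 \<le> \<rho>" "\<And>s y. Q (Suc s) y \<Longrightarrow> ustep m \<beta> \<Lambda> f y \<le> \<rho> * f y"
    and "\<And>s y. Q (Suc s) y \<Longrightarrow> Q s y" "\<And>s y j. Q (Suc s) y \<Longrightarrow> j \<in> {1..m} \<Longrightarrow> Q s (grow y j)"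
    and "Q N x"
  shows "(ustep m \<beta> \<Lambda> ^^ N) f x \<le> \<rho> ^ N * f x"
proof (rule ustep_pow_le[where Q=Q and F="\<lambda>s y. \<rho> ^ s * f y"])
  fix s y assume "Q (Suc s) y"
  then have "\<rho> ^ s * ustep m \<beta> \<Lambda> f y \<le> \<rho> ^ s * (\<rho> * f y)"
    using assms by (intro mult_left_mono) auto
  then show "ustep m \<beta> \<Lambda> (\<lambda>y. \<rho> ^ s * f y) y \<le> \<rho> ^ Suc s * f y"
    by (simp only: ustep_scale power_Suc2 mult.assoc)
qed (use assms in auto)

lemma ustep_pow_nonneg: "(\<And>y. 0 \<le> f y) \<Longrightarrow> 0 \<le> (ustep m \<beta> \<Lambda> ^^ N) f x"
  using ustep_pow_mono[of "\<lambda>_. 0" f N x] by (simp add: ustep_pow_const)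

section \<open>Poisson representation of the transition function\<close>

definition point :: "(nat \<Rightarrow> nat) \<Rightarrow> (nat \<Rightarrow> nat) \<Rightarrow> real" where
  "point y x = (if x = y then 1 else 0)"

lemma grow_neq: "grow x j \<noteq> x"
  by (metis fun_upd_same n_not_Suc_n)

lemma gen_pow_Suc_crystal:
  "gen_pow (crystal_rate m \<beta>) (Suc n) x y
    = (\<Sum>j\<in>{1..m}. \<beta> (Vn j x) * (gen_pow (crystal_rate m \<beta>) n (grow x j) y - gen_pow (crystal_rate m \<beta>) n x y))"
proof -
  have "(\<Sum>\<^sub>\<infinity>z. ctmc_gen (crystal_rate m \<beta>) x z * gen_pow (crystal_rate m \<beta>) n z y)
    = (\<Sum>j\<in>{1..m}. \<beta> (Vn j x) * (gen_pow (crystal_rate m \<beta>) n (grow x j) y - gen_pow (crystal_rate m \<beta>) n x y))"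
    by (rule gen_finite_jumps) (auto simp: crystal_rate_def grow_neq)
  then show ?thesis by simp
qed

text \<open>On bounded functions the generator has norm at most \<open>2 * \<Lambda>\<close>; hence
  the exponential series in \<open>trans_fun\<close> converges absolutely.\<close>

lemma abs_gen_pow_le: "\<bar>gen_pow (crystal_rate m \<beta>) n x y\<bar> \<le> (2 * \<Lambda>) ^ n"
proof (induction n arbitrary: x)
  case (Suc n)
  let ?g = "\<lambda>x. gen_pow (crystal_rate m \<beta>) n x y"
  have r: "0 \<le> \<beta> (Vn j x)" for j by (rule rate_nonneg[OF Vn_le_2])
  have "\<bar>gen_pow (crystal_rate m \<beta>) (Suc n) x y\<bar> \<le> (\<Sum>j\<in>{1..m}. \<bar>\<beta> (Vn j x) * (?g (grow x j) - ?g x)\<bar>)"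
    unfolding gen_pow_Suc_crystal by (rule sum_abs)
  also have "\<dots> \<le> (\<Sum>j\<in>{1..m}. \<beta> (Vn j x) * (2 * (2 * \<Lambda>) ^ n))"
  proof (rule sum_mono)
    fix j
    have "\<bar>?g (grow x j) - ?g x\<bar> \<le> 2 * (2 * \<Lambda>) ^ n"
      using Suc[of "grow x j"] Suc[of x] by linarith
    then show "\<bar>\<beta> (Vn j x) * (?g (grow x j) - ?g x)\<bar> \<le> \<beta> (Vn j x) * (2 * (2 * \<Lambda>) ^ n)"
      using r[of j] by (simp add: abs_mult mult_left_mono)
  qed
  also have "\<dots> = (\<Sum>j\<in>{1..m}. \<beta> (Vn j x)) * (2 * (2 * \<Lambda>) ^ n)"
    by (simp add: sum_distrib_right)
  also have "\<dots> \<le> \<Lambda> * (2 * (2 * \<Lambda>) ^ n)"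
    using rates_sum_le \<Lambda>_pos by (intro mult_right_mono) auto
  finally show ?case by (simp add: mult_ac)
qed simp

lemma sum_choose_Suc:
  fixes a :: "nat \<Rightarrow> real"
  shows "(\<Sum>l\<le>Suc N. real (Suc N choose l) * a l)
    = (\<Sum>l\<le>N. real (N choose l) * a l) + (\<Sum>l\<le>N. real (N choose l) * a (Suc l))"
proof -
  have "(\<Sum>l\<le>Suc N. real (Suc N choose l) * a l)
      = a 0 + (\<Sum>l\<le>N. real (Suc N choose Suc l) * a (Suc l))"
    by (subst sum.atMost_Suc_shift) simp
  also have "\<dots> = (a 0 + (\<Sum>l\<le>N. real (N choose Suc l) * a (Suc l))) + (\<Sum>l\<le>N. real (N choose l) * a (Suc l))"
    by (simp add: ring_distribs sum.distrib)
  also have "a 0 + (\<Sum>l\<le>N. real (N choose Suc l) * a (Suc l)) = (\<Sum>l\<le>Suc N. real (N choose l) * a l)"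
    by (subst sum.atMost_Suc_shift) simp
  finally show ?thesis by simp
qed

text \<open>One step is the identity plus the generator divided by \<open>\<Lambda>\<close>, so its
  powers follow the binomial theorem.\<close>

lemma ustep_pow_point:
  "(ustep m \<beta> \<Lambda> ^^ N) (point y) x
    = (\<Sum>l\<le>N. real (N choose l) * (gen_pow (crystal_rate m \<beta>) l x y / \<Lambda> ^ l))"
proof (induction N arbitrary: x)
  case 0 then show ?case by (simp add: point_def)
next
  case (Suc N)
  let ?g = "\<lambda>l x. gen_pow (crystal_rate m \<beta>) l x y / \<Lambda> ^ l"
  have g: "ustep m \<beta> \<Lambda> (?g l) x = ?g l x + ?g (Suc l) x" for l
    unfolding ustep_def gen_pow_Suc_crystal
    by (simp add: sum_divide_distrib diff_divide_distrib mult.commute flip: times_divide_eq_right)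
  have "(ustep m \<beta> \<Lambda> ^^ N) (point y) = (\<lambda>x. \<Sum>l\<le>N. real (N choose l) * ?g l x)"
    using Suc by auto
  then have "(ustep m \<beta> \<Lambda> ^^ Suc N) (point y) x = ustep m \<beta> \<Lambda> (\<lambda>x. \<Sum>l\<le>N. real (N choose l) * ?g l x) x"
    by simp
  also have "\<dots> = (\<Sum>l\<le>N. real (N choose l) * (?g l x + ?g (Suc l) x))"
    by (simp only: ustep_sum ustep_scale g)
  also have "\<dots> = (\<Sum>l\<le>Suc N. real (Suc N choose l) * ?g l x)"
    unfolding sum_choose_Suc by (simp only: ring_distribs sum.distrib)
  finally show ?case .
qed

text \<open>With Q the generator and P = 1 + Q / \<Lambda> this is exp(\<Lambda> t) exp(t Q) =
  exp(\<Lambda> t P), read off entrywise from a Cauchy product.\<close>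

lemma trans_fun_poisson:
  "(\<lambda>N. (\<Lambda> * t) ^ N / fact N * (ustep m \<beta> \<Lambda> ^^ N) (point y) x)
    sums (exp (\<Lambda> * t) * trans_fun (crystal_rate m \<beta>) t x y)"
proof -
  let ?q = "\<lambda>n. gen_pow (crystal_rate m \<beta>) n x y"
  define a where "a n = t ^ n / fact n * ?q n" for n
  define b where "b n = (\<Lambda> * t) ^ n / fact n" for n
  have "summable (\<lambda>n. norm (a n))"
  proof (rule summable_comparison_test')
    show "summable (\<lambda>n. (\<bar>t\<bar> * (2 * \<Lambda>)) ^ n / fact n)"
      using summable_exp[of "\<bar>t\<bar> * (2 * \<Lambda>)"] by (simp add: field_simps)
    fix n
    have "\<bar>t\<bar> ^ n / fact n * \<bar>?q n\<bar> \<le> \<bar>t\<bar> ^ n / fact n * (2 * \<Lambda>) ^ n"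
      using abs_gen_pow_le by (intro mult_left_mono) auto
    then show "norm (norm (a n)) \<le> (\<bar>t\<bar> * (2 * \<Lambda>)) ^ n / fact n"
      by (simp add: a_def abs_mult power_mult_distrib power_abs)
  qed
  moreover have "summable (\<lambda>n. norm (b n))"
    using summable_norm_exp[of "\<Lambda> * t"] by (simp add: b_def field_simps)
  ultimately have "(\<lambda>k. \<Sum>i\<le>k. a i * b (k - i)) sums ((\<Sum>n. a n) * (\<Sum>n. b n))"
    by (rule Cauchy_product_sums)
  moreover have "(\<Sum>n. b n) = exp (\<Lambda> * t)"
    by (simp add: b_def exp_def divide_inverse mult.commute scaleR_conv_of_real)
  moreover have "(\<Sum>n. a n) = trans_fun (crystal_rate m \<beta>) t x y"
    by (simp add: a_def trans_fun_def)
  moreover have "(\<Sum>i\<le>k. a i * b (k - i)) = (\<Lambda> * t) ^ k / fact k * (ustep m \<beta> \<Lambda> ^^ k) (point y) x" for k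
    unfolding ustep_pow_point sum_distrib_left
  proof (rule sum.cong)
    fix i assume "i \<in> {..k}"
    then have i: "i \<le> k" by simp
    have "(\<Lambda> * t) ^ k = (\<Lambda> * t) ^ (k - i) * (\<Lambda> ^ i * t ^ i)"
      using i by (simp add: power_add[symmetric] flip: power_mult_distrib)
    then show "a i * b (k - i) = (\<Lambda> * t) ^ k / fact k * (real (k choose i) * (?q i / \<Lambda> ^ i))"
      using \<Lambda>_pos by (simp add: a_def b_def binomial_fact[OF i])
  qed simp
  ultimately show ?thesis by (simp add: mult.commute)
qed

lemma trans_fun_nonneg: 
  assumes "0 \<le> t" shows "0 \<le> trans_fun (crystal_rate m \<beta>) t x y"
proof -
  have "0 \<le> exp (\<Lambda> * t) * trans_fun (crystal_rate m \<beta>) t x y"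
    by (rule sums_le[OF _ sums_zero trans_fun_poisson])
       (use assms \<Lambda>_pos in \<open>auto intro!: mult_nonneg_nonneg divide_nonneg_nonneg ustep_pow_nonneg simp: point_def\<close>)
  then show ?thesis by (simp add: zero_le_mult_iff)
qed

text \<open>Chernoff bound in continuous time: growth \<open>\<nu> ^ N\<close> along the steps
  becomes \<open>exp (\<Lambda> * t * (\<nu> - 1))\<close> when \<open>N\<close> is Poisson with
  mean \<open>\<Lambda> * t\<close>.\<close>

lemma sum_trans_fun_le:
  assumes t: "0 \<le> t" and F: "finite F" and w: "\<And>y. 0 \<le> w y" "\<And>y. y \<in> F \<Longrightarrow> 1 \<le> w y"
    and c: "\<And>N. (ustep m \<beta> \<Lambda> ^^ N) w x \<le> c * \<nu> ^ N"
  shows "(\<Sum>y\<in>F. trans_fun (crystal_rate m \<beta>) t x y) \<le> c * exp (\<Lambda> * t * (\<nu> - 1))"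
proof -
  let ?u = "ustep m \<beta> \<Lambda>"
  have "(\<lambda>N. \<Sum>y\<in>F. (\<Lambda> * t) ^ N / fact N * (?u ^^ N) (point y) x)
     sums (\<Sum>y\<in>F. exp (\<Lambda> * t) * trans_fun (crystal_rate m \<beta>) t x y)"
    by (intro sums_sum trans_fun_poisson)
  moreover have "(\<lambda>N. c * ((\<Lambda> * t * \<nu>) ^ N / fact N)) sums (c * exp (\<Lambda> * t * \<nu>))"
    using exp_converges[of "\<Lambda> * t * \<nu>"] by (intro sums_mult) (simp add: divide_inverse mult.commute)
  moreover have "(\<Sum>y\<in>F. (\<Lambda> * t) ^ N / fact N * (?u ^^ N) (point y) x) \<le> c * ((\<Lambda> * t * \<nu>) ^ N / fact N)" for N
  proof -
    have "(\<Sum>y\<in>F. (?u ^^ N) (point y) x) = (?u ^^ N) (\<lambda>z. \<Sum>y\<in>F. point y z) x"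
      by (simp only: ustep_pow_sum)
    also have "\<dots> \<le> (?u ^^ N) w x"
      using F w by (intro ustep_pow_mono) (simp add: point_def)
    also have "\<dots> \<le> c * \<nu> ^ N" by (rule c)
    finally have "(\<Lambda> * t) ^ N / fact N * (\<Sum>y\<in>F. (?u ^^ N) (point y) x) \<le> (\<Lambda> * t) ^ N / fact N * (c * \<nu> ^ N)"
      using t \<Lambda>_pos by (intro mult_left_mono) auto
    then show ?thesis by (simp add: sum_distrib_left power_mult_distrib mult_ac)
  qed
  ultimately have "(\<Sum>y\<in>F. exp (\<Lambda> * t) * trans_fun (crystal_rate m \<beta>) t x y) \<le> c * exp (\<Lambda> * t * \<nu>)"
    by (rule sums_le[rotated 1])
  then have "exp (\<Lambda> * t) * (\<Sum>y\<in>F. trans_fun (crystal_rate m \<beta>) t x y) \<le> exp (\<Lambda> * t) * (c * exp (\<Lambda> * t * (\<nu> - 1)))"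
    by (simp add: sum_distrib_left algebra_simps flip: exp_add)
  then show ?thesis by simp
qed

text \<open>Constant weight 1 in the previous bound gives total mass at most 1. Summability matters:
  otherwise \<open>infsum\<close> would be 0 by convention and \<open>crystal_tail\<close> would
  carry no information.\<close>

lemma trans_fun_summable_on:
  assumes "0 \<le> t" shows "trans_fun (crystal_rate m \<beta>) t x summable_on A"
proof (rule nonneg_bdd_above_summable_on)
  show "bdd_above (sum (trans_fun (crystal_rate m \<beta>) t x) ` {F. F \<subseteq> A \<and> finite F})"
  proof (rule bdd_aboveI2)
    fix F assume "F \<in> {F. F \<subseteq> A \<and> finite F}"
    then show "sum (trans_fun (crystal_rate m \<beta>) t x) F \<le> 1 * exp (\<Lambda> * t * (1 - 1))"
      using assms by (intro sum_trans_fun_le[where w="\<lambda>_. 1"]) (auto simp: ustep_pow_const)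
  qed
qed (use assms trans_fun_nonneg in auto)

text \<open>Makes the tail hypothesis usable for steps. Fewer than \<open>K\<close> steps from zero
  keep all heights below \<open>K\<close>, so the truncated Poisson series sees only the finite set
  \<open>F\<close> of states.\<close>

lemma crystal_tail_ge:
  assumes t: "0 \<le> t"
  shows "(\<Sum>N<K. (\<Lambda> * t) ^ N / fact N * (ustep m \<beta> \<Lambda> ^^ N) (\<lambda>y. if d * t \<le> real (y m) then 1 else 0) (\<lambda>_. 0))
    \<le> exp (\<Lambda> * t) * crystal_tail m \<beta> t d"
proof -
  let ?u = "ustep m \<beta> \<Lambda>" and ?z = "\<lambda>_::nat. 0::nat"
  let ?T = "trans_fun (crystal_rate m \<beta>) t ?z"
  define F where "F = {y. d * t \<le> real (y m) \<and> crystal_config m y \<and> (\<forall>i. y i \<le> K)}"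
  have "F \<subseteq> {f. \<forall>i. (i \<in> {1..m} \<longrightarrow> f i \<in> {..K}) \<and> (i \<notin> {1..m} \<longrightarrow> f i = 0)}"
    by (auto simp: F_def crystal_config_def not_less_eq_eq)
  then have finF: "finite F"
    by (rule finite_subset) (intro finite_set_of_finite_funs, auto)
  have le: "(?u ^^ N) (\<lambda>y. if d * t \<le> real (y m) then 1 else 0) ?z \<le> (\<Sum>y\<in>F. (?u ^^ N) (point y) ?z)"
    if "N < K" for N
  proof -
    define Q where "Q s y \<longleftrightarrow> crystal_config m y \<and> (\<forall>i. y i + s \<le> K)" for s and y :: "nat \<Rightarrow> nat"
    have "(?u ^^ N) (\<lambda>y. if d * t \<le> real (y m) then 1 else 0) ?z
      \<le> (?u ^^ N) (\<lambda>z. \<Sum>y\<in>F. point y z) ?z"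
    proof (rule ustep_pow_le[where Q=Q and F="\<lambda>s. (?u ^^ s) (\<lambda>z. \<Sum>y\<in>F. point y z)"])
      fix y assume "Q 0 y"
      then show "(if d * t \<le> real (y m) then 1 else 0) \<le> (?u ^^ 0) (\<lambda>z. \<Sum>y\<in>F. point y z) y"
        using finF by (auto simp: Q_def F_def point_def)
    next
      fix s y j assume "Q (Suc s) y" "j \<in> {1..m}"
      then show "Q s (grow y j)"
        unfolding Q_def crystal_config_def
        by (auto) (metis Suc_leD add_Suc_right)
    next
      fix s y assume "Q (Suc s) y"
      then show "Q s y" unfolding Q_def by (metis Suc_leD add_Suc_right)
    next
      show "Q N ?z" using that by (auto simp: Q_def crystal_config_def)
    qed simp
    then show ?thesis by (simp only: ustep_pow_sum)
  qed
  have "(\<Sum>N<K. (\<Lambda> * t) ^ N / fact N * (?u ^^ N) (\<lambda>y. if d * t \<le> real (y m) then 1 else 0) ?z)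
    \<le> (\<Sum>N<K. (\<Lambda> * t) ^ N / fact N * (\<Sum>y\<in>F. (?u ^^ N) (point y) ?z))"
    using le t \<Lambda>_pos by (intro sum_mono mult_left_mono) auto
  also have "\<dots> = (\<Sum>y\<in>F. \<Sum>N<K. (\<Lambda> * t) ^ N / fact N * (?u ^^ N) (point y) ?z)"
    by (subst sum.swap) (simp add: sum_distrib_left)
  also have "\<dots> \<le> (\<Sum>y\<in>F. exp (\<Lambda> * t) * ?T y)"
  proof (rule sum_mono)
    fix y
    show "(\<Sum>N<K. (\<Lambda> * t) ^ N / fact N * (?u ^^ N) (point y) ?z) \<le> exp (\<Lambda> * t) * ?T y"
      unfolding sums_unique[OF trans_fun_poisson]
      by (rule sum_le_suminf[OF sums_summable[OF trans_fun_poisson]])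
         (use t \<Lambda>_pos in \<open>auto intro!: mult_nonneg_nonneg divide_nonneg_nonneg ustep_pow_nonneg simp: point_def\<close>)
  qed
  also have "\<dots> = exp (\<Lambda> * t) * (\<Sum>y\<in>F. ?T y)" by (simp add: sum_distrib_left)
  also have "(\<Sum>y\<in>F. ?T y) \<le> crystal_tail m \<beta> t d"
    unfolding crystal_tail_def
    by (rule finite_sum_le_infsum[OF trans_fun_summable_on[OF t] finF])
       (use trans_fun_nonneg[OF t] in \<open>auto simp: F_def\<close>)
  finally show ?thesis by simp
qed

text \<open>A priori Chernoff bound with exponent 1, the rate of the last site being at most
  \<open>B\<close>. It later shows that the set whose infimum is \<open>tilde_d\<close> is not
  empty.\<close>

lemma crystal_tail_le:
  assumes t: "0 \<le> t" and m: "1 \<le> m" and B: "\<And>v. v \<le> 2 \<Longrightarrow> \<beta> v \<le> B" "0 \<le> B"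
  shows "crystal_tail m \<beta> t d \<le> exp (- (d * t)) * exp (B * (exp 1 - 1) * t)"
proof -
  define \<nu> where "\<nu> = 1 + B / \<Lambda> * (exp 1 - 1)"
  have nu0: "0 \<le> \<nu>" unfolding \<nu>_def using B \<Lambda>_pos by simp
  have step: "ustep m \<beta> \<Lambda> (\<lambda>y. exp (1 * real (y m))) y \<le> \<nu> * exp (1 * real (y m))" for y
  proof -
    have "\<beta> (Vn m y) / \<Lambda> * (exp 1 - 1) * exp (1 * real (y m)) \<le> B / \<Lambda> * (exp 1 - 1) * exp (1 * real (y m))"
      using B(1)[OF Vn_le_2] \<Lambda>_pos by (intro mult_right_mono divide_right_mono) auto
    then show ?thesis
      using m by (subst ustep_exp_site) (auto simp: \<nu>_def algebra_simps)
  qed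
  have pow: "(ustep m \<beta> \<Lambda> ^^ N) (\<lambda>y. exp (- (d * t)) * exp (1 * real (y m))) (\<lambda>_. 0) \<le> exp (- (d * t)) * \<nu> ^ N" for N
    using ustep_pow_geometric[where Q="\<lambda>_ _. True" and f="\<lambda>y. exp (1 * real (y m))", OF nu0 step, of N "\<lambda>_. 0"]
    unfolding ustep_pow_scale by simp
  have "\<Lambda> * t * (\<nu> - 1) = B * (exp 1 - 1) * t"
    using \<Lambda>_pos by (simp add: \<nu>_def)
  then have "(\<Sum>y\<in>F. trans_fun (crystal_rate m \<beta>) t (\<lambda>_. 0) y) \<le> exp (- (d * t)) * exp (B * (exp 1 - 1) * t)"
    if F: "finite F" "F \<subseteq> {y. d * t \<le> real (y m)}" for F
  proof -
    have "1 \<le> exp (- (d * t)) * exp (1 * real (y m))" if "y \<in> F" for y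
      using that F(2) by (auto simp flip: exp_add)
    then show ?thesis
      using sum_trans_fun_le[OF t F(1) _ _ pow] \<open>\<Lambda> * t * (\<nu> - 1) = B * (exp 1 - 1) * t\<close> by simp
  qed
  then show ?thesis
    unfolding crystal_tail_def
    by (intro infsum_le_finite_sums trans_fun_summable_on[OF t]) auto
qed

end

section \<open>Exponential moments of the attractive process\<close>

definition exp_sum :: "nat set \<Rightarrow> real \<Rightarrow> (nat \<Rightarrow> nat) \<Rightarrow> real" where
  "exp_sum I \<theta> y = (\<Sum>i\<in>I. exp (\<theta> * real (y i)))"

lemma Vn_mono:
  assumes "x \<le> y" "x j = y j" shows "Vn j x \<le> Vn j y"
proof -
  have "x (j - 1) \<le> y (j - 1)" "x (j + 1) \<le> y (j + 1)" using assms by (auto simp: le_fun_def)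
  then show ?thesis using assms(2) by (auto simp: Vn_def)
qed

lemma ustep_exp_gap:
  assumes i: "1 \<le> i" "i < m"
  shows "ustep m \<beta> \<Lambda> (\<lambda>y. exp (\<phi> * (real (y i) - real (y (Suc i))))) x
    = exp (\<phi> * (real (x i) - real (x (Suc i))))
      * (1 + \<beta> (Vn i x) / \<Lambda> * (exp \<phi> - 1) + \<beta> (Vn (Suc i) x) / \<Lambda> * (exp (- \<phi>) - 1))"
proof -
  let ?E = "exp (\<phi> * (real (x i) - real (x (Suc i))))"
  have "(\<Sum>j\<in>{1..m}. \<beta> (Vn j x) / \<Lambda> * (exp (\<phi> * (real (grow x j i) - real (grow x j (Suc i)))) - ?E))
      = (\<Sum>j\<in>{1..m}. (if j = i then \<beta> (Vn i x) / \<Lambda> * (exp \<phi> - 1) * ?E else 0)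
          + (if j = Suc i then \<beta> (Vn (Suc i) x) / \<Lambda> * (exp (- \<phi>) - 1) * ?E else 0))"
  proof (intro sum.cong refl)
    fix j
    have "exp (\<phi> * (real (Suc (x i)) - real (x (Suc i)))) = exp \<phi> * ?E"
         "exp (\<phi> * (real (x i) - real (Suc (x (Suc i))))) = exp (- \<phi>) * ?E"
      by (simp_all add: algebra_simps flip: exp_add)
    then show "\<beta> (Vn j x) / \<Lambda> * (exp (\<phi> * (real (grow x j i) - real (grow x j (Suc i)))) - ?E)
      = (if j = i then \<beta> (Vn i x) / \<Lambda> * (exp \<phi> - 1) * ?E else 0)
          + (if j = Suc i then \<beta> (Vn (Suc i) x) / \<Lambda> * (exp (- \<phi>) - 1) * ?E else 0)"
      by (auto simp: left_diff_distrib mult.assoc simp del: of_nat_Suc times_divide_eq_left)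
  qed
  also have "\<dots> = \<beta> (Vn i x) / \<Lambda> * (exp \<phi> - 1) * ?E + \<beta> (Vn (Suc i) x) / \<Lambda> * (exp (- \<phi>) - 1) * ?E"
    using i by (simp add: sum.distrib sum.delta)
  finally show ?thesis by (simp add: ustep_def algebra_simps)
qed

text \<open>The sites outside \<open>1..m\<close> stay at 0, so that the result is again a
  configuration.\<close>

definition lift :: "nat \<Rightarrow> nat \<Rightarrow> (nat \<Rightarrow> nat) \<Rightarrow> nat \<Rightarrow> nat" where
  "lift m c x i = (if i \<in> {1..m} then x i + c else 0)"

lemma lift_grow: "j \<in> {1..m} \<Longrightarrow> lift m c (grow x j) = grow (lift m c x) j"
  by (auto simp: lift_def)

lemma crystal_config_grow: "crystal_config m x \<Longrightarrow> j \<in> {1..m} \<Longrightarrow> crystal_config m (grow x j)"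
  by (auto simp: crystal_config_def)

text \<open>Differences inside are unchanged, and a boundary zero is never higher than a site,
  before or after lifting.\<close>

lemma Vn_lift:
  assumes "crystal_config m x" "j \<in> {1..m}" shows "Vn j (lift m c x) = Vn j x"
proof -
  have "x 0 = 0" "x (Suc m) = 0" using assms by (auto simp: crystal_config_def)
  moreover have "j - Suc 0 \<in> {1..m} \<or> j = 1" "Suc j \<in> {1..m} \<or> j = m" using assms(2) by auto
  ultimately show ?thesis using assms(2) by (auto simp: Vn_def lift_def)
qed

text \<open>\<open>(1 - x + x\<^sup>2) * (1 + x) = 1 + x ^ 3\<close> is at least 1, and
  \<open>1 + x\<close> is at most \<open>exp x\<close>.\<close>

lemma exp_minus_le_quadratic:
  fixes x :: real
  assumes "0 \<le> x" shows "exp (- x) \<le> 1 - x + x\<^sup>2"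
proof -
  have "1 \<le> (1 - x + x\<^sup>2) * (1 + x)" using assms by (simp add: algebra_simps power2_eq_square)
  also have "\<dots> \<le> (1 - x + x\<^sup>2) * exp x"
  proof (rule mult_left_mono)
    have "1 - x + x\<^sup>2 = (1 - x / 2)\<^sup>2 + 3 * (x / 2)\<^sup>2" by (simp add: power2_eq_square algebra_simps)
    then show "0 \<le> 1 - x + x\<^sup>2" by simp
  qed simp
  finally show ?thesis by (simp add: exp_minus field_simps)
qed

lemma exp_le_1_plus_double: "0 \<le> x \<Longrightarrow> x \<le> 1 \<Longrightarrow> exp x - 1 \<le> 2 * (x::real)"
  using exp_bound[of x] mult_left_mono[of x 1 x] by (simp add: power2_eq_square)

lemma exp_partial_sum_le:
  fixes z :: real
  assumes "0 \<le> z" shows "(\<Sum>N<K. z ^ N / fact N) \<le> exp z"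
proof -
  have "(\<lambda>N. z ^ N / fact N) sums exp z"
    using exp_converges[of z] by (simp add: divide_inverse mult.commute)
  then show ?thesis using assms
    by (metis (no_types, lifting) sums_unique sums_summable sum_le_suminf finite_lessThan
        divide_nonneg_nonneg zero_le_power fact_ge_zero)
qed

lemma crystal_config_zero: "crystal_config m (\<lambda>_. 0)"
  by (simp add: crystal_config_def)

text \<open>With \<open>\<beta> 2 = \<beta> 1\<close> the rate is nondecreasing in the number of
  higher neighbours; together with \<open>Vn_mono\<close> this is attractiveness.\<close>

locale attractive_crystal = uniformized +
  assumes m_pos: "1 \<le> m" and \<beta>01: "\<beta> 0 \<le> \<beta> 1" and \<beta>12: "\<beta> 2 = \<beta> 1" and \<beta>1_pos: "0 < \<beta> 1"
begin

lemma \<beta>_le: "v \<le> 2 \<Longrightarrow> \<beta> v \<le> \<beta> 1"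
  using \<beta>01 \<beta>12 by (cases "v = 0"; cases "v = 1"; cases "v = 2") auto

lemma \<beta>_mono: "v \<le> w \<Longrightarrow> w \<le> 2 \<Longrightarrow> \<beta> v \<le> \<beta> w"
  using \<beta>_le[of v] \<beta>12 by (cases "w = 0"; cases "w = 1"; cases "w = 2") auto

text \<open>The basic coupling of ordered configurations, in analytic form. At a site of equal
  height the upper copy is at least as fast; at a strictly lower site a solo jump of the lower copy
  keeps the order. Each site loses at most \<open>\<beta> 1 * D\<close>, and
  \<open>real m * \<beta> 1 \<le> \<Lambda>\<close> lets \<open>D\<close> cover all losses.\<close>

lemma mono_ustep:
  assumes f: "mono f" shows "mono (ustep m \<beta> \<Lambda> f)"
proof (rule monoI)
  fix x y :: "nat \<Rightarrow> nat" assume xy: "x \<le> y"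
  define D where "D = f y - f x"
  have D: "0 \<le> D" using f xy by (simp add: D_def monoD)
  have up: "f z \<le> f (grow z j)" for z j
    by (rule monoD[OF f]) (simp add: le_fun_def)
  have r0: "0 \<le> \<beta> (Vn j z)" and r1: "\<beta> (Vn j z) \<le> \<beta> 1" for j z
    using rate_nonneg \<beta>_le Vn_le_2 by auto
  have "\<beta> (Vn j x) * (f (grow x j) - f x) - \<beta> 1 * D \<le> \<beta> (Vn j y) * (f (grow y j) - f y)" for j
  proof (cases "x j = y j")
    case True
    have "grow x j \<le> grow y j" using xy True by (simp add: le_fun_def)
    then have "f (grow x j) \<le> f (grow y j)" by (rule monoD[OF f])
    then have "\<beta> (Vn j x) * (f (grow x j) - f x - D) \<le> \<beta> (Vn j x) * (f (grow y j) - f y)"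
      using r0 by (intro mult_left_mono) (auto simp: D_def)
    also have "\<dots> \<le> \<beta> (Vn j y) * (f (grow y j) - f y)"
      using up[of y j] \<beta>_mono[OF Vn_mono[OF xy True] Vn_le_2] by (intro mult_right_mono) auto
    finally show ?thesis using mult_right_mono[OF r1[of j x] D] by (simp add: algebra_simps)
  next
    case False
    have "x j < y j" using xy False by (metis le_fun_def le_neq_implies_less)
    then have "grow x j \<le> y" using xy by (auto simp: le_fun_def)
    then have "f (grow x j) \<le> f y" by (rule monoD[OF f])
    then have "\<beta> (Vn j x) * (f (grow x j) - f x) \<le> \<beta> (Vn j x) * D"
      using r0 by (intro mult_left_mono) (auto simp: D_def)
    then have "\<beta> (Vn j x) * (f (grow x j) - f x) \<le> \<beta> 1 * D"
      using mult_right_mono[OF r1[of j x] D] by linarith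
    moreover have "0 \<le> \<beta> (Vn j y) * (f (grow y j) - f y)" using up[of y j] r0 by simp
    ultimately show ?thesis by linarith
  qed
  then have "(\<Sum>j\<in>{1..m}. (\<beta> (Vn j x) * (f (grow x j) - f x) - \<beta> 1 * D) / \<Lambda>)
      \<le> (\<Sum>j\<in>{1..m}. \<beta> (Vn j y) * (f (grow y j) - f y) / \<Lambda>)"
    using \<Lambda>_pos by (intro sum_mono divide_right_mono) auto
  moreover have "real m * (\<beta> 1 * D / \<Lambda>) \<le> D"
  proof -
    have "real m * \<beta> 1 * D \<le> \<Lambda> * D" using rate_le[of 1] D by (intro mult_right_mono) auto
    then show ?thesis using \<Lambda>_pos by (simp add: field_simps)
  qed
  ultimately show "ustep m \<beta> \<Lambda> f x \<le> ustep m \<beta> \<Lambda> f y"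
    by (simp add: ustep_def D_def diff_divide_distrib sum_subtractf)
qed

lemma mono_ustep_pow: "mono f \<Longrightarrow> mono ((ustep m \<beta> \<Lambda> ^^ N) f)"
  by (induction N) (simp_all add: mono_ustep)

lemma mono_exp_sum: "0 \<le> \<theta> \<Longrightarrow> mono (exp_sum I \<theta>)"
  unfolding exp_sum_def by (intro monoI sum_mono) (auto simp: le_fun_def intro!: mult_left_mono)

section \<open>Moment growth from flat starts\<close>

definition growth :: "real \<Rightarrow> nat \<Rightarrow> real" where
  "growth \<theta> N = (ustep m \<beta> \<Lambda> ^^ N) (exp_sum {1..m} \<theta>) (\<lambda>_. 0)"

lemma ustep_pow_lift:
  "crystal_config m x \<Longrightarrow> (ustep m \<beta> \<Lambda> ^^ N) (exp_sum {1..m} \<theta>) (lift m c x)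
    = exp (\<theta> * real c) * (ustep m \<beta> \<Lambda> ^^ N) (exp_sum {1..m} \<theta>) x"
proof (induction N arbitrary: x)
  case 0
  show ?case
    unfolding funpow_0 exp_sum_def sum_distrib_left
    by (intro sum.cong refl) (simp add: lift_def algebra_simps flip: exp_add)
next
  case (Suc N)
  let ?f = "(ustep m \<beta> \<Lambda> ^^ N) (exp_sum {1..m} \<theta>)"
  have "ustep m \<beta> \<Lambda> ?f (lift m c x) = exp (\<theta> * real c) * ?f x
      + (\<Sum>j\<in>{1..m}. \<beta> (Vn j x) / \<Lambda> * (exp (\<theta> * real c) * ?f (grow x j) - exp (\<theta> * real c) * ?f x))"
    unfolding ustep_def[of _ _ _ ?f "lift m c x"]
  proof (intro arg_cong2[of _ _ _ _ "(+)"] sum.cong refl Suc.IH Suc.prems)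
    fix j assume j: "j \<in> {1..m}"
    show "\<beta> (Vn j (lift m c x)) / \<Lambda> * (?f (grow (lift m c x) j) - ?f (lift m c x))
      = \<beta> (Vn j x) / \<Lambda> * (exp (\<theta> * real c) * ?f (grow x j) - exp (\<theta> * real c) * ?f x)"
      by (simp only: Vn_lift[OF Suc.prems j] lift_grow[OF j, symmetric] Suc.IH[OF Suc.prems]
          Suc.IH[OF crystal_config_grow[OF Suc.prems j]])
  qed
  also have "\<dots> = exp (\<theta> * real c) * ustep m \<beta> \<Lambda> ?f x"
    by (simp add: ustep_def algebra_simps sum_distrib_left sum_subtractf)
  finally show ?case by simp
qed

text \<open>By attractiveness a configuration may be replaced by the flat one at height
  \<open>M\<close>, a translate of the zero configuration.\<close>

lemma ustep_pow_le_growth: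
  assumes "0 \<le> \<theta>" "crystal_config m x" "\<And>i. x i \<le> M"
  shows "(ustep m \<beta> \<Lambda> ^^ N) (exp_sum {1..m} \<theta>) x \<le> exp (\<theta> * real M) * growth \<theta> N"
proof -
  have "x \<le> lift m M (\<lambda>_. 0)"
    using assms(2,3) by (auto simp: le_fun_def lift_def crystal_config_def not_less_eq_eq)
  then have "(ustep m \<beta> \<Lambda> ^^ N) (exp_sum {1..m} \<theta>) x
      \<le> (ustep m \<beta> \<Lambda> ^^ N) (exp_sum {1..m} \<theta>) (lift m M (\<lambda>_. 0))"
    by (rule monoD[OF mono_ustep_pow[OF mono_exp_sum[OF assms(1)]]])
  then show ?thesis by (simp only: ustep_pow_lift growth_def crystal_config_zero)
qed

lemma growth_nonneg: "0 \<le> growth \<theta> N"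
  unfolding growth_def by (intro ustep_pow_nonneg) (simp add: exp_sum_def sum_nonneg)

text \<open>After \<open>s\<close> steps the process is restarted from the flat configuration at its
  current maximum \<open>M\<close>. The sum over sites dominates \<open>exp (\<theta> * M)\<close>,
  which closes the recursion without a constant.\<close>

lemma growth_add:
  assumes "0 \<le> \<theta>" shows "growth \<theta> (N + s) \<le> growth \<theta> N * growth \<theta> s"
proof -
  let ?u = "ustep m \<beta> \<Lambda>" and ?A = "exp_sum {1..m} \<theta>"
  have le: "(?u ^^ N) ?A x \<le> growth \<theta> N * ?A x" if x: "crystal_config m x" for x
  proof -
    define M where "M = Max (x ` {1..m})"
    have "M \<in> x ` {1..m}" unfolding M_def using m_pos by (intro Max_in) auto
    then obtain i where i: "i \<in> {1..m}" "M = x i" by auto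
    have "x j \<le> M" for j
    proof (cases "j \<in> {1..m}")
      case True then show ?thesis unfolding M_def by (intro Max_ge) auto
    next
      case False then show ?thesis using x by (auto simp: crystal_config_def not_less_eq_eq)
    qed
    then have "(?u ^^ N) ?A x \<le> exp (\<theta> * real M) * growth \<theta> N"
      by (intro ustep_pow_le_growth assms x)
    also have "exp (\<theta> * real M) \<le> ?A x"
      unfolding exp_sum_def i(2) by (rule member_le_sum[OF i(1), of "\<lambda>i. exp (\<theta> * real (x i))"]) auto
    finally show ?thesis using growth_nonneg[of \<theta> N] by (simp add: mult.commute mult_right_mono)
  qed
  have "(?u ^^ s) ((?u ^^ N) ?A) (\<lambda>_. 0) \<le> (?u ^^ s) (\<lambda>x. growth \<theta> N * ?A x) (\<lambda>_. 0)"
    by (rule ustep_pow_le[where Q="\<lambda>_. crystal_config m" and F="\<lambda>s. (?u ^^ s) (\<lambda>x. growth \<theta> N * ?A x)"])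
       (use le in \<open>auto simp: crystal_config_grow crystal_config_zero\<close>)
  then show ?thesis
    by (simp add: ustep_pow_scale growth_def add.commute[of N] funpow_add)
qed

text \<open>One good \<open>N\<close> controls all its multiples; the factor \<open>m\<close> is the
  value at time 0.\<close>

lemma growth_mult:
  assumes "0 \<le> \<theta>" "growth \<theta> N \<le> \<rho> ^ N" "0 \<le> \<rho>"
  shows "growth \<theta> (q * N) \<le> real m * \<rho> ^ (q * N)"
proof (induction q)
  case 0 show ?case by (simp add: growth_def exp_sum_def)
next
  case (Suc q)
  have "growth \<theta> (Suc q * N) \<le> growth \<theta> N * growth \<theta> (q * N)"
    using growth_add[OF assms(1), of N "q * N"] by simp
  also have "\<dots> \<le> \<rho> ^ N * (real m * \<rho> ^ (q * N))"
    using assms Suc growth_nonneg by (intro mult_mono) auto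
  finally show ?case by (simp add: power_add mult_ac)
qed

text \<open>The tail assumption only concerns the last site. It carries over to the other ones because
  the lower of two adjacent sites already grows at the maximal rate \<open>\<beta> 1\<close>, so that gaps are driftless.
  The additive constant \<open>K\<close> of the proof absorbs the drift at gap zero.\<close>

lemma gap_moment:
  assumes i: "1 \<le> i" "i < m" and \<phi>: "0 < \<phi>"
  defines "c \<equiv> exp \<phi> + exp (- \<phi>) - 2"
  shows "(ustep m \<beta> \<Lambda> ^^ N) (\<lambda>y. exp (\<phi> * (real (y i) - real (y (Suc i))))) (\<lambda>_. 0)
    \<le> (1 + (exp \<phi> - 1) / c) * (1 + \<beta> 1 * c / \<Lambda>) ^ N"
proof -
  \<comment> \<open>\<open>c\<close> is a second difference of \<open>exp\<close>, of order
    \<open>\<phi>\<^sup>2\<close>: driftless gaps have no first-order term. Since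
    \<open>K * c = exp \<phi> - 1\<close>, the product \<open>(\<mu> - 1) * K\<close> is the largest
    possible drift of \<open>E\<close> where \<open>E x \<le> 1\<close>.\<close>
  define K where "K = (exp \<phi> - 1) / c"
  define \<mu> where "\<mu> = 1 + \<beta> 1 * c / \<Lambda>"
  define E where "E y = exp (\<phi> * (real (y i) - real (y (Suc i))))" for y :: "nat \<Rightarrow> nat"
  have "c = (exp (\<phi> / 2) - exp (- \<phi> / 2))\<^sup>2"
    unfolding c_def power2_diff by (simp add: power2_eq_square mult.assoc flip: exp_add)
  moreover have "exp (\<phi> / 2) - exp (- \<phi> / 2) > 0" using \<phi> by simp
  ultimately have c: "0 < c" by simp
  have K: "0 \<le> K" "K * c = exp \<phi> - 1" unfolding K_def using c \<phi> by auto
  have \<mu>: "0 \<le> \<mu>" "\<mu> - 1 = \<beta> 1 * c / \<Lambda>" unfolding \<mu>_def using c \<beta>1_pos \<Lambda>_pos by auto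
  have step: "ustep m \<beta> \<Lambda> (\<lambda>y. E y + K) x \<le> \<mu> * (E x + K)" for x
  proof -
    let ?a = "\<beta> (Vn i x) / \<Lambda> * (exp \<phi> - 1)" and ?b = "\<beta> (Vn (Suc i) x) / \<Lambda> * (exp (- \<phi>) - 1)"
    have a: "?a \<le> \<beta> 1 / \<Lambda> * (exp \<phi> - 1)"
      using \<beta>_le[OF Vn_le_2] \<phi> \<Lambda>_pos by (intro mult_right_mono divide_right_mono) auto
    have eq: "ustep m \<beta> \<Lambda> (\<lambda>y. E y + K) x = E x * (1 + ?a + ?b) + K"
      unfolding E_def ustep_add ustep_const ustep_exp_gap[OF i] ..
    have "E x * (?a + ?b) \<le> (\<mu> - 1) * (E x + K)"
    proof (cases "x (Suc i) < x i")
      case True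
      then have "Vn (Suc i) x = 1 \<or> Vn (Suc i) x = 2" by (auto simp: Vn_def)
      then have "\<beta> (Vn (Suc i) x) = \<beta> 1" using \<beta>12 by auto
      then have "?a + ?b \<le> \<beta> 1 / \<Lambda> * (exp \<phi> - 1) + \<beta> 1 / \<Lambda> * (exp (- \<phi>) - 1)"
        using a by simp
      also have "\<dots> = \<mu> - 1" unfolding \<mu>(2) c_def by (simp add: add_divide_distrib diff_divide_distrib algebra_simps)
      finally have "E x * (?a + ?b) \<le> E x * (\<mu> - 1)" by (intro mult_left_mono) (simp_all add: E_def)
      also have "\<dots> \<le> (\<mu> - 1) * (E x + K)"
        using K c \<beta>1_pos \<Lambda>_pos unfolding \<mu>(2) by (subst mult.commute, intro mult_left_mono) auto
      finally show ?thesis .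
    next
      case False
      then have E1: "E x \<le> 1" using \<phi> by (simp add: E_def mult_nonneg_nonpos)
      have "?b \<le> 0" using rate_nonneg[OF Vn_le_2] \<phi> \<Lambda>_pos by (intro mult_nonneg_nonpos) auto
      then have "E x * (?a + ?b) \<le> E x * (\<beta> 1 / \<Lambda> * (exp \<phi> - 1))"
        using a by (intro mult_left_mono) (auto simp: E_def)
      also have "\<dots> \<le> 1 * (\<beta> 1 / \<Lambda> * (exp \<phi> - 1))"
        using E1 \<beta>1_pos \<Lambda>_pos \<phi> by (intro mult_right_mono) auto
      also have "\<dots> = (\<mu> - 1) * K" unfolding \<mu>(2) K(2)[symmetric] by simp
      also have "\<dots> \<le> (\<mu> - 1) * (E x + K)"
        using c \<beta>1_pos \<Lambda>_pos unfolding \<mu>(2) by (intro mult_left_mono) (auto simp: E_def)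
      finally show ?thesis .
    qed
    then show ?thesis unfolding eq by (simp add: algebra_simps)
  qed
  have "(ustep m \<beta> \<Lambda> ^^ N) E (\<lambda>_. 0) \<le> (ustep m \<beta> \<Lambda> ^^ N) (\<lambda>y. E y + K) (\<lambda>_. 0)"
    using K by (intro ustep_pow_mono) auto
  also have "\<dots> \<le> \<mu> ^ N * (E (\<lambda>_. 0) + K)"
    by (rule ustep_pow_geometric[where Q="\<lambda>_ _. True"]) (use \<mu> step in auto)
  finally show ?thesis unfolding E_def \<mu>_def K_def by (simp add: mult.commute)
qed

text \<open>Crude bound with every rate replaced by \<open>\<beta> 1\<close>. Taken at
  \<open>2 * \<theta>\<close>, it controls exceptionally large heights in
  \<open>growth_lt_geometric\<close>.\<close>

lemma exp_sum_moment:
  assumes "0 \<le> \<theta>"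
  shows "growth \<theta> N \<le> real m * (1 + \<beta> 1 * (exp \<theta> - 1) / \<Lambda>) ^ N"
proof -
  have pos: "0 \<le> 1 + \<beta> 1 * (exp \<theta> - 1) / \<Lambda>" using \<beta>1_pos \<Lambda>_pos assms by simp
  have "growth \<theta> N \<le> (1 + \<beta> 1 * (exp \<theta> - 1) / \<Lambda>) ^ N * exp_sum {1..m} \<theta> (\<lambda>_. 0)"
    unfolding growth_def
  proof (rule ustep_pow_geometric[where Q="\<lambda>_ _. True", OF pos])
    fix y
    show "ustep m \<beta> \<Lambda> (exp_sum {1..m} \<theta>) y \<le> (1 + \<beta> 1 * (exp \<theta> - 1) / \<Lambda>) * exp_sum {1..m} \<theta> y"
      unfolding exp_sum_def ustep_sum sum_distrib_left
    proof (rule sum_mono)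
      fix i assume i: "i \<in> {1..m}"
      have "\<beta> (Vn i y) / \<Lambda> * (exp \<theta> - 1) \<le> \<beta> 1 * (exp \<theta> - 1) / \<Lambda>"
        using \<beta>_le[OF Vn_le_2] \<Lambda>_pos assms by (simp add: divide_right_mono mult_right_mono)
      then have "\<beta> (Vn i y) / \<Lambda> * (exp \<theta> - 1) * exp (\<theta> * real (y i)) \<le> \<beta> 1 * (exp \<theta> - 1) / \<Lambda> * exp (\<theta> * real (y i))"
        by (intro mult_right_mono) auto
      then show "ustep m \<beta> \<Lambda> (\<lambda>y. exp (\<theta> * real (y i))) y \<le> (1 + \<beta> 1 * (exp \<theta> - 1) / \<Lambda>) * exp (\<theta> * real (y i))"
        unfolding ustep_exp_site[OF i] by (simp add: ring_distribs)
    qed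
  qed auto
  then show ?thesis by (simp add: exp_sum_def mult.commute)
qed

text \<open>If every descent between neighbours were below \<open>b\<close>, the heights could fall
  by at most \<open>m * b\<close> on the way from \<open>i\<close> to \<open>m\<close>.\<close>

lemma gap_exists:
  assumes i: "i \<in> {1..m}" and "real (y m) < a" "a + real m * b < real (y i)" "0 \<le> b"
  shows "\<exists>j\<in>{1..<m}. b \<le> real (y j) - real (y (Suc j))"
proof (rule ccontr)
  assume H: "\<not> ?thesis"
  have "real (y i) \<le> real (y k) + real (k - i) * b" if "i \<le> k" "k \<le> m" for k
    using that
  proof (induction k rule: dec_induct)
    case (step k)
    have "real (y k) - real (y (Suc k)) < b" using H step i by (auto simp: not_le)
    then show ?case using step by (simp add: Suc_diff_le algebra_simps)
  qed simp
  from this[of m] have "real (y i) \<le> real (y m) + real (m - i) * b" using i by simp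
  also have "\<dots> \<le> real (y m) + real m * b" using assms(4) by (intro add_left_mono mult_right_mono) auto
  finally show False using assms by linarith
qed

text \<open>Three ranges of a height. Up to \<open>(d + m * \<epsilon>) * t\<close> it is harmless.
  From \<open>L * t\<close> on, the exponent is doubled. In between, the last site has reached
  \<open>d * t\<close> or, by \<open>gap_exists\<close>, some gap has reached
  \<open>\<epsilon> * t\<close>; these rare events are charged with the worst factor
  \<open>exp (\<theta> * L * t)\<close>.\<close>

lemma exp_sum_le_split:
  assumes \<theta>: "0 \<le> \<theta>" and \<phi>: "0 \<le> \<phi>" and e: "0 \<le> \<epsilon>" and t: "0 \<le> t"
  shows "exp_sum {1..m} \<theta> y \<le> real m * exp (\<theta> * (d + real m * \<epsilon>) * t)
    + real m * exp (\<theta> * L * t) * ((if d * t \<le> real (y m) then 1 else 0)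
        + (\<Sum>j\<in>{1..<m}. exp (- (\<phi> * \<epsilon> * t)) * exp (\<phi> * (real (y j) - real (y (Suc j))))))
    + exp (- (\<theta> * L * t)) * exp_sum {1..m} (2 * \<theta>) y"
proof -
  let ?S = "(if d * t \<le> real (y m) then 1 else 0)
        + (\<Sum>j\<in>{1..<m}. exp (- (\<phi> * \<epsilon> * t)) * exp (\<phi> * (real (y j) - real (y (Suc j)))))"
  have S0: "0 \<le> ?S" by (intro add_nonneg_nonneg sum_nonneg) auto
  have "exp_sum {1..m} \<theta> y \<le> (\<Sum>i\<in>{1..m}. exp (\<theta> * (d + real m * \<epsilon>) * t) + exp (\<theta> * L * t) * ?S
      + exp (- (\<theta> * L * t)) * exp (2 * \<theta> * real (y i)))"
    unfolding exp_sum_def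
  proof (rule sum_mono)
    fix i assume i: "i \<in> {1..m}"
    let ?a = "exp (\<theta> * (d + real m * \<epsilon>) * t)" and ?b = "exp (\<theta> * L * t) * ?S"
      and ?c = "exp (- (\<theta> * L * t)) * exp (2 * \<theta> * real (y i))"
    have b0: "0 \<le> ?b" using S0 by simp
    consider "L * t \<le> real (y i)" | "real (y i) \<le> (d + real m * \<epsilon>) * t"
      | "real (y i) < L * t" "(d + real m * \<epsilon>) * t < real (y i)" by linarith
    then show "exp (\<theta> * real (y i)) \<le> ?a + ?b + ?c"
    proof cases
      case 1
      have "\<theta> * (L * t) \<le> \<theta> * real (y i)" using 1 \<theta> by (intro mult_left_mono)
      then have "exp (\<theta> * real (y i)) \<le> ?c" by (simp add: algebra_simps flip: exp_add)
      then show ?thesis using b0 exp_ge_zero[of "\<theta> * (d + real m * \<epsilon>) * t"] by linarith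
    next
      case 2
      have "\<theta> * real (y i) \<le> \<theta> * ((d + real m * \<epsilon>) * t)" using 2 \<theta> by (intro mult_left_mono)
      then have "exp (\<theta> * real (y i)) \<le> ?a" by (simp add: mult.assoc)
      moreover have "0 \<le> ?c" by simp
      ultimately show ?thesis using b0 by linarith
    next
      case 3
      have "1 \<le> ?S"
      proof (cases "d * t \<le> real (y m)")
        case True then show ?thesis by (auto intro!: sum_nonneg)
      next
        case False
        then obtain j where j: "j \<in> {1..<m}" "\<epsilon> * t \<le> real (y j) - real (y (Suc j))"
          using gap_exists[of i y "d * t" "\<epsilon> * t"] i 3 e t by (auto simp: algebra_simps)
        have "\<phi> * (\<epsilon> * t) \<le> \<phi> * (real (y j) - real (y (Suc j)))" using j \<phi> by (intro mult_left_mono) auto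
        then have "1 \<le> exp (- (\<phi> * \<epsilon> * t)) * exp (\<phi> * (real (y j) - real (y (Suc j))))"
          by (simp add: mult.assoc flip: exp_add)
        also have "\<dots> \<le> (\<Sum>j\<in>{1..<m}. exp (- (\<phi> * \<epsilon> * t)) * exp (\<phi> * (real (y j) - real (y (Suc j)))))"
          using j by (intro member_le_sum[of j _ "\<lambda>j. exp (- (\<phi> * \<epsilon> * t)) * exp (\<phi> * (real (y j) - real (y (Suc j))))"]) auto
        finally show ?thesis using False by simp
      qed
      then have "exp (\<theta> * L * t) * 1 \<le> ?b" by (intro mult_left_mono) auto
      moreover have "\<theta> * real (y i) \<le> \<theta> * (L * t)" using 3 \<theta> by (intro mult_left_mono) auto
      then have "exp (\<theta> * real (y i)) \<le> exp (\<theta> * L * t)" by (simp add: mult.assoc)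
      moreover have "0 \<le> ?a" "0 \<le> ?c" by auto
      ultimately show ?thesis by linarith
    qed
  qed
  also have "\<dots> = real m * exp (\<theta> * (d + real m * \<epsilon>) * t)
    + real m * exp (\<theta> * L * t) * ?S + exp (- (\<theta> * L * t)) * exp_sum {1..m} (2 * \<theta>) y"
    unfolding exp_sum_def by (simp only: sum.distrib sum_distrib_left[symmetric] sum_constant) (simp add: algebra_simps)
  finally show ?thesis .
qed

text \<open>Passes from tails in continuous time to moments in discrete time. Arguing by
  contradiction avoids inverting the Poisson average: lower bounds for every \<open>N\<close>
  survive averaging and would force moments of order \<open>exp (\<theta> * d' * t)\<close>, more
  than the split permits.\<close>

lemma growth_lt_geometric:
  assumes d: "0 < d" "d < d'" and C: "0 < C" "0 < \<alpha>"
    and tail: "\<And>t. 0 \<le> t \<Longrightarrow> crystal_tail m \<beta> t d \<le> C * exp (- \<alpha> * t)"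
  shows "\<exists>\<theta>\<^sub>0>0. \<forall>\<theta>. 0 < \<theta> \<and> \<theta> \<le> \<theta>\<^sub>0 \<longrightarrow> (\<exists>N. growth \<theta> N < (1 + \<theta> * d' / \<Lambda>) ^ N)"
proof -
  define B where "B = \<beta> 1"
  have B: "0 < B" using \<beta>1_pos by (simp add: B_def)
  \<comment> \<open>The gaps share half of the margin, so that \<open>d0\<close> is the midpoint of
    \<open>d\<close> and \<open>d'\<close>.\<close>
  define \<epsilon> where "\<epsilon> = (d' - d) / (2 * real m)"
  define d0 where "d0 = d + real m * \<epsilon>"
  have eps: "0 < \<epsilon>" using d m_pos by (simp add: \<epsilon>_def)
  have d0: "d0 < d'" "0 < d0" using d eps m_pos by (auto simp: d0_def \<epsilon>_def field_simps intro!: add_pos_pos)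
  \<comment> \<open>So small that the quadratic growth \<open>B * c\<close> of the gap moment uses
    up at most half of the gain \<open>\<phi> * \<epsilon>\<close> from a gap of size
    \<open>\<epsilon> * t\<close>.\<close>
  define \<phi> where "\<phi> = min 1 (\<epsilon> / (4 * B))"
  have \<phi>: "0 < \<phi>" "\<phi> \<le> 1" "\<phi> * (4 * B) \<le> \<epsilon>" using eps B by (auto simp: \<phi>_def min_def field_simps)
  define c where "c = exp \<phi> + exp (- \<phi>) - 2"
  have "c \<le> 2 * \<phi>\<^sup>2" using exp_bound[of \<phi>] exp_minus_le_quadratic[of \<phi>] \<phi> by (simp add: c_def)
  then have "B * c \<le> B * (2 * \<phi>\<^sup>2)" using B by (intro mult_left_mono) auto
  also have "\<dots> = \<phi> * (\<phi> * (4 * B)) / 2" by (simp add: power2_eq_square)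
  also have "\<dots> \<le> \<phi> * \<epsilon> / 2" using \<phi> by (intro divide_right_mono mult_left_mono) auto
  finally have Bc: "B * c \<le> \<phi> * \<epsilon> / 2" .
  define K where "K = 1 + (exp \<phi> - 1) / c"
  have c0: "0 \<le> c"
  proof -
    have "1 + \<phi> \<le> exp \<phi>" "1 + (- \<phi>) \<le> exp (- \<phi>)" by (rule exp_ge_add_one_self)+
    then show ?thesis unfolding c_def by linarith
  qed
  have K: "1 \<le> K" using c0 \<phi> by (simp add: K_def)
  \<comment> \<open>Both tail rates, \<open>\<alpha>\<close> and the remaining half of
    \<open>\<phi> * \<epsilon>\<close>, have to beat the factor
    \<open>exp (\<theta> * L * t)\<close> with \<open>L = 4 * B\<close>.\<close>
  define \<theta>0 where "\<theta>0 = min (1 / 2) (min \<alpha> (\<phi> * \<epsilon> / 2) / (4 * B))"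
  have \<theta>0: "0 < \<theta>0" using C \<phi> eps B by (simp add: \<theta>0_def)
  show ?thesis
  proof (intro exI[of _ \<theta>0] conjI \<theta>0 allI impI)
    fix \<theta> assume "0 < \<theta> \<and> \<theta> \<le> \<theta>0"
    then have \<theta>: "0 < \<theta>" "2 * \<theta> \<le> 1" "\<theta> * (4 * B) \<le> \<alpha>" "\<theta> * (4 * B) \<le> \<phi> * \<epsilon> / 2"
      using B by (auto simp: \<theta>0_def pos_le_divide_eq)
    \<comment> \<open>The moment at \<open>2 * \<theta>\<close> grows at rate
      \<open>B * (exp (2 * \<theta>) - 1) \<le> 4 * B * \<theta>\<close>, which
      \<open>exp (- (\<theta> * L * t))\<close> cancels.\<close>
    define L where "L = 4 * B"
    define \<rho> where "\<rho> = 1 + \<theta> * d' / \<Lambda>"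
    define \<mu> where "\<mu> = 1 + B * c / \<Lambda>"
    define \<nu> where "\<nu> = 1 + B * (exp (2 * \<theta>) - 1) / \<Lambda>"
    have pos: "0 \<le> \<rho>" "0 \<le> \<mu>" "0 \<le> \<nu>"
      unfolding \<rho>_def \<mu>_def \<nu>_def using \<theta> d \<Lambda>_pos B c0 by auto
    define Z where "Z = real m * (C + real m * K + 2)"
    show "\<exists>N. growth \<theta> N < \<rho> ^ N"
    proof (rule ccontr)
      assume "\<not> ?thesis"
      then have ge: "\<rho> ^ N \<le> growth \<theta> N" for N by (meson not_less)
      have main: "exp (\<theta> * d' * t) \<le> Z * exp (\<theta> * d0 * t)" if t: "0 \<le> t" for t
      proof -
        let ?u = "ustep m \<beta> \<Lambda>" and ?z = "\<lambda>_::nat. 0::nat"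
        define a where "a N = (\<Lambda> * t) ^ N / fact N" for N
        have a0: "0 \<le> a N" for N using t \<Lambda>_pos by (simp add: a_def)
        define s where "s N = (?u ^^ N) (\<lambda>y. if d * t \<le> real (y m) then 1 else 0) ?z" for N
        define e1 where "e1 = real m * exp (\<theta> * d0 * t)"
        define e2 where "e2 = real m * exp (\<theta> * L * t)"
        define e3 where "e3 = real m * exp (- (\<phi> * \<epsilon> * t)) * K"
        define e4 where "e4 = exp (- (\<theta> * L * t)) * real m"
        have e: "0 \<le> e1" "0 \<le> e2" "0 \<le> e3" "0 \<le> e4" using K by (auto simp: e1_def e2_def e3_def e4_def)
        have bound: "\<rho> ^ N \<le> e1 + e2 * (s N + e3 * \<mu> ^ N) + e4 * \<nu> ^ N" for N
        proof -
          have "growth \<theta> N \<le> (?u ^^ N) (\<lambda>y. e1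
            + e2 * ((if d * t \<le> real (y m) then 1 else 0)
                + (\<Sum>j\<in>{1..<m}. exp (- (\<phi> * \<epsilon> * t)) * exp (\<phi> * (real (y j) - real (y (Suc j))))))
            + exp (- (\<theta> * L * t)) * exp_sum {1..m} (2 * \<theta>) y) ?z"
            unfolding growth_def e1_def e2_def d0_def
            by (intro ustep_pow_mono exp_sum_le_split) (use \<theta> \<phi> eps t in auto)
          also have "\<dots> = e1 + e2 * (s N + (\<Sum>j\<in>{1..<m}. exp (- (\<phi> * \<epsilon> * t)) *
                (?u ^^ N) (\<lambda>y. exp (\<phi> * (real (y j) - real (y (Suc j))))) ?z))
              + exp (- (\<theta> * L * t)) * growth (2 * \<theta>) N"
            by (simp only: ustep_pow_add ustep_pow_const ustep_pow_scale ustep_pow_sum s_def growth_def)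
          also have "\<dots> \<le> e1 + e2 * (s N + (\<Sum>j\<in>{1..<m}. exp (- (\<phi> * \<epsilon> * t)) * (K * \<mu> ^ N)))
              + exp (- (\<theta> * L * t)) * (real m * \<nu> ^ N)"
          proof -
            have "(?u ^^ N) (\<lambda>y. exp (\<phi> * (real (y j) - real (y (Suc j))))) ?z \<le> K * \<mu> ^ N"
              if "j \<in> {1..<m}" for j
              using gap_moment[of j \<phi> N] that \<phi> by (simp add: K_def \<mu>_def c_def B_def)
            moreover have "growth (2 * \<theta>) N \<le> real m * \<nu> ^ N"
              using exp_sum_moment[of "2 * \<theta>" N] \<theta> by (simp add: \<nu>_def B_def)
            ultimately show ?thesis
              using e by (intro add_mono mult_left_mono sum_mono order_refl) auto
          qed
          also have "\<dots> \<le> e1 + e2 * (s N + e3 * \<mu> ^ N) + e4 * \<nu> ^ N"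
          proof -
            have "real (m - 1) * (exp (- (\<phi> * \<epsilon> * t)) * (K * \<mu> ^ N)) \<le> real m * (exp (- (\<phi> * \<epsilon> * t)) * (K * \<mu> ^ N))"
              using K pos by (intro mult_right_mono) auto
            then have "e2 * (s N + real (m - 1) * (exp (- (\<phi> * \<epsilon> * t)) * (K * \<mu> ^ N))) \<le> e2 * (s N + e3 * \<mu> ^ N)"
              using e by (intro mult_left_mono add_left_mono) (auto simp: e3_def mult_ac)
            then show ?thesis by (simp add: e4_def mult_ac)
          qed
          finally show ?thesis using ge[of N] by linarith
        qed
        \<comment> \<open>Poisson averaging of \<open>bound\<close>. Apart from the
          \<open>e1\<close> term all resulting exponents are at most 0 by the choice of constants,
          hence dominated by \<open>\<theta> * d0 * t\<close>.\<close>
        have "(\<Sum>N<k. a N * \<rho> ^ N) \<le> exp (\<Lambda> * t) * (Z * exp (\<theta> * d0 * t))" for k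
        proof -
          have az: "(\<Sum>N<k. a N * z ^ N) \<le> exp (\<Lambda> * t * z)" if "0 \<le> z" for z
            using exp_partial_sum_le[of "\<Lambda> * t * z" k] that t \<Lambda>_pos
            by (simp add: a_def power_mult_distrib)
          have "(\<Sum>N<k. a N * \<rho> ^ N) \<le> (\<Sum>N<k. a N * (e1 + e2 * (s N + e3 * \<mu> ^ N) + e4 * \<nu> ^ N))"
            using bound a0 by (intro sum_mono mult_left_mono) auto
          also have "\<dots> = e1 * (\<Sum>N<k. a N * 1 ^ N) + e2 * ((\<Sum>N<k. a N * s N) + e3 * (\<Sum>N<k. a N * \<mu> ^ N))
              + e4 * (\<Sum>N<k. a N * \<nu> ^ N)"
            by (simp add: sum.distrib sum_distrib_left algebra_simps)
          also have "\<dots> \<le> e1 * exp (\<Lambda> * t * 1) + e2 * (exp (\<Lambda> * t) * (C * exp (- \<alpha> * t)) + e3 * exp (\<Lambda> * t * \<mu>))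
              + e4 * exp (\<Lambda> * t * \<nu>)"
          proof -
            have "(\<Sum>N<k. a N * s N) \<le> exp (\<Lambda> * t) * crystal_tail m \<beta> t d"
              unfolding a_def s_def by (rule crystal_tail_ge[OF t])
            also have "\<dots> \<le> exp (\<Lambda> * t) * (C * exp (- \<alpha> * t))"
              using tail[OF t] by (intro mult_left_mono) auto
            finally have "(\<Sum>N<k. a N * s N) \<le> exp (\<Lambda> * t) * (C * exp (- \<alpha> * t))" .
            then show ?thesis using e pos by (intro add_mono mult_left_mono az) auto
          qed
          also have "\<dots> = exp (\<Lambda> * t) * (real m * exp (\<theta> * d0 * t) + real m * C * exp (\<theta> * L * t - \<alpha> * t)
              + real m * real m * K * exp (\<theta> * L * t - \<phi> * \<epsilon> * t + B * c * t)
              + real m * exp (B * (exp (2 * \<theta>) - 1) * t - \<theta> * L * t))"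
          proof -
            have "\<Lambda> * t * \<mu> = \<Lambda> * t + B * c * t" "\<Lambda> * t * \<nu> = \<Lambda> * t + B * (exp (2 * \<theta>) - 1) * t"
              using \<Lambda>_pos by (auto simp: \<mu>_def \<nu>_def field_simps)
            then have "exp (\<Lambda> * t * \<mu>) = exp (\<Lambda> * t) * exp (B * c * t)"
              "exp (\<Lambda> * t * \<nu>) = exp (\<Lambda> * t) * exp (B * (exp (2 * \<theta>) - 1) * t)"
              by (simp_all only: exp_add)
            then show ?thesis
              by (simp only: e1_def e2_def e3_def e4_def exp_add exp_diff)
                 (simp add: exp_minus divide_inverse algebra_simps)
          qed
          also have "\<dots> \<le> exp (\<Lambda> * t) * (real m * exp (\<theta> * d0 * t) + real m * C * exp (\<theta> * d0 * t)
              + real m * real m * K * exp (\<theta> * d0 * t) + real m * exp (\<theta> * d0 * t))"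
          proof (intro mult_left_mono add_mono order_refl)
            have nn: "0 \<le> \<theta> * d0 * t" using \<theta> d0 t by simp
            have "(\<theta> * L - \<alpha>) * t \<le> 0" using \<theta> t by (intro mult_nonpos_nonneg) (auto simp: L_def)
            then show "exp (\<theta> * L * t - \<alpha> * t) \<le> exp (\<theta> * d0 * t)" using nn by (simp add: algebra_simps)
            have "(\<theta> * L - \<phi> * \<epsilon> + B * c) * t \<le> 0"
              using \<theta> t Bc by (intro mult_nonpos_nonneg) (auto simp: L_def)
            then show "exp (\<theta> * L * t - \<phi> * \<epsilon> * t + B * c * t) \<le> exp (\<theta> * d0 * t)"
              using nn by (simp add: algebra_simps)
            have "B * (exp (2 * \<theta>) - 1) \<le> B * (2 * (2 * \<theta>))"
              using B \<theta> by (intro mult_left_mono exp_le_1_plus_double) auto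
            then have "(B * (exp (2 * \<theta>) - 1) - \<theta> * L) * t \<le> 0"
              using t by (intro mult_nonpos_nonneg) (simp_all add: L_def mult_ac)
            then show "exp (B * (exp (2 * \<theta>) - 1) * t - \<theta> * L * t) \<le> exp (\<theta> * d0 * t)"
              using nn by (simp add: algebra_simps)
          qed (use C K in auto)
          also have "\<dots> = exp (\<Lambda> * t) * (Z * exp (\<theta> * d0 * t))"
            by (simp add: Z_def algebra_simps)
          finally show ?thesis .
        qed
        moreover have "(\<lambda>N. a N * \<rho> ^ N) sums exp (\<Lambda> * t * \<rho>)"
          using exp_converges[of "\<Lambda> * t * \<rho>"]
          by (simp add: a_def power_mult_distrib divide_inverse mult_ac)
        ultimately have "exp (\<Lambda> * t * \<rho>) \<le> exp (\<Lambda> * t) * (Z * exp (\<theta> * d0 * t))"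
          by (simp only: sums_def) (rule LIMSEQ_le_const2, auto)
        moreover have "\<Lambda> * t * \<rho> = \<Lambda> * t + \<theta> * d' * t" using \<Lambda>_pos by (simp add: \<rho>_def field_simps)
        ultimately show ?thesis by (simp add: exp_add)
      qed
      \<comment> \<open>The time at which \<open>exp (\<theta> * (d' - d0) * t)\<close> equals
        \<open>exp Z\<close>, which exceeds the prefactor \<open>Z\<close>.\<close>
      define t where "t = Z / (\<theta> * (d' - d0))"
      have Z: "0 < Z" unfolding Z_def using m_pos C K by (intro mult_pos_pos add_pos_nonneg) auto
      have t: "0 \<le> t" "\<theta> * d' * t = Z + \<theta> * d0 * t" using Z \<theta> d0 by (auto simp: t_def field_simps)
      have "exp Z * exp (\<theta> * d0 * t) \<le> Z * exp (\<theta> * d0 * t)"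
        using main[OF t(1)] unfolding t(2) exp_add .
      then have "exp Z \<le> Z" by simp
      then show False using exp_ge_add_one_self[of Z] by linarith
    qed
  qed
qed

end

section \<open>Speeds of low and high sites\<close>

definition restr :: "nat \<Rightarrow> nat \<Rightarrow> (nat \<Rightarrow> nat) \<Rightarrow> nat \<Rightarrow> nat" where
  "restr a l y i = (if 1 \<le> i \<and> i \<le> l then y (a + i - 1) else 0)"

lemma restr_grow:
  assumes "1 \<le> i" "i \<le> l" shows "restr a l (grow y (a + i - 1)) = grow (restr a l y) i"
  using assms by (auto simp: restr_def fun_eq_iff)

lemma restr_grow_outside:
  assumes "j \<notin> {a..<a + l}" shows "restr a l (grow y j) = restr a l y"
  using assms by (auto simp: restr_def fun_eq_iff)

text \<open>Replacing the outside of a block by 0 changes no comparison if the outside neighbours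
  are not higher than the ends of the block.\<close>

lemma Vn_restr:
  assumes "1 \<le> i" "i \<le> l" "1 \<le> a" "y (a - 1) \<le> y a" "y (a + l) \<le> y (a + l - 1)"
  shows "Vn i (restr a l y) = Vn (a + i - 1) y"
proof -
  have "restr a l y (i - 1) > restr a l y i \<longleftrightarrow> y (a + i - 1 - 1) > y (a + i - 1)"
  proof (cases "i = 1")
    case True then show ?thesis using assms by (simp add: restr_def)
  next
    case False
    then have "a + (i - 1) - 1 = a + i - 1 - 1" "1 \<le> i - 1" "i - 1 \<le> l" using assms by auto
    then show ?thesis using assms by (simp add: restr_def)
  qed
  moreover have "restr a l y (i + 1) > restr a l y i \<longleftrightarrow> y (a + i - 1 + 1) > y (a + i - 1)"
  proof (cases "i = l")
    case True then show ?thesis using assms by (simp add: restr_def)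
  next
    case False
    then have "a + (i + 1) - 1 = a + i - 1 + 1" "i + 1 \<le> l" using assms by auto
    then show ?thesis using assms by (simp add: restr_def)
  qed
  ultimately show ?thesis by (simp only: Vn_def)
qed

text \<open>Jumps outside the block do not change the restriction. For monotone \<open>f\<close> the
  larger rates \<open>\<gamma>\<close> only help, and so do extra jumps at the sites
  \<open>l + 1, ..., n\<close>; thus one process on \<open>n\<close> sites dominates shorter blocks
  as well.\<close>

lemma ustep_restr_le:
  assumes f: "mono f" and \<Lambda>: "0 < \<Lambda>" and l: "1 \<le> l" "l \<le> n" and a: "1 \<le> a" "a + l \<le> k + 1"
    and nn: "\<And>v. v \<le> 2 \<Longrightarrow> 0 \<le> \<gamma> v" and le: "\<And>v. v \<le> 2 \<Longrightarrow> \<beta> v \<le> \<gamma> v"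
    and y: "y (a - 1) \<le> y a" "y (a + l) \<le> y (a + l - 1)"
  shows "ustep k \<beta> \<Lambda> (\<lambda>y. f (restr a l y)) y \<le> ustep n \<gamma> \<Lambda> f (restr a l y)"
proof -
  let ?r = "restr a l y"
  have up: "0 \<le> f (grow ?r i) - f ?r" for i
    using monoD[OF f, of ?r "grow ?r i"] by (simp add: le_fun_def)
  have "(\<Sum>j\<in>{1..k}. \<beta> (Vn j y) / \<Lambda> * (f (restr a l (grow y j)) - f ?r))
      = (\<Sum>j\<in>{a..<a + l}. \<beta> (Vn j y) / \<Lambda> * (f (restr a l (grow y j)) - f ?r))"
    using a by (intro sum.mono_neutral_right) (auto simp: restr_grow_outside)
  also have "\<dots> = (\<Sum>i\<in>{1..l}. \<beta> (Vn (a + i - 1) y) / \<Lambda> * (f (restr a l (grow y (a + i - 1))) - f ?r))"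
    by (rule sum.reindex_bij_witness[where i="\<lambda>i. a + i - 1" and j="\<lambda>j. j - a + 1"]) auto
  also have "\<dots> = (\<Sum>i\<in>{1..l}. \<beta> (Vn i ?r) / \<Lambda> * (f (grow ?r i) - f ?r))"
  proof (intro sum.cong refl)
    fix i assume "i \<in> {1..l}"
    then have i: "1 \<le> i" "i \<le> l" by auto
    show "\<beta> (Vn (a + i - 1) y) / \<Lambda> * (f (restr a l (grow y (a + i - 1))) - f ?r)
      = \<beta> (Vn i ?r) / \<Lambda> * (f (grow ?r i) - f ?r)"
      by (simp only: restr_grow[OF i] Vn_restr[OF i a(1) y])
  qed
  also have "\<dots> \<le> (\<Sum>i\<in>{1..l}. \<gamma> (Vn i ?r) / \<Lambda> * (f (grow ?r i) - f ?r))"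
    using up \<Lambda> le[OF Vn_le_2] by (intro sum_mono mult_right_mono divide_right_mono) auto
  also have "\<dots> \<le> (\<Sum>i\<in>{1..n}. \<gamma> (Vn i ?r) / \<Lambda> * (f (grow ?r i) - f ?r))"
    using up \<Lambda> nn[OF Vn_le_2] l by (intro sum_mono2) auto
  finally show ?thesis by (simp add: ustep_def)
qed

locale crystal = uniformized k \<beta> \<Lambda> for k :: nat and \<beta> :: "nat \<Rightarrow> real" and \<Lambda> :: real +
  assumes k2: "2 \<le> k" and \<beta>0: "0 < \<beta> 0" and \<beta>02: "\<beta> 0 < \<beta> 2" and \<beta>21: "\<beta> 2 < \<beta> 1"
begin

lemma rate_le_\<beta>1: "\<beta> (Vn j y) \<le> \<beta> 1"
  using \<beta>02 \<beta>21 by (auto simp: Vn_def numeral_2_eq_2)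

lemma rate_ge_\<beta>0: "\<beta> 0 \<le> \<beta> (Vn j y)"
  using \<beta>02 \<beta>21 by (auto simp: Vn_def numeral_2_eq_2)

lemma rate_ge_\<beta>2: "y (j - 1) > y j \<or> y (j + 1) > y j \<Longrightarrow> \<beta> 2 \<le> \<beta> (Vn j y)"
  using \<beta>21 by (auto simp: Vn_def numeral_2_eq_2)

text \<open>One step changes a difference of heights by at most one, so \<open>s\<close> counts the
  steps for which the order is safe. In this form it serves as the \<open>Q\<close> of
  \<open>ustep_pow_le\<close>.\<close>

definition separated :: "nat set \<Rightarrow> nat set \<Rightarrow> nat \<Rightarrow> (nat \<Rightarrow> nat) \<Rightarrow> bool" where
  "separated S H s y \<longleftrightarrow> crystal_config k y \<and> (\<forall>i\<in>S. \<forall>j\<in>H. y i + s \<le> y j)"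

lemma separated_Suc: "separated S H (Suc s) y \<Longrightarrow> separated S H s y"
  unfolding separated_def by (metis Suc_leD add_Suc_right)

lemma separated_grow:
  assumes "separated S H (Suc s) y" "j \<in> {1..k}" shows "separated S H s (grow y j)"
  unfolding separated_def
proof (intro conjI ballI)
  show "crystal_config k (grow y j)" using assms by (simp add: separated_def crystal_config_grow)
  fix a b assume "a \<in> S" "b \<in> H"
  then have "y a + Suc s \<le> y b" using assms(1) by (simp add: separated_def)
  then show "grow y j a + s \<le> grow y j b" by auto
qed

context
  fixes S H :: "nat set"
  assumes union: "S \<union> H = {1..k}" and disj: "S \<inter> H = {}" and neS: "S \<noteq> {}" and neH: "H \<noteq> {}"
begin

lemma finite_SH: "finite S" "finite H" and card_SH: "card S \<le> k" "card H \<le> k"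
proof -
  show fin: "finite S" "finite H" using union finite_Un[of S H] by auto
  have "S \<subseteq> {1..k}" "H \<subseteq> {1..k}" using union by auto
  from card_mono[OF _ this(1)] card_mono[OF _ this(2)] show "card S \<le> k" "card H \<le> k" by auto
qed

text \<open>The weights \<open>\<eta> ^ \<bar>i - p\<bar>\<close> decay away from a fixed high site \<open>p\<close>. A low site which is not below
  its neighbour in the direction of \<open>p\<close> may be slow, but its term is at most \<open>\<eta>\<close> times that of the neighbour.\<close>

lemma low_general:
  assumes \<theta>: "0 \<le> \<theta>" and \<eta>: "0 < \<eta>" "\<eta> \<le> 1" "real k * \<eta> \<le> 1"
    and x: "separated S H N x" "\<And>i. i \<in> S \<Longrightarrow> a \<le> x i"
  shows "(ustep k \<beta> \<Lambda> ^^ N) (exp_sum S (- \<theta>)) x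
    \<le> (real k / \<eta> ^ k) * (1 - (1 - exp (- \<theta>)) * (1 - real k * \<eta>) * \<beta> 2 / \<Lambda>) ^ N * exp (- \<theta> * real a)"
proof -
  obtain p where p: "p \<in> H" using neH by auto
  then have pk: "p \<in> {1..k}" using union by auto
  define w where "w i = \<eta> ^ (if i < p then p - i else i - p)" for i
  define W where "W y = (\<Sum>i\<in>S. w i * exp (- \<theta> * real (y i)))" for y :: "nat \<Rightarrow> nat"
  define \<sigma> where "\<sigma> = 1 - (1 - exp (- \<theta>)) * (1 - real k * \<eta>) * \<beta> 2 / \<Lambda>"
  have w0: "0 < w i" for i using \<eta> by (simp add: w_def)
  have W0: "0 \<le> W y" for y unfolding W_def by (intro sum_nonneg) (use w0 in \<open>auto intro: less_imp_le\<close>)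
  have Sk: "i \<in> S \<Longrightarrow> i \<in> {1..k}" for i using union by auto
  have step: "ustep k \<beta> \<Lambda> W y \<le> \<sigma> * W y" if y: "separated S H (Suc s) y" for s y
  proof -
    let ?e = "\<lambda>i. exp (- \<theta> * real (y i))"
    have site: "\<beta> 2 * (w i * ?e i - \<eta> * W y) \<le> \<beta> (Vn i y) * (w i * ?e i)" if i: "i \<in> S" for i
    proof -
      have ip: "i \<noteq> p" using i p disj by auto
      define q where "q = (if i < p then i + 1 else i - 1)"
      have q: "q \<in> {1..k}" "w i = \<eta> * w q"
      proof -
        show "q \<in> {1..k}" using Sk[OF i] pk ip by (auto simp: q_def)
        have "(if i < p then p - i else i - p) = Suc (if q < p then p - q else q - p)"
          using ip by (auto simp: q_def)
        then show "w i = \<eta> * w q" by (simp add: w_def)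
      qed
      show ?thesis
      proof (cases "y i < y q")
        case True
        then have "\<beta> 2 \<le> \<beta> (Vn i y)" by (intro rate_ge_\<beta>2) (auto simp: q_def split: if_splits)
        then have "\<beta> 2 * (w i * ?e i) \<le> \<beta> (Vn i y) * (w i * ?e i)"
          using w0[of i] by (intro mult_right_mono) auto
        moreover have "0 \<le> \<beta> 2 * (\<eta> * W y)" using \<beta>0 \<beta>02 \<eta> W0 by simp
        ultimately show ?thesis by (simp only: right_diff_distrib)
      next
        case False
        then have "q \<notin> H" using y i unfolding separated_def by force
        then have qS: "q \<in> S" using q(1) union by blast
        have "\<theta> * real (y q) \<le> \<theta> * real (y i)" using False \<theta> by (intro mult_left_mono) auto
        then have "?e i \<le> ?e q" by simp
        then have "w i * ?e i \<le> \<eta> * (w q * ?e q)"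
          using w0[of q] \<eta> unfolding q(2) by (simp add: mult.assoc mult_left_mono)
        also have "\<dots> \<le> \<eta> * W y" unfolding W_def using qS \<eta> w0
          by (intro mult_left_mono member_le_sum[of q S "\<lambda>i. w i * ?e i"] finite_SH) (auto intro: less_imp_le)
        finally have "\<beta> 2 * (w i * ?e i - \<eta> * W y) \<le> 0"
          using \<beta>0 \<beta>02 by (intro mult_nonneg_nonpos) auto
        moreover have "0 \<le> \<beta> (Vn i y) * (w i * ?e i)"
          using rate_nonneg[OF Vn_le_2] w0[of i] by (intro mult_nonneg_nonneg) auto
        ultimately show ?thesis by linarith
      qed
    qed
    have "\<beta> 2 * (1 - real k * \<eta>) * W y \<le> \<beta> 2 * (W y - real (card S) * (\<eta> * W y))"
    proof -
      have "real (card S) * (\<eta> * W y) \<le> real k * (\<eta> * W y)"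
        using card_SH W0 \<eta> by (intro mult_right_mono) auto
      then have "\<beta> 2 * (W y - real k * (\<eta> * W y)) \<le> \<beta> 2 * (W y - real (card S) * (\<eta> * W y))"
        using \<beta>0 \<beta>02 by (intro mult_left_mono) auto
      then show ?thesis by (simp add: algebra_simps)
    qed
    also have "\<dots> = (\<Sum>i\<in>S. \<beta> 2 * (w i * ?e i - \<eta> * W y))"
      by (simp only: sum_distrib_left[symmetric] sum_subtractf sum_constant W_def[symmetric] mult.left_commute)
    also have "\<dots> \<le> (\<Sum>i\<in>S. \<beta> (Vn i y) * (w i * ?e i))" by (intro sum_mono site)
    finally have drift: "\<beta> 2 * (1 - real k * \<eta>) * W y \<le> (\<Sum>i\<in>S. \<beta> (Vn i y) * (w i * ?e i))" .
    have "ustep k \<beta> \<Lambda> W y = (\<Sum>i\<in>S. w i * (?e i + \<beta> (Vn i y) / \<Lambda> * (exp (- \<theta>) - 1) * ?e i))"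
      unfolding W_def ustep_sum ustep_scale by (intro sum.cong refl) (simp only: ustep_exp_site[OF Sk])
    also have "\<dots> = W y - (1 - exp (- \<theta>)) / \<Lambda> * (\<Sum>i\<in>S. \<beta> (Vn i y) * (w i * ?e i))"
      unfolding W_def sum_distrib_left sum_subtractf[symmetric]
      by (intro sum.cong refl) (simp add: diff_divide_distrib algebra_simps)
    also have "\<dots> \<le> W y - (1 - exp (- \<theta>)) / \<Lambda> * (\<beta> 2 * (1 - real k * \<eta>) * W y)"
      using drift \<theta> \<Lambda>_pos by (intro diff_left_mono mult_left_mono) auto
    also have "\<dots> = \<sigma> * W y"
    proof -
      have "w - a / \<Lambda> * (b * q * w) = (1 - a * q * b / \<Lambda>) * w" for a b q w
        using \<Lambda>_pos by (simp add: field_simps)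
      then show ?thesis by (simp only: \<sigma>_def)
    qed
    finally show ?thesis .
  qed
  have \<sigma>0: "0 \<le> \<sigma>"
  proof -
    have "1 * \<beta> 2 \<le> real k * \<beta> 2" using k2 \<beta>0 \<beta>02 by (intro mult_right_mono) auto
    then have "\<beta> 2 / \<Lambda> \<le> 1" using rate_le[of 2] \<Lambda>_pos by simp
    then have "((1 - exp (- \<theta>)) * (1 - real k * \<eta>)) * (\<beta> 2 / \<Lambda>) \<le> 1 * 1"
      using \<theta> \<eta> \<beta>0 \<beta>02 \<Lambda>_pos by (intro mult_mono mult_le_one) auto
    then show ?thesis by (simp add: \<sigma>_def)
  qed
  \<comment> \<open>The weights lie between \<open>\<eta> ^ k\<close> and 1. Returning to equal
    weights costs the factor \<open>1 / \<eta> ^ k\<close> once, not per step.\<close>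
  have wk: "\<eta> ^ k \<le> w i" if "i \<in> S" for i
    unfolding w_def using \<eta> Sk[OF that] pk by (intro power_decreasing) auto
  have "(ustep k \<beta> \<Lambda> ^^ N) (exp_sum S (- \<theta>)) x \<le> (ustep k \<beta> \<Lambda> ^^ N) (\<lambda>y. (1 / \<eta> ^ k) * W y) x"
  proof (rule ustep_pow_mono)
    fix y
    have "\<eta> ^ k * exp_sum S (- \<theta>) y \<le> W y"
      unfolding exp_sum_def W_def sum_distrib_left using wk by (intro sum_mono mult_right_mono) auto
    then show "exp_sum S (- \<theta>) y \<le> (1 / \<eta> ^ k) * W y" using \<eta> by (simp add: field_simps)
  qed
  also have "\<dots> = (1 / \<eta> ^ k) * (ustep k \<beta> \<Lambda> ^^ N) W x" by (rule ustep_pow_scale)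
  also have "\<dots> \<le> (1 / \<eta> ^ k) * (\<sigma> ^ N * W x)"
    by (intro mult_left_mono
        ustep_pow_geometric[where Q="separated S H", OF \<sigma>0 step separated_Suc separated_grow x(1)])
       (use \<eta> in auto)
  also have "\<dots> \<le> (1 / \<eta> ^ k) * (\<sigma> ^ N * (real k * exp (- \<theta> * real a)))"
  proof -
    have "W x \<le> (\<Sum>i\<in>S. 1 * exp (- \<theta> * real a))"
      unfolding W_def
    proof (intro sum_mono mult_mono)
      fix i assume "i \<in> S"
      show "w i \<le> 1" unfolding w_def using \<eta> by (intro power_le_one) auto
      show "exp (- \<theta> * real (x i)) \<le> exp (- \<theta> * real a)"
        using x(2)[OF \<open>i \<in> S\<close>] \<theta> by (simp add: mult_left_mono)
    qed auto
    also have "\<dots> \<le> real k * exp (- \<theta> * real a)" using card_SH by simp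
    finally show ?thesis using \<eta> \<sigma>0 by (intro mult_left_mono) auto
  qed
  finally show ?thesis by (simp add: \<sigma>_def mult_ac)
qed

text \<open>An end site below all others has exactly one higher neighbour, the boundary on its other
  side being 0. Its rate is the largest one, \<open>\<beta> 1\<close>; this makes up for a high
  block that may have more than \<open>n\<close> sites.\<close>

lemma low_end:
  assumes \<theta>: "0 \<le> \<theta>" and S: "S = {1} \<or> S = {k}"
    and x: "separated S H N x" "\<And>i. i \<in> S \<Longrightarrow> a \<le> x i"
  shows "(ustep k \<beta> \<Lambda> ^^ N) (exp_sum S (- \<theta>)) x
    \<le> (1 - (1 - exp (- \<theta>)) * \<beta> 1 / \<Lambda>) ^ N * exp (- \<theta> * real a)"
proof -
  define \<sigma> where "\<sigma> = 1 - (1 - exp (- \<theta>)) * \<beta> 1 / \<Lambda>"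
  obtain i where i: "S = {i}" "i = 1 \<or> i = k" using S by auto
  have ik: "i \<in> {1..k}" using i k2 by auto
  have \<sigma>0: "0 \<le> \<sigma>"
  proof -
    have "1 * \<beta> 1 \<le> real k * \<beta> 1" using k2 \<beta>0 \<beta>02 \<beta>21 by (intro mult_right_mono) auto
    then have "\<beta> 1 / \<Lambda> \<le> 1" using rate_le[of 1] \<Lambda>_pos by simp
    then have "(1 - exp (- \<theta>)) * (\<beta> 1 / \<Lambda>) \<le> 1 * 1"
      using \<theta> \<beta>0 \<beta>02 \<beta>21 \<Lambda>_pos by (intro mult_mono) auto
    then show ?thesis by (simp add: \<sigma>_def)
  qed
  have step: "ustep k \<beta> \<Lambda> (exp_sum S (- \<theta>)) y \<le> \<sigma> * exp_sum S (- \<theta>) y" if y: "separated S H (Suc s) y" for s y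
  proof -
    have h: "y i < y j" if "j \<in> {1..k}" "j \<noteq> i" for j
    proof -
      have "j \<in> H" using that union i(1) by blast
      then show ?thesis using y i(1) unfolding separated_def by force
    qed
    have "y 0 = 0" "y (Suc k) = 0" using y by (auto simp: separated_def crystal_config_def)
    from i(2) have "Vn i y = 1"
    proof
      assume "i = 1"
      then show ?thesis using h[of 2] k2 \<open>y 0 = 0\<close> by (simp add: Vn_def numeral_2_eq_2)
    next
      assume "i = k"
      then show ?thesis using h[of "k - 1"] k2 \<open>y (Suc k) = 0\<close> by (simp add: Vn_def)
    qed
    then have "ustep k \<beta> \<Lambda> (\<lambda>y. exp (- \<theta> * real (y i))) y = \<sigma> * exp (- \<theta> * real (y i))"
      unfolding ustep_exp_site[OF ik] \<sigma>_def by (simp add: algebra_simps diff_divide_distrib)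
    then show ?thesis unfolding exp_sum_def i(1) by simp
  qed
  have "(ustep k \<beta> \<Lambda> ^^ N) (exp_sum S (- \<theta>)) x \<le> \<sigma> ^ N * exp_sum S (- \<theta>) x"
    by (rule ustep_pow_geometric[where Q="separated S H", OF \<sigma>0 step separated_Suc separated_grow x(1)])
  also have "\<dots> \<le> \<sigma> ^ N * exp (- \<theta> * real a)"
    using \<sigma>0 x(2)[of i] \<theta> i(1) by (intro mult_left_mono) (auto simp: exp_sum_def mult_left_mono)
  finally show ?thesis by (simp add: \<sigma>_def)
qed

text \<open>A highest site has no higher neighbour and carries at least the share
  \<open>1 / k\<close> of the exponential sum, which lowers the mean rate from
  \<open>\<beta> 1\<close> by \<open>(\<beta> 1 - \<beta> 0) / k\<close>.\<close>

lemma high_crude: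
  assumes \<theta>: "0 \<le> \<theta>" and x: "separated S H N x" "\<And>i. i \<in> H \<Longrightarrow> x i \<le> b"
  shows "(ustep k \<beta> \<Lambda> ^^ N) (exp_sum H \<theta>) x
    \<le> real k * (1 + (exp \<theta> - 1) * (\<beta> 1 - (\<beta> 1 - \<beta> 0) / real k) / \<Lambda>) ^ N * exp (\<theta> * real b)"
proof -
  define D where "D = \<beta> 1 - (\<beta> 1 - \<beta> 0) / real k"
  define \<rho> where "\<rho> = 1 + (exp \<theta> - 1) * D / \<Lambda>"
  have "(\<beta> 1 - \<beta> 0) / real k \<le> (\<beta> 1 - \<beta> 0) / 1" using k2 \<beta>02 \<beta>21 by (intro divide_left_mono) auto
  then have "0 \<le> D" using \<beta>0 by (simp add: D_def)
  then have \<rho>0: "0 \<le> \<rho>" using \<theta> \<Lambda>_pos by (simp add: \<rho>_def)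
  have Hk: "i \<in> H \<Longrightarrow> i \<in> {1..k}" for i using union by auto
  have step: "ustep k \<beta> \<Lambda> (exp_sum H \<theta>) y \<le> \<rho> * exp_sum H \<theta> y" if y: "separated S H (Suc s) y" for s y
  proof -
    let ?e = "\<lambda>i. exp (\<theta> * real (y i))"
    have "Max (y ` H) \<in> y ` H" using finite_SH neH by (intro Max_in) auto
    then obtain p where p: "p \<in> H" "y p = Max (y ` H)" by auto
    have top: "y j \<le> y p" for j
    proof -
      consider "j \<in> H" | "j \<in> S" | "j \<notin> {1..k}" using union by blast
      then show ?thesis
      proof cases
        case 1 then show ?thesis unfolding p(2) using finite_SH by (intro Max_ge) auto
      next
        case 2 then show ?thesis using y p(1) unfolding separated_def by force
      next
        case 3 then show ?thesis using y by (auto simp: separated_def crystal_config_def not_less_eq_eq)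
      qed
    qed
    then have V0: "Vn p y = 0" by (simp add: Vn_def not_less)
    have "exp_sum H \<theta> y \<le> (\<Sum>i\<in>H. ?e p)"
      unfolding exp_sum_def using top \<theta> by (intro sum_mono) (auto intro: mult_left_mono)
    also have "\<dots> \<le> real k * ?e p" using card_SH by simp
    finally have ep: "exp_sum H \<theta> y / real k \<le> ?e p" using k2 by (simp add: field_simps)
    have "(\<Sum>i\<in>H. \<beta> (Vn i y) * ?e i) \<le> (\<Sum>i\<in>H. \<beta> 1 * ?e i - (if i = p then (\<beta> 1 - \<beta> 0) * ?e p else 0))"
    proof (intro sum_mono)
      fix i show "\<beta> (Vn i y) * ?e i \<le> \<beta> 1 * ?e i - (if i = p then (\<beta> 1 - \<beta> 0) * ?e p else 0)"
        using V0 rate_le_\<beta>1[of i y] by (auto simp: algebra_simps mult_right_mono)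
    qed
    also have "\<dots> = \<beta> 1 * exp_sum H \<theta> y - (\<beta> 1 - \<beta> 0) * ?e p"
      using p finite_SH by (simp add: sum_subtractf exp_sum_def sum_distrib_left)
    also have "\<dots> \<le> \<beta> 1 * exp_sum H \<theta> y - (\<beta> 1 - \<beta> 0) * (exp_sum H \<theta> y / real k)"
      using ep \<beta>02 \<beta>21 by (intro diff_left_mono mult_left_mono) auto
    also have "\<dots> = D * exp_sum H \<theta> y" by (simp add: D_def algebra_simps)
    finally have drift: "(\<Sum>i\<in>H. \<beta> (Vn i y) * ?e i) \<le> D * exp_sum H \<theta> y" .
    have "ustep k \<beta> \<Lambda> (exp_sum H \<theta>) y = (\<Sum>i\<in>H. ?e i + \<beta> (Vn i y) / \<Lambda> * (exp \<theta> - 1) * ?e i)"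
      unfolding exp_sum_def ustep_sum by (intro sum.cong refl) (simp only: ustep_exp_site[OF Hk])
    also have "\<dots> = exp_sum H \<theta> y + (exp \<theta> - 1) / \<Lambda> * (\<Sum>i\<in>H. \<beta> (Vn i y) * ?e i)"
      unfolding exp_sum_def sum_distrib_left sum.distrib[symmetric]
      by (intro sum.cong refl) simp
    also have "\<dots> \<le> exp_sum H \<theta> y + (exp \<theta> - 1) / \<Lambda> * (D * exp_sum H \<theta> y)"
      using drift \<theta> \<Lambda>_pos by (intro add_left_mono mult_left_mono) auto
    finally show ?thesis by (simp add: \<rho>_def algebra_simps)
  qed
  have "(ustep k \<beta> \<Lambda> ^^ N) (exp_sum H \<theta>) x \<le> \<rho> ^ N * exp_sum H \<theta> x"
    by (rule ustep_pow_geometric[where Q="separated S H", OF \<rho>0 step separated_Suc separated_grow x(1)])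
  also have "\<dots> \<le> \<rho> ^ N * (real k * exp (\<theta> * real b))"
  proof -
    have "exp_sum H \<theta> x \<le> (\<Sum>i\<in>H. exp (\<theta> * real b))"
      unfolding exp_sum_def using x(2) \<theta> by (intro sum_mono) (auto intro: mult_left_mono)
    also have "\<dots> \<le> real k * exp (\<theta> * real b)" using card_SH by simp
    finally show ?thesis using \<rho>0 by (intro mult_left_mono) auto
  qed
  finally show ?thesis by (simp add: \<rho>_def D_def mult_ac)
qed

text \<open>The block lies between the nearest low sites \<open>p\<close> and \<open>q\<close>, or
  the positions \<open>0\<close> and \<open>k + 1\<close>. If it left out fewer than two sites,
  there would be a single low site, at one of the ends.\<close>

lemma block_exists:
  assumes i: "i \<in> H" and S: "S \<noteq> {1}" "S \<noteq> {k}"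
  obtains a l where "1 \<le> a" "a + l \<le> k + 1" "l + 2 \<le> k" "a \<le> i" "i < a + l" "{a..<a + l} \<subseteq> H"
    "a - 1 = 0 \<or> a - 1 \<in> S" "a + l = k + 1 \<or> a + l \<in> S"
proof -
  define A where "A = insert 0 {j \<in> S. j < i}"
  define B where "B = insert (k + 1) {j \<in> S. i < j}"
  have fin: "finite A" "finite B" unfolding A_def B_def using finite_SH by auto
  define p where "p = Max A"
  define q where "q = Min B"
  have "A \<noteq> {}" "B \<noteq> {}" by (auto simp: A_def B_def)
  then have p: "p \<in> A" "\<And>j. j \<in> A \<Longrightarrow> j \<le> p" and q: "q \<in> B" "\<And>j. j \<in> B \<Longrightarrow> q \<le> j"
    unfolding p_def q_def using fin by (auto intro: Max_in Min_in)
  have ik: "1 \<le> i" "i \<le> k" using i union by auto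
  have pi: "p < i" using p(1) ik by (auto simp: A_def)
  have iq: "i < q" using q(1) ik by (auto simp: B_def)
  have Sk: "j \<in> S \<Longrightarrow> 1 \<le> j \<and> j \<le> k" for j using union by auto
  have qk: "q \<le> k + 1" using q(2)[of "k + 1"] by (simp add: B_def)
  have noS: "j \<notin> S" if "p < j" "j < q" for j
  proof
    assume j: "j \<in> S"
    then have "j \<noteq> i" using i disj by auto
    then consider "j < i" | "i < j" by linarith
    then show False using p(2)[of j] q(2)[of j] j that by cases (auto simp: A_def B_def)
  qed
  have size: "q - Suc p + 2 \<le> k"
  proof (rule ccontr)
    assume "\<not> ?thesis"
    then have "k + 1 < q - Suc p + 3" by linarith
    then have c: "(p = 0 \<and> q = k + 1) \<or> (p = 0 \<and> q = k) \<or> (p = 1 \<and> q = k + 1)"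
      using qk pi iq by linarith
    have pq: "j = p \<or> j = q" if j: "j \<in> S" for j
    proof -
      have "\<not> (p < j \<and> j < q)" using noS j by blast
      then show ?thesis using Sk[OF j] c by linarith
    qed
    have "S \<subseteq> {1} \<or> S \<subseteq> {k}"
    proof (cases "p = 1")
      case True
      have "j = 1" if "j \<in> S" for j using pq[OF that] Sk[OF that] c True by linarith
      then show ?thesis by blast
    next
      case False
      have "j = k" if "j \<in> S" for j using pq[OF that] Sk[OF that] c False by linarith
      then show ?thesis by blast
    qed
    then show False using neS S by blast
  qed
  show thesis
  proof (rule that[of "Suc p" "q - Suc p"])
    show "{Suc p..<Suc p + (q - Suc p)} \<subseteq> H"
    proof
      fix j assume "j \<in> {Suc p..<Suc p + (q - Suc p)}"
      then have "p < j" "j < q" by auto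
      then show "j \<in> H" using noS[of j] union qk by auto
    qed
    show "Suc p - 1 = 0 \<or> Suc p - 1 \<in> S" using p(1) unfolding A_def by auto
    have "Suc p + (q - Suc p) = q" using pi iq by linarith
    then show "Suc p + (q - Suc p) = k + 1 \<or> Suc p + (q - Suc p) \<in> S" using q(1) unfolding B_def by auto
  qed (use pi iq qk size in linarith)+
qed

text \<open>Each high site is followed inside its own block, which has at most
  \<open>k - 2 \<le> n\<close> sites. There the attractive process takes over step by step, started
  from the flat configuration at height \<open>b\<close>.\<close>

lemma high_block:
  assumes att: "attractive_crystal n \<gamma> \<Lambda>" and kn: "k \<le> n + 2"
    and \<gamma>: "\<And>v. v \<le> 2 \<Longrightarrow> \<beta> v \<le> \<gamma> v"
    and S: "S \<noteq> {1}" "S \<noteq> {k}" and \<theta>: "0 \<le> \<theta>"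
    and x: "separated S H N x" "\<And>i. i \<in> {1..k} \<Longrightarrow> x i \<le> b"
  shows "(ustep k \<beta> \<Lambda> ^^ N) (exp_sum H \<theta>) x
    \<le> real k * attractive_crystal.growth n \<gamma> \<Lambda> \<theta> N * exp (\<theta> * real b)"
proof -
  interpret T: attractive_crystal n \<gamma> \<Lambda> by (rule att)
  let ?A = "exp_sum {1..n} \<theta>"
  have site: "(ustep k \<beta> \<Lambda> ^^ N) (\<lambda>y. exp (\<theta> * real (y i))) x \<le> exp (\<theta> * real b) * T.growth \<theta> N"
    if i: "i \<in> H" for i
  proof -
    obtain a l where al: "1 \<le> a" "a + l \<le> k + 1" "l + 2 \<le> k" "a \<le> i" "i < a + l" "{a..<a + l} \<subseteq> H"
      "a - 1 = 0 \<or> a - 1 \<in> S" "a + l = k + 1 \<or> a + l \<in> S"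
      using block_exists[OF i S] by blast
    have l: "1 \<le> l" "l \<le> n" using al kn by auto
    have "(ustep k \<beta> \<Lambda> ^^ N) (\<lambda>y. exp (\<theta> * real (y i))) x \<le> (ustep n \<gamma> \<Lambda> ^^ N) ?A (restr a l x)"
    proof (rule ustep_pow_le[where Q="separated S H" and F="\<lambda>s y. (ustep n \<gamma> \<Lambda> ^^ s) ?A (restr a l y)"])
      fix y
      have "i - a + 1 \<in> {1..n}" "restr a l y (i - a + 1) = y i" using al l by (auto simp: restr_def)
      then show "exp (\<theta> * real (y i)) \<le> (ustep n \<gamma> \<Lambda> ^^ 0) ?A (restr a l y)"
        using member_le_sum[of "i - a + 1" "{1..n}" "\<lambda>j. exp (\<theta> * real (restr a l y j))"]
        by (simp add: exp_sum_def)
    next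
      fix s y assume y: "separated S H (Suc s) y"
      have "a \<in> H" "a + l - 1 \<in> H" using al(6) l by (auto simp: subset_eq)
      moreover have "y 0 = 0" "y (k + 1) = 0" using y by (auto simp: separated_def crystal_config_def)
      moreover have "y j \<le> y j'" if "j \<in> S" "j' \<in> H" for j j'
        using y that unfolding separated_def by force
      ultimately have "y (a - 1) \<le> y a" "y (a + l) \<le> y (a + l - 1)"
        using al(7,8) by auto
      then have "ustep k \<beta> \<Lambda> (\<lambda>y. (ustep n \<gamma> \<Lambda> ^^ s) ?A (restr a l y)) y
          \<le> ustep n \<gamma> \<Lambda> ((ustep n \<gamma> \<Lambda> ^^ s) ?A) (restr a l y)"
        by (intro ustep_restr_le T.mono_ustep_pow T.mono_exp_sum \<theta> \<Lambda>_pos l al \<gamma> T.rate_nonneg)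
      then show "ustep k \<beta> \<Lambda> (\<lambda>y. (ustep n \<gamma> \<Lambda> ^^ s) ?A (restr a l y)) y
          \<le> (ustep n \<gamma> \<Lambda> ^^ Suc s) ?A (restr a l y)" by simp
    qed (fact separated_Suc separated_grow x(1))+
    also have "\<dots> \<le> exp (\<theta> * real b) * T.growth \<theta> N"
    proof (rule T.ustep_pow_le_growth[OF \<theta>])
      show "crystal_config n (restr a l x)" using l by (auto simp: crystal_config_def restr_def)
      show "restr a l x j \<le> b" for j
      proof (cases "1 \<le> j \<and> j \<le> l")
        case True
        then have "a + j - 1 \<in> {1..k}" using al(1,2) by auto
        then show ?thesis using x(2) True by (simp add: restr_def)
      qed (auto simp: restr_def)
    qed
    finally show ?thesis .
  qed
  have "(ustep k \<beta> \<Lambda> ^^ N) (exp_sum H \<theta>) x = (\<Sum>i\<in>H. (ustep k \<beta> \<Lambda> ^^ N) (\<lambda>y. exp (\<theta> * real (y i))) x)"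
    unfolding exp_sum_def by (rule ustep_pow_sum)
  also have "\<dots> \<le> (\<Sum>i\<in>H. exp (\<theta> * real b) * T.growth \<theta> N)" by (intro sum_mono site)
  also have "\<dots> \<le> real k * (exp (\<theta> * real b) * T.growth \<theta> N)"
    using card_SH T.growth_nonneg by (simp add: mult_right_mono)
  finally show ?thesis by (simp add: mult_ac)
qed

end

end

section \<open>Drift of the spread and ergodicity of the shape\<close>

lemma shape_eq_diff:
  assumes "shape k x = shape k x'" "i \<in> {1..k}" "j \<in> {1..k}"
  shows "int (x i) - int (x j) = int (x' i) - int (x' j)"
proof -
  have *: "int (x i) - int (x' i) = int (x 1) - int (x' 1)" if "1 \<le> i" "i \<le> k" for i
    using that
  proof (induction i rule: dec_induct)
    case (step l)
    have "shape k x l = shape k x' l" using assms(1) by simp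
    then show ?case using step by (simp add: shape_def)
  qed simp
  from *[of i] *[of j] show ?thesis using assms(2,3) by simp
qed

lemma shape_eq_less_iff:
  assumes "shape k x = shape k x'" "i \<in> {1..k}" "j \<in> {1..k}"
  shows "x i < x j \<longleftrightarrow> x' i < x' j"
  using shape_eq_diff[OF assms] by linarith

text \<open>Equal shapes differ by one constant on \<open>1..k\<close>, and the boundary is never
  higher than a site. Hence the choice of \<open>x\<close> in \<open>shape_rate\<close> does not
  influence the rates.\<close>

lemma Vn_shape_eq:
  assumes c: "crystal_config k x" "crystal_config k x'" and s: "shape k x = shape k x'"
    and j: "j \<in> {1..k}"
  shows "Vn j x = Vn j x'"
proof -
  have z: "x 0 = 0" "x' 0 = 0" "x (Suc k) = 0" "x' (Suc k) = 0" using c by (auto simp: crystal_config_def)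
  have "x j < x (j - 1) \<longleftrightarrow> x' j < x' (j - 1)"
  proof (cases "j = 1")
    case False
    then have "j - 1 \<in> {1..k}" using j by auto
    then show ?thesis by (rule shape_eq_less_iff[OF s j])
  qed (use z in simp)
  moreover have "x j < x (j + 1) \<longleftrightarrow> x' j < x' (j + 1)"
  proof (cases "j = k")
    case False
    then have "j + 1 \<in> {1..k}" using j by auto
    then show ?thesis by (rule shape_eq_less_iff[OF s j])
  qed (use z in simp)
  ultimately show ?thesis by (simp only: Vn_def)
qed

lemma shape_grow_eq:
  assumes "shape k x = shape k x'" shows "shape k (grow x j) = shape k (grow x' j)"
proof
  fix i
  have "shape k x i = shape k x' i" using assms by simp
  then show "shape k (grow x j) i = shape k (grow x' j) i" by (auto simp: shape_def)
qed

lemma shape_grow_neq: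
  assumes "2 \<le> k" "j \<in> {1..k}" shows "shape k (grow x j) \<noteq> shape k x"
proof (cases "j < k")
  case True
  then have "shape k (grow x j) j \<noteq> shape k x j" using assms by (auto simp: shape_def)
  then show ?thesis by auto
next
  case False
  then have "shape k (grow x j) (k - 1) \<noteq> shape k x (k - 1)" using assms by (auto simp: shape_def)
  then show ?thesis by auto
qed

lemma shape_in_space: "shape k x \<in> shape_space k"
  by (auto simp: shape_def shape_space_def)

lemma shape_lift: "shape k (lift k c x) = shape k x"
  by (auto simp: shape_def lift_def fun_eq_iff)

lemma shape_surj:
  assumes "h \<in> shape_space k" shows "\<exists>x. crystal_config k x \<and> shape k x = h"
proof -
  \<comment> \<open>Heights are summed up from the right end; the shift \<open>C\<close> makes them
    nonnegative.\<close>
  define C where "C = (\<Sum>l\<in>{1..<k}. \<bar>h l\<bar>)"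
  define x where "x i = (if i \<in> {1..k} then nat ((\<Sum>l\<in>{i..<k}. h l) + C) else 0)" for i
  have nn: "0 \<le> (\<Sum>l\<in>{i..<k}. h l) + C" if "1 \<le> i" for i
  proof -
    have "- (\<Sum>l\<in>{i..<k}. h l) \<le> (\<Sum>l\<in>{i..<k}. \<bar>h l\<bar>)" by (simp flip: sum_negf) (intro sum_mono, auto)
    also have "\<dots> \<le> C" unfolding C_def using that by (intro sum_mono2) auto
    finally show ?thesis by simp
  qed
  have "shape k x i = h i" for i
  proof (cases "1 \<le> i \<and> i < k")
    case True
    then have "(\<Sum>l\<in>{i..<k}. h l) = h i + (\<Sum>l\<in>{Suc i..<k}. h l)" by (simp add: sum.atLeast_Suc_lessThan)
    then show ?thesis using True nn[of i] nn[of "Suc i"] by (simp add: shape_def x_def)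
  next
    case False
    then show ?thesis using assms by (auto simp: shape_def shape_space_def)
  qed
  moreover have "crystal_config k x" by (auto simp: crystal_config_def x_def)
  ultimately show ?thesis by blast
qed

text \<open>The very choice made inside \<open>shape_rate\<close>, so that
  \<open>shape_rate_rep\<close> holds by unfolding.\<close>

definition rep :: "nat \<Rightarrow> (nat \<Rightarrow> int) \<Rightarrow> nat \<Rightarrow> nat" where
  "rep k h = (SOME x. crystal_config k x \<and> shape k x = h)"

lemma rep: 
  assumes "h \<in> shape_space k" shows "crystal_config k (rep k h)" "shape k (rep k h) = h"
  using someI_ex[OF shape_surj[OF assms]] unfolding rep_def by auto

lemma shape_rate_rep:
  "shape_rate k \<beta> h z
    = (\<Sum>j\<in>{1..k}. if z = shape k (grow (rep k h) j) then \<beta> (Vn j (rep k h)) else 0)"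
  by (simp only: shape_rate_def rep_def Let_def)

definition shape_inv :: "nat \<Rightarrow> ((nat \<Rightarrow> nat) \<Rightarrow> real) \<Rightarrow> bool" where
  "shape_inv k f \<longleftrightarrow> (\<forall>x x'. crystal_config k x \<longrightarrow> crystal_config k x' \<longrightarrow> shape k x = shape k x' \<longrightarrow> f x = f x')"

lemma shape_inv_ustep:
  assumes f: "shape_inv k f" shows "shape_inv k (ustep k \<beta> \<Lambda> f)"
  unfolding shape_inv_def
proof (intro allI impI)
  fix x x' assume x: "crystal_config k x" "crystal_config k x'" "shape k x = shape k x'"
  have "f x = f x'" using f x unfolding shape_inv_def by blast
  moreover have "f (grow x j) = f (grow x' j)" if j: "j \<in> {1..k}" for j
    using f crystal_config_grow[OF x(1) j] crystal_config_grow[OF x(2) j] shape_grow_eq[OF x(3), of j]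
    unfolding shape_inv_def by blast
  ultimately show "ustep k \<beta> \<Lambda> f x = ustep k \<beta> \<Lambda> f x'"
    unfolding ustep_def using Vn_shape_eq[OF x] by simp
qed

lemma shape_inv_ustep_pow: "shape_inv k f \<Longrightarrow> shape_inv k ((ustep k \<beta> \<Lambda> ^^ N) f)"
  by (induction N) (simp_all add: shape_inv_ustep)

section \<open>The spread and its drift over \<open>M\<close> steps\<close>

context crystal
begin

definition spread :: "(nat \<Rightarrow> nat) \<Rightarrow> real" where
  "spread x = Max ((\<lambda>(i, j). real (x i) - real (x j)) ` ({1..k} \<times> {1..k}))"

lemma spread_ge: "i \<in> {1..k} \<Longrightarrow> j \<in> {1..k} \<Longrightarrow> real (x i) - real (x j) \<le> spread x"
  unfolding spread_def by (rule Max_ge) auto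

lemma spread_attained: "\<exists>i\<in>{1..k}. \<exists>j\<in>{1..k}. spread x = real (x i) - real (x j)"
proof -
  have "spread x \<in> (\<lambda>(i, j). real (x i) - real (x j)) ` ({1..k} \<times> {1..k})"
    unfolding spread_def using k2 by (intro Max_in) auto
  then show ?thesis by auto
qed

lemma spread_nonneg: "0 \<le> spread x"
  using spread_ge[of 1 1 x] k2 by simp

lemma spread_grow: "spread (grow x j) \<le> spread x + 1"
proof -
  obtain a b where ab: "a \<in> {1..k}" "b \<in> {1..k}" "spread (grow x j) = real (grow x j a) - real (grow x j b)"
    using spread_attained by blast
  then show ?thesis using spread_ge[of a b x] by (auto split: if_splits)
qed

lemma shape_inv_spread: "shape_inv k spread"
  unfolding shape_inv_def
proof (intro allI impI)
  fix x x' assume s: "shape k x = shape k x'"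
  have "real (x i) - real (x j) = real (x' i) - real (x' j)" if "i \<in> {1..k}" "j \<in> {1..k}" for i j
    using shape_eq_diff[OF s that] by linarith
  then show "spread x = spread x'" unfolding spread_def by (intro arg_cong[of _ _ Max] image_cong) auto
qed

text \<open>Pigeonhole on the levels \<open>x q + t * M\<close> above the lowest site
  \<open>q\<close>: of \<open>k + 1\<close> nested nonempty sets of sites two consecutive ones
  agree, so a layer of thickness \<open>M\<close> contains no height. The bound on the spread puts
  the highest site above this layer.\<close>

lemma split_exists:
  assumes sp: "real ((k + 1) * M) < spread x" and M: "1 \<le> M" and x: "crystal_config k x"
  obtains S H where "S \<union> H = {1..k}" "S \<inter> H = {}" "S \<noteq> {}" "H \<noteq> {}" "separated S H M x"
proof -
  obtain p q where pq: "p \<in> {1..k}" "q \<in> {1..k}" "spread x = real (x p) - real (x q)"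
    using spread_attained by blast
  have min: "x q \<le> x i" if "i \<in> {1..k}" for i using spread_ge[OF pq(1) that, of x] pq(3) by simp
  define L where "L t = {i \<in> {1..k}. x i \<le> x q + t * M}" for t
  have finL: "finite (L t)" for t by (simp add: L_def)
  have "\<exists>t<k. L t = L (Suc t)"
  proof (rule ccontr)
    assume neq: "\<not> ?thesis"
    have "t + 1 \<le> card (L t)" if "t \<le> k" for t
      using that
    proof (induction t)
      case 0
      have "q \<in> L 0" using pq by (simp add: L_def)
      then show ?case using finL[of 0] card_gt_0_iff[of "L 0"] by force
    next
      case (Suc t)
      have "L t \<subset> L (Suc t)" using neq Suc.prems by (force simp: L_def)
      then have "card (L t) < card (L (Suc t))" by (rule psubset_card_mono[OF finL])
      then show ?case using Suc by simp
    qed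
    from this[of k] have "k + 1 \<le> card (L k)" by simp
    moreover have "card (L k) \<le> card {1..k}" by (intro card_mono) (auto simp: L_def)
    ultimately show False by simp
  qed
  then obtain t where t: "t < k" "L t = L (Suc t)" by blast
  show thesis
  proof (rule that[of "L t" "{1..k} - L t"])
    show "L t \<noteq> {}" using pq by (auto simp: L_def)
    have "x q + t * M < x p"
    proof -
      have "(k + 1) * M < x p - x q" using sp pq(3) min[OF pq(1)]
        by (metis of_nat_diff of_nat_less_iff)
      moreover have "t * M \<le> (k + 1) * M" using t by (intro mult_right_mono) auto
      ultimately show ?thesis by linarith
    qed
    then show "{1..k} - L t \<noteq> {}" using pq(1) by (auto simp: L_def)
    show "separated (L t) ({1..k} - L t) M x"
      unfolding separated_def
    proof (intro conjI ballI x)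
      fix i j assume ij: "i \<in> L t" "j \<in> {1..k} - L t"
      have "j \<notin> L (Suc t)" using ij t by simp
      then have "x q + (t * M + M) < x j" using ij by (auto simp: L_def add.commute)
      moreover have "x i \<le> x q + t * M" using ij by (simp add: L_def)
      ultimately show "x i + M \<le> x j" by linarith
    qed
  qed (auto simp: L_def)
qed

text \<open>Jensen's inequality for the logarithm, made linear by tangents at \<open>c1\<close> and
  \<open>c2\<close>, the bounds on the two expectations. The product of moments becomes a sum, so
  the dependence of high and low sites does not matter.\<close>

lemma log_drift:
  assumes part: "S \<union> H = {1..k}" "S \<noteq> {}" "H \<noteq> {}" and sep: "separated S H M x" and \<theta>: "0 < \<theta>"
    and K: "0 < K\<^sub>1" "0 < K\<^sub>2" "K\<^sub>1 * K\<^sub>2 \<le> exp (- 1)"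
    and high: "(ustep k \<beta> \<Lambda> ^^ M) (exp_sum H \<theta>) x \<le> K\<^sub>1 * exp (\<theta> * real b)"
    and low: "(ustep k \<beta> \<Lambda> ^^ M) (exp_sum S (- \<theta>)) x \<le> K\<^sub>2 * exp (- \<theta> * real a)"
    and ab: "spread x = real b - real a"
  shows "(ustep k \<beta> \<Lambda> ^^ M) (\<lambda>y. \<theta> * spread y) x \<le> \<theta> * spread x - 1"
proof -
  let ?u = "ustep k \<beta> \<Lambda>"
  define c1 where "c1 = K\<^sub>1 * exp (\<theta> * real b)"
  define c2 where "c2 = K\<^sub>2 * exp (- \<theta> * real a)"
  have c: "0 < c1" "0 < c2" using K by (auto simp: c1_def c2_def)
  have lnle: "r \<le> ln C - 1 + (1 / C) * A" if "0 < C" "exp r \<le> A" for r C A :: real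
  proof -
    have "1 + (r - ln C) \<le> exp (r - ln C)" by (rule exp_ge_add_one_self)
    also have "\<dots> = exp r / C" using that by (simp add: exp_diff)
    also have "\<dots> \<le> A / C" using that by (intro divide_right_mono) auto
    finally show ?thesis by simp
  qed
  define G where "G y = (ln c1 - 1 + (ln c2 - 1)) + ((1 / c1) * exp_sum H \<theta> y + (1 / c2) * exp_sum S (- \<theta>) y)" for y
  have fin: "finite S" "finite H" using part(1) finite_Un[of S H] by auto
  have le: "\<theta> * spread y \<le> G y" if y: "separated S H 0 y" for y
  proof -
    obtain i j where ij: "i \<in> {1..k}" "j \<in> {1..k}" "spread y = real (y i) - real (y j)"
      using spread_attained by blast
    have sh: "y s \<le> y h" if "s \<in> S" "h \<in> H" for s h using y that by (auto simp: separated_def)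
    \<comment> \<open>Even with no steps left every low site is at most as high as every high site,
      so the maximum can be sought in \<open>H\<close> and the minimum in \<open>S\<close>.\<close>
    obtain h where h: "h \<in> H" "y i \<le> y h" using part ij(1) sh by blast
    obtain s where s: "s \<in> S" "y s \<le> y j" using part ij(2) sh by blast
    have "\<theta> * real (y h) \<le> ln c1 - 1 + (1 / c1) * exp_sum H \<theta> y"
      using c h fin unfolding exp_sum_def
      by (intro lnle member_le_sum[of h H "\<lambda>i. exp (\<theta> * real (y i))"]) auto
    moreover have "- \<theta> * real (y s) \<le> ln c2 - 1 + (1 / c2) * exp_sum S (- \<theta>) y"
      using c s fin unfolding exp_sum_def
      by (intro lnle member_le_sum[of s S "\<lambda>i. exp (- \<theta> * real (y i))"]) auto
    moreover have "\<theta> * spread y \<le> \<theta> * real (y h) + - \<theta> * real (y s)"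
    proof -
      have "\<theta> * spread y \<le> \<theta> * (real (y h) - real (y s))" using ij h s \<theta> by (intro mult_left_mono) auto
      then show ?thesis by (simp add: algebra_simps)
    qed
    ultimately show ?thesis unfolding G_def by linarith
  qed
  have "(?u ^^ M) (\<lambda>y. \<theta> * spread y) x \<le> (?u ^^ M) G x"
    by (rule ustep_pow_le[where Q="separated S H" and F="\<lambda>s. (?u ^^ s) G"])
       (simp_all only: funpow_0 le sep separated_Suc separated_grow, simp)
  also have "\<dots> = (ln c1 - 1 + (ln c2 - 1)) + ((1 / c1) * (?u ^^ M) (exp_sum H \<theta>) x + (1 / c2) * (?u ^^ M) (exp_sum S (- \<theta>)) x)"
    unfolding G_def by (simp only: ustep_pow_add ustep_pow_const ustep_pow_scale)
  also have "\<dots> \<le> (ln c1 - 1 + (ln c2 - 1)) + ((1 / c1) * c1 + (1 / c2) * c2)"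
    using high low c unfolding c1_def[symmetric] c2_def[symmetric] by (intro add_left_mono add_mono mult_left_mono) auto
  also have "\<dots> = ln c1 + ln c2" using c by simp
  also have "\<dots> = ln (K\<^sub>1 * K\<^sub>2) + \<theta> * spread x"
    unfolding c1_def c2_def ab using K by (simp add: ln_mult algebra_simps)
  also have "ln (K\<^sub>1 * K\<^sub>2) \<le> - 1" using K ln_mono[of "K\<^sub>1 * K\<^sub>2" "exp (- 1)"] by simp
  finally show ?thesis by simp
qed

text \<open>\<open>c1\<close> and \<open>c2\<close> say that the growth factor of the high moment
  times the decay factor of the low moment is below 1, in the general and in the end-site case. Over
  many steps this beats all prefactors.\<close>

lemma spread_drift:
  assumes att: "attractive_crystal n \<gamma> \<Lambda>" and kn: "k \<le> n + 2"
    and \<gamma>: "\<And>v. v \<le> 2 \<Longrightarrow> \<beta> v \<le> \<gamma> v"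
    and \<theta>: "0 < \<theta>" and \<eta>: "0 < \<eta>" "\<eta> \<le> 1" "real k * \<eta> \<le> 1" and \<rho>: "1 \<le> \<rho>"
    and growth: "attractive_crystal.growth n \<gamma> \<Lambda> \<theta> N < \<rho> ^ N"
    and c1: "\<rho> * (1 - (1 - exp (- \<theta>)) * (1 - real k * \<eta>) * \<beta> 2 / \<Lambda>) < 1"
    and c2: "(1 + (exp \<theta> - 1) * (\<beta> 1 - (\<beta> 1 - \<beta> 0) / real k) / \<Lambda>) * (1 - (1 - exp (- \<theta>)) * \<beta> 1 / \<Lambda>) < 1"
  shows "\<exists>M\<ge>1. \<forall>x. crystal_config k x \<and> real ((k + 1) * M) < spread x \<longrightarrow>
    (ustep k \<beta> \<Lambda> ^^ M) (\<lambda>y. \<theta> * spread y) x \<le> \<theta> * spread x - 1"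
proof -
  interpret T: attractive_crystal n \<gamma> \<Lambda> by (rule att)
  define \<sigma> where "\<sigma> = 1 - (1 - exp (- \<theta>)) * (1 - real k * \<eta>) * \<beta> 2 / \<Lambda>"
  define \<rho>' where "\<rho>' = 1 + (exp \<theta> - 1) * (\<beta> 1 - (\<beta> 1 - \<beta> 0) / real k) / \<Lambda>"
  define \<sigma>' where "\<sigma>' = 1 - (1 - exp (- \<theta>)) * \<beta> 1 / \<Lambda>"
  have "(\<beta> 1 - \<beta> 0) / real k \<le> (\<beta> 1 - \<beta> 0) / 1" using k2 \<beta>02 \<beta>21 by (intro divide_left_mono) auto
  then have \<rho>': "1 \<le> \<rho>'" using \<theta> \<Lambda>_pos \<beta>0 by (simp add: \<rho>'_def)
  have b\<Lambda>: "\<beta> 1 \<le> \<Lambda>"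
  proof -
    have "1 * \<beta> 1 \<le> real k * \<beta> 1" using k2 \<beta>0 \<beta>02 \<beta>21 by (intro mult_right_mono) auto
    then show ?thesis using rate_le[of 1] by simp
  qed
  have \<sigma>': "0 \<le> \<sigma>'"
  proof -
    have "(1 - exp (- \<theta>)) * \<beta> 1 \<le> 1 * \<beta> 1" using \<beta>0 \<beta>02 \<beta>21 by (intro mult_right_mono) auto
    then show ?thesis using b\<Lambda> \<Lambda>_pos by (simp add: \<sigma>'_def)
  qed
  have \<sigma>: "0 \<le> \<sigma>"
  proof -
    have "((1 - exp (- \<theta>)) * (1 - real k * \<eta>)) * \<beta> 2 \<le> 1 * \<beta> 1"
      using \<eta> \<beta>0 \<beta>02 \<beta>21 \<theta> by (intro mult_mono mult_le_one) auto
    then show ?thesis using b\<Lambda> \<Lambda>_pos by (simp add: \<sigma>_def)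
  qed
  \<comment> \<open>At \<open>N = 0\<close> the left side of \<open>growth\<close> is
    \<open>n\<close> and the right side is 1. Positivity of \<open>N\<close> is needed for
    \<open>q \<le> q * N\<close>.\<close>
  have N: "1 \<le> N"
  proof (rule ccontr)
    assume "\<not> ?thesis"
    then have "N = 0" by simp
    then show False using growth T.m_pos by (simp add: T.growth_def exp_sum_def)
  qed
  \<comment> \<open>The prefactors of the general case: \<open>k\<close> from
    \<open>high_block\<close>, \<open>n\<close> from \<open>growth_mult\<close>,
    \<open>k / \<eta> ^ k\<close> from \<open>low_general\<close>.\<close>
  define D where "D = real k * real n * (real k / \<eta> ^ k)"
  have D: "0 < D" unfolding D_def using k2 T.m_pos \<eta> by simp
  have small: "\<forall>\<^sub>F q in sequentially. C * z ^ q < exp (- 1)" if z: "0 \<le> z" "z < 1" for C z :: real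
  proof -
    have "(\<lambda>q. C * z ^ q) \<longlonglongrightarrow> C * 0"
      using z by (intro tendsto_mult tendsto_const LIMSEQ_realpow_zero) auto
    then show ?thesis by (rule order_tendstoD(2)) simp
  qed
  have z: "0 \<le> \<rho> * \<sigma>" "\<rho> * \<sigma> < 1" "0 \<le> \<rho>' * \<sigma>'" "\<rho>' * \<sigma>' < 1"
    using c1 c2 \<rho> \<rho>' \<sigma> \<sigma>' by (simp_all add: \<sigma>_def \<rho>'_def \<sigma>'_def)
  have "\<forall>\<^sub>F q in sequentially. D * (\<rho> * \<sigma>) ^ q < exp (- 1) \<and> real k * (\<rho>' * \<sigma>') ^ q < exp (- 1) \<and> 1 \<le> q"
    by (intro eventually_conj small z eventually_ge_at_top)
  then obtain q where q: "D * (\<rho> * \<sigma>) ^ q < exp (- 1)" "real k * (\<rho>' * \<sigma>') ^ q < exp (- 1)" "1 \<le> q"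
    using eventually_happens'[OF sequentially_bot] by blast
  \<comment> \<open>A multiple of \<open>N\<close>, because \<open>growth_mult\<close> bounds the
    moments only there.\<close>
  define M where "M = q * N"
  have qM: "q \<le> M" using N by (simp add: M_def)
  have "D * (\<rho> * \<sigma>) ^ M \<le> D * (\<rho> * \<sigma>) ^ q"
    using D z qM by (intro mult_left_mono power_decreasing) auto
  then have M1: "(D * \<rho> ^ M) * \<sigma> ^ M \<le> exp (- 1)" using q(1) by (simp add: power_mult_distrib mult_ac)
  have "real k * (\<rho>' * \<sigma>') ^ M \<le> real k * (\<rho>' * \<sigma>') ^ q"
    using z qM by (intro mult_left_mono power_decreasing) auto
  then have M2: "(real k * \<rho>' ^ M) * \<sigma>' ^ M \<le> exp (- 1)" using q(2) by (simp add: power_mult_distrib mult_ac)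
  have gM: "T.growth \<theta> M \<le> real n * \<rho> ^ M"
    unfolding M_def using \<theta> growth \<rho> by (intro T.growth_mult) auto
  have kpos: "0 < real k" "0 < real n" using k2 T.m_pos by auto
  show ?thesis
  proof (intro exI[of _ M] conjI allI impI)
    show "1 \<le> M" using qM q(3) by simp
    fix x assume "crystal_config k x \<and> real ((k + 1) * M) < spread x"
    then obtain S H where SH: "S \<union> H = {1..k}" "S \<inter> H = {}" "S \<noteq> {}" "H \<noteq> {}" "separated S H M x"
      using split_exists[OF _ \<open>1 \<le> M\<close>] by blast
    obtain p r where pr: "p \<in> {1..k}" "r \<in> {1..k}" "spread x = real (x p) - real (x r)"
      using spread_attained by blast
    have max: "x i \<le> x p" if "i \<in> {1..k}" for i using spread_ge[OF that pr(2), of x] pr(3) by simp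
    have min: "x r \<le> x i" if "i \<in> {1..k}" for i using spread_ge[OF pr(1) that, of x] pr(3) by simp
    have bounds: "\<And>i. i \<in> S \<Longrightarrow> x r \<le> x i" "\<And>i. i \<in> H \<Longrightarrow> x i \<le> x p"
      using SH(1) max min by blast+
    show "(ustep k \<beta> \<Lambda> ^^ M) (\<lambda>y. \<theta> * spread y) x \<le> \<theta> * spread x - 1"
    proof (cases "S = {1} \<or> S = {k}")
      case True
      define K1 where "K1 = real k * \<rho>' ^ M"
      have K1: "0 < K1" using kpos \<rho>' by (simp add: K1_def)
      show ?thesis
      proof (rule log_drift[OF SH(1,3,4,5) \<theta> K1 _ _ _ _ pr(3)])
        show "0 < exp (- 1) / K1" "K1 * (exp (- 1) / K1) \<le> exp (- 1)" using K1 by auto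
        show "(ustep k \<beta> \<Lambda> ^^ M) (exp_sum H \<theta>) x \<le> K1 * exp (\<theta> * real (x p))"
          unfolding K1_def \<rho>'_def using bounds(2) by (rule high_crude[OF SH(1-4) less_imp_le[OF \<theta>] SH(5)])
        have "\<sigma>' ^ M \<le> exp (- 1) / K1" using M2 K1 by (simp add: K1_def field_simps)
        then have "\<sigma>' ^ M * exp (- \<theta> * real (x r)) \<le> exp (- 1) / K1 * exp (- \<theta> * real (x r))"
          by (intro mult_right_mono) auto
        moreover have "(ustep k \<beta> \<Lambda> ^^ M) (exp_sum S (- \<theta>)) x \<le> \<sigma>' ^ M * exp (- \<theta> * real (x r))"
          unfolding \<sigma>'_def using bounds(1) by (rule low_end[OF SH(1-4) less_imp_le[OF \<theta>] True SH(5)])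
        ultimately show "(ustep k \<beta> \<Lambda> ^^ M) (exp_sum S (- \<theta>)) x \<le> exp (- 1) / K1 * exp (- \<theta> * real (x r))"
          by linarith
      qed
    next
      case False
      define K1 where "K1 = real k * (real n * \<rho> ^ M)"
      have K1: "0 < K1" using kpos \<rho> by (simp add: K1_def)
      show ?thesis
      proof (rule log_drift[OF SH(1,3,4,5) \<theta> K1 _ _ _ _ pr(3)])
        show "0 < exp (- 1) / K1" "K1 * (exp (- 1) / K1) \<le> exp (- 1)" using K1 by auto
        have "real k * T.growth \<theta> M * exp (\<theta> * real (x p)) \<le> K1 * exp (\<theta> * real (x p))"
          using gM kpos by (simp add: K1_def)
        moreover have "(ustep k \<beta> \<Lambda> ^^ M) (exp_sum H \<theta>) x \<le> real k * T.growth \<theta> M * exp (\<theta> * real (x p))"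
          by (rule high_block[OF SH(1-4) att kn \<gamma> _ _ less_imp_le[OF \<theta>] SH(5)]) (use False max in auto)
        ultimately show "(ustep k \<beta> \<Lambda> ^^ M) (exp_sum H \<theta>) x \<le> K1 * exp (\<theta> * real (x p))"
          by linarith
        have "real k / \<eta> ^ k * \<sigma> ^ M \<le> exp (- 1) / K1" using M1 K1 by (simp add: K1_def D_def field_simps)
        then have "real k / \<eta> ^ k * \<sigma> ^ M * exp (- \<theta> * real (x r)) \<le> exp (- 1) / K1 * exp (- \<theta> * real (x r))"
          by (intro mult_right_mono) auto
        moreover have "(ustep k \<beta> \<Lambda> ^^ M) (exp_sum S (- \<theta>)) x
            \<le> real k / \<eta> ^ k * \<sigma> ^ M * exp (- \<theta> * real (x r))"
          unfolding \<sigma>_def using bounds(1) by (rule low_general[OF SH(1-4) less_imp_le[OF \<theta>] \<eta> SH(5)])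
        ultimately show "(ustep k \<beta> \<Lambda> ^^ M) (exp_sum S (- \<theta>)) x \<le> exp (- 1) / K1 * exp (- \<theta> * real (x r))"
          by linarith
      qed
    qed
  qed
qed

section \<open>The jump chain of the shape process\<close>

lemma exit_rate_shape:
  assumes "h \<in> shape_space k"
  shows "exit_rate (shape_rate k \<beta>) h = (\<Sum>j\<in>{1..k}. \<beta> (Vn j (rep k h)))"
proof (rule exit_rate_finite_jumps[where t="\<lambda>j. shape k (grow (rep k h) j)"])
  show "shape k (grow (rep k h) j) \<noteq> h" if "j \<in> {1..k}" for j
    using shape_grow_neq[OF k2 that, of "rep k h"] rep(2)[OF assms] by simp
qed (simp_all only: shape_rate_rep finite_atLeastAtMost)

lemma shape_exit_bounds:
  assumes "h \<in> shape_space k"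
  shows "real k * \<beta> 0 \<le> exit_rate (shape_rate k \<beta>) h" "exit_rate (shape_rate k \<beta>) h \<le> \<Lambda>"
proof -
  have "(\<Sum>j\<in>{1..k}. \<beta> 0) \<le> (\<Sum>j\<in>{1..k}. \<beta> (Vn j (rep k h)))" by (intro sum_mono rate_ge_\<beta>0)
  then show "real k * \<beta> 0 \<le> exit_rate (shape_rate k \<beta>) h" unfolding exit_rate_shape[OF assms] by simp
  show "exit_rate (shape_rate k \<beta>) h \<le> \<Lambda>" unfolding exit_rate_shape[OF assms] by (rule rates_sum_le)
qed

sublocale chain: finite_jump_chain "shape_rate k \<beta>" "shape_space k" "{1..k}"
  "\<lambda>h j. \<beta> (Vn j (rep k h)) / exit_rate (shape_rate k \<beta>) h"
  "\<lambda>h j. shape k (grow (rep k h) j)" "real k * \<beta> 0"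
proof
  show pos: "0 < real k * \<beta> 0" using k2 \<beta>0 by simp
  fix y assume y: "y \<in> shape_space k"
  note bounds = shape_exit_bounds[OF y]
  show "real k * \<beta> 0 \<le> exit_rate (shape_rate k \<beta>) y" by (rule bounds)
  show "(\<Sum>\<^sub>\<infinity>z. jump_prob (shape_rate k \<beta>) y z * f z)
      = (\<Sum>j\<in>{1..k}. \<beta> (Vn j (rep k y)) / exit_rate (shape_rate k \<beta>) y * f (shape k (grow (rep k y) j)))" for f
  proof (rule jump_prob_finite_jumps)
    show "shape k (grow (rep k y) j) \<noteq> y" if "j \<in> {1..k}" for j
      using shape_grow_neq[OF k2 that, of "rep k y"] rep(2)[OF y] by simp
  qed (simp_all only: shape_rate_rep finite_atLeastAtMost)
  show "(\<Sum>j\<in>{1..k}. \<beta> (Vn j (rep k y)) / exit_rate (shape_rate k \<beta>) y) = 1"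
    using pos bounds unfolding sum_divide_distrib[symmetric] exit_rate_shape[OF y, symmetric] by simp
  fix j
  show "0 \<le> \<beta> (Vn j (rep k y)) / exit_rate (shape_rate k \<beta>) y"
    using pos bounds rate_nonneg[OF Vn_le_2] by (intro divide_nonneg_nonneg) auto
qed (auto simp: shape_in_space)

text \<open>Missing units are added one at a time, each by a jump of positive probability; the
  induction is on their number and stops early if the target shape is met.\<close>

lemma shape_reachable:
  assumes y: "crystal_config k y"
  shows "crystal_config k x \<Longrightarrow> x \<le> y \<Longrightarrow> \<exists>L. 0 < chain.hit_within (shape k y) L (shape k x)"
proof (induction "\<Sum>i\<in>{1..k}. y i - x i" arbitrary: x rule: less_induct)
  case less
  let ?h = "shape k x" and ?i = "shape k y"
  note h = shape_in_space[of k x]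
  show ?case
  proof (cases "?h = ?i")
    case True
    then have "0 < chain.hit_within ?i 0 ?h" by (simp add: chain.hit_within_0)
    then show ?thesis by blast
  next
    case False
    then have "x \<noteq> y" by auto
    then obtain j where "x j \<noteq> y j" by auto
    then have xj: "x j < y j" using less.prems(2) by (metis le_fun_def le_neq_implies_less)
    then have j: "j \<in> {1..k}" using y by (auto simp: crystal_config_def not_less_eq_eq intro: ccontr)
    have "(\<Sum>i\<in>{1..k}. y i - grow x j i) < (\<Sum>i\<in>{1..k}. y i - x i)"
      using j xj by (intro sum_strict_mono_ex1) (auto intro!: bexI[of _ j])
    moreover have "grow x j \<le> y" using less.prems(2) xj by (auto simp: le_fun_def)
    ultimately obtain L where L: "0 < chain.hit_within ?i L (shape k (grow x j))"
      using less.hyps[of "grow x j"] crystal_config_grow[OF less.prems(1) j] by blast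
    let ?p = "\<lambda>j. \<beta> (Vn j (rep k ?h)) / exit_rate (shape_rate k \<beta>) ?h"
    have nxt: "shape k (grow (rep k ?h) j) = shape k (grow x j)"
      by (rule shape_grow_eq) (rule rep(2)[OF h])
    have "0 < ?p j * chain.hit_within ?i L (shape k (grow (rep k ?h) j))"
      unfolding nxt using L \<beta>0 rate_ge_\<beta>0[of j "rep k ?h"] shape_exit_bounds(1)[OF h] chain.l_pos
      by (intro mult_pos_pos divide_pos_pos) auto
    also have "\<dots> \<le> chain.avg (chain.hit_within ?i L) ?h"
      unfolding chain.avg_def
      by (rule member_le_sum[OF j, of "\<lambda>j. ?p j * chain.hit_within ?i L (shape k (grow (rep k ?h) j))"])
         (auto intro!: mult_nonneg_nonneg chain.p_nonneg[OF h] chain.hit_within_nonneg shape_in_space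
           simp del: times_divide_eq_left)
    finally have "0 < chain.hit_within ?i (Suc L) ?h"
      using False chain.hit_within_Suc[OF h] by simp
    then show ?thesis by blast
  qed
qed

text \<open>Heights never decrease, so the target is first raised by a constant that puts it above
  the start; this keeps its shape.\<close>

lemma shape_reachable_all:
  assumes "i \<in> shape_space k" "h \<in> shape_space k"
  shows "\<exists>L. 0 < chain.hit_within i L h"
proof -
  define c where "c = (\<Sum>l\<in>{1..k}. rep k h l)"
  have "rep k h \<le> lift k c (rep k i)"
  proof (rule le_funI)
    fix l show "rep k h l \<le> lift k c (rep k i) l"
    proof (cases "l \<in> {1..k}")
      case True
      then have "rep k h l \<le> c" unfolding c_def by (intro member_le_sum) auto
      then show ?thesis using True by (simp add: lift_def)
    next
      case False
      then show ?thesis using rep(1)[OF assms(2)] by (auto simp: crystal_config_def not_less_eq_eq)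
    qed
  qed
  moreover have "crystal_config k (lift k c (rep k i))" by (auto simp: crystal_config_def lift_def)
  ultimately show ?thesis
    using shape_reachable[of "lift k c (rep k i)" "rep k h"] rep[OF assms(1)] rep[OF assms(2)]
    by (simp add: shape_lift)
qed

text \<open>The uniformized chain may stay put, so passing to the jump chain multiplies the drift of
  \<open>V\<close> by \<open>\<Lambda> / E \<ge> 1\<close>. A drift of at most -1 persists, and on
  \<open>F\<close> the drift stays bounded because \<open>E\<close> is bounded below.\<close>

lemma ergodic_of_spread_drift:
  assumes \<theta>: "0 < \<theta>"
    and drift: "\<And>x. crystal_config k x \<Longrightarrow> B < spread x \<Longrightarrow>
      (ustep k \<beta> \<Lambda> ^^ M) (\<lambda>y. \<theta> * spread y) x \<le> \<theta> * spread x - 1"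
  shows "shape_ergodic k \<beta>"
  unfolding shape_ergodic_def
proof
  fix i assume i: "i \<in> shape_space k"
  let ?u = "ustep k \<beta> \<Lambda>" and ?g = "\<lambda>y. \<theta> * spread y"
  define V where "V x = (\<Sum>s<M. (?u ^^ s) ?g x)" for x
  have g_inv: "shape_inv k ?g" using shape_inv_spread unfolding shape_inv_def by metis
  have V_inv: "V x = V x'" if "crystal_config k x" "crystal_config k x'" "shape k x = shape k x'" for x x'
    unfolding V_def using shape_inv_ustep_pow[OF g_inv] that unfolding shape_inv_def by (intro sum.cong) blast+
  have V0: "0 \<le> V x" for x
    unfolding V_def using \<theta> spread_nonneg by (intro sum_nonneg ustep_pow_nonneg) auto
  have uV: "?u V x = V x + ((?u ^^ M) ?g x - ?g x)" for x
  proof -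
    have "?u V x = (\<Sum>s<M. (?u ^^ Suc s) ?g x)"
      unfolding V_def by (simp add: ustep_sum)
    also have "\<dots> = V x + ((?u ^^ M) ?g x - (?u ^^ 0) ?g x)"
      using sum_lessThan_telescope[of "\<lambda>s. (?u ^^ s) ?g x" M] unfolding V_def by (simp only: sum_subtractf)
    finally show ?thesis by simp
  qed
  have crude: "(?u ^^ M) ?g x \<le> ?g x + \<theta> * real M" for x
  proof -
    have "(?u ^^ M) ?g x \<le> (\<lambda>s x. ?g x + \<theta> * real s) M x"
    proof (rule ustep_pow_le[where Q="\<lambda>_ _. True"])
      fix s y
      have "?u (\<lambda>x. ?g x + \<theta> * real s) y \<le> ?u (\<lambda>_. ?g y + \<theta> * real (Suc s)) y"
      proof (rule ustep_mono_at)
        fix j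
        have "\<theta> * spread (grow y j) \<le> \<theta> * (spread y + 1)"
          using spread_grow[of y j] \<theta> by (intro mult_left_mono) auto
        then show "?g (grow y j) + \<theta> * real s \<le> ?g y + \<theta> * real (Suc s)" by (simp add: algebra_simps)
      qed (use \<theta> in simp)
      then show "?u (\<lambda>x. ?g x + \<theta> * real s) y \<le> ?g y + \<theta> * real (Suc s)" by (simp add: ustep_const)
    qed auto
    then show ?thesis .
  qed
  define F where "F = {h \<in> shape_space k. spread (rep k h) \<le> B}"
  have finF: "finite F"
  proof (rule finite_subset)
    let ?C = "\<lceil>B\<rceil>"
    show "F \<subseteq> {h. \<forall>l. (l \<in> {1..<k} \<longrightarrow> h l \<in> {- ?C..?C}) \<and> (l \<notin> {1..<k} \<longrightarrow> h l = 0)}"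
    proof (intro subsetI CollectI allI conjI impI)
      fix h l assume h: "h \<in> F"
      then have hS: "h \<in> shape_space k" and sp: "spread (rep k h) \<le> B" by (auto simp: F_def)
      show "h l = 0" if "l \<notin> {1..<k}" using hS that by (auto simp: shape_space_def)
      assume l: "l \<in> {1..<k}"
      then have lk: "l \<in> {1..k}" "Suc l \<in> {1..k}" by auto
      have "h l = shape k (rep k h) l" using rep(2)[OF hS] by simp
      also have "\<dots> = int (rep k h l) - int (rep k h (Suc l))" using l by (simp add: shape_def)
      finally have "real_of_int (h l) = real (rep k h l) - real (rep k h (Suc l))" by simp
      then have "real_of_int (h l) \<le> B" "real_of_int (- h l) \<le> B"
        using spread_ge[OF lk, of "rep k h"] spread_ge[OF lk(2,1), of "rep k h"] sp by auto
      then show "h l \<in> {- ?C..?C}" by (simp add: le_ceiling_iff) linarith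
    qed
  qed (intro finite_set_of_finite_funs, auto)
  \<comment> \<open>The 1 offsets the required -1; the rest is the largest \<open>M\<close>-step
    increase \<open>\<theta> * M\<close> times the largest factor
    \<open>\<Lambda> / E\<close>.\<close>
  define b where "b = 1 + \<Lambda> / (real k * \<beta> 0) * (\<theta> * real M)"
  show "positive_recurrent (shape_rate k \<beta>) i"
  proof (rule chain.positive_recurrent_of_finite_exception[where F=F and V="\<lambda>h. V (rep k h)" and b=b])
    show "0 \<le> b" unfolding b_def using \<Lambda>_pos \<theta> \<beta>0 by (intro add_nonneg_nonneg mult_nonneg_nonneg divide_nonneg_nonneg) auto
    show "F \<subseteq> shape_space k" by (auto simp: F_def)
    fix h assume h: "h \<in> shape_space k"
    show "\<exists>L. 0 < chain.hit_within i L h" by (rule shape_reachable_all[OF i h])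
    define x where "x = rep k h"
    define E where "E = exit_rate (shape_rate k \<beta>) h"
    have x: "crystal_config k x" "shape k x = h" using rep[OF h] by (auto simp: x_def)
    have E: "real k * \<beta> 0 \<le> E" "E \<le> \<Lambda>" "0 < E" "E = (\<Sum>j\<in>{1..k}. \<beta> (Vn j x))"
      using shape_exit_bounds[OF h] chain.l_pos exit_rate_shape[OF h] by (auto simp: E_def x_def)
    have "chain.avg (\<lambda>h. V (rep k h)) h = (\<Sum>j\<in>{1..k}. \<beta> (Vn j x) / E * V (grow x j))"
      unfolding chain.avg_def E_def[symmetric] x_def[symmetric]
    proof (rule sum.cong)
      fix j assume j: "j \<in> {1..k}"
      have "V (rep k (shape k (grow x j))) = V (grow x j)"
        using rep[OF shape_in_space[of k "grow x j"]] crystal_config_grow[OF x(1) j] by (intro V_inv) auto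
      then show "\<beta> (Vn j x) / E * V (rep k (shape k (grow x j))) = \<beta> (Vn j x) / E * V (grow x j)" by simp
    qed simp
    also have "\<dots> = V x + \<Lambda> / E * (?u V x - V x)"
    proof -
      have "\<Lambda> / E * (?u V x - V x) = (\<Sum>j\<in>{1..k}. \<beta> (Vn j x) / E * (V (grow x j) - V x))"
        unfolding ustep_def using \<Lambda>_pos by (simp add: sum_distrib_left)
      also have "\<dots> = (\<Sum>j\<in>{1..k}. \<beta> (Vn j x) / E * V (grow x j)) - (\<Sum>j\<in>{1..k}. \<beta> (Vn j x)) / E * V x"
        by (simp only: right_diff_distrib sum_subtractf sum_distrib_right sum_divide_distrib)
      finally show ?thesis using E(3) unfolding E(4)[symmetric] by simp
    qed
    finally have avg: "chain.avg (\<lambda>h. V (rep k h)) h = V x + \<Lambda> / E * ((?u ^^ M) ?g x - ?g x)"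
      by (simp add: uV)
    have "\<Lambda> / E * ((?u ^^ M) ?g x - ?g x) \<le> - 1 + (if h \<in> F then b else 0)"
    proof (cases "h \<in> F")
      case True
      have "\<Lambda> / E * ((?u ^^ M) ?g x - ?g x) \<le> \<Lambda> / E * (\<theta> * real M)"
        using crude[of x] \<Lambda>_pos E by (intro mult_left_mono) auto
      also have "\<dots> \<le> \<Lambda> / (real k * \<beta> 0) * (\<theta> * real M)"
        using \<Lambda>_pos E(1,3) k2 \<beta>0 \<theta> by (intro mult_right_mono divide_left_mono mult_pos_pos) auto
      finally show ?thesis using True by (simp add: b_def)
    next
      case False
      then have "B < spread x" using h by (auto simp: F_def x_def)
      then have "(?u ^^ M) ?g x - ?g x \<le> - 1" using drift[OF x(1)] by simp
      then have "\<Lambda> / E * ((?u ^^ M) ?g x - ?g x) \<le> \<Lambda> / E * (- 1)"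
        using \<Lambda>_pos E by (intro mult_left_mono) auto
      also have "\<dots> \<le> - 1" using E by simp
      finally show ?thesis using False by simp
    qed
    then show "chain.avg (\<lambda>h. V (rep k h)) h \<le> V (rep k h) - 1 + (if h \<in> F then b else 0)"
      unfolding avg x_def[symmetric] by linarith
  qed (use i finF V0 in auto)
qed

end

text \<open>An infimum below \<open>c\<close> yields an element below \<open>c\<close> once the set
  is nonempty; \<open>d = B * (exp 1 - 1) + 1\<close> lies in it, with decay rate 1 by
  \<open>crystal_tail_le\<close>.\<close>

lemma tilde_d_lessD:
  assumes att: "attractive_crystal n (tilde_param \<beta>) \<Lambda>" and less: "tilde_d n \<beta> < c"
  obtains d C \<alpha> where "0 < d" "d < c" "0 < C" "0 < \<alpha>"
    "\<And>t. 0 \<le> t \<Longrightarrow> crystal_tail n (tilde_param \<beta>) t d \<le> C * exp (- \<alpha> * t)"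
proof -
  interpret T: attractive_crystal n "tilde_param \<beta>" \<Lambda> by (rule att)
  let ?P = "\<lambda>d. d > 0 \<and> (\<exists>C \<alpha>. C > 0 \<and> \<alpha> > 0 \<and>
      (\<forall>t\<ge>0. crystal_tail n (tilde_param \<beta>) t d \<le> C * exp (- \<alpha> * t)))"
  define B where "B = tilde_param \<beta> 1"
  define d where "d = B * (exp 1 - 1) + 1"
  have B: "0 < B" using T.\<beta>1_pos by (simp add: B_def)
  have "crystal_tail n (tilde_param \<beta>) t d \<le> 1 * exp (- 1 * t)" if "0 \<le> t" for t
    using T.crystal_tail_le[OF that T.m_pos, of B d] T.\<beta>_le B
    by (simp add: d_def B_def algebra_simps flip: exp_add)
  moreover have "0 < d" using B by (simp add: d_def add_nonneg_pos)
  ultimately have "?P d" using zero_less_one by blast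
  then have "{d. ?P d} \<noteq> {}" by blast
  from cInf_lessD[OF this] less obtain d where "?P d" "d < c" unfolding tilde_d_def by blast
  then show thesis using that by blast
qed

theorem theorem6:
  fixes \<beta> :: "nat \<Rightarrow> real" and n :: nat
  assumes "0 < \<beta> 0" and "\<beta> 0 < \<beta> 2" and "\<beta> 2 < \<beta> 1"
    and "1 \<le> n"
    and "\<beta> 2 > tilde_d n \<beta>"
  shows "\<forall>k. 2 \<le> k \<and> k \<le> n + 2 \<longrightarrow> shape_ergodic k \<beta>"
proof (intro allI impI)
  fix k assume "2 \<le> k \<and> k \<le> n + 2"
  then have k: "2 \<le> k" "k \<le> n + 2" by auto
  define \<gamma> where "\<gamma> = tilde_param \<beta>"
  \<comment> \<open>One common clock, fast enough for the comparison process on \<open>n\<close>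
    sites and for every \<open>k \<le> n + 2\<close>.\<close>
  define \<Lambda> where "\<Lambda> = (real n + 2) * \<beta> 1"
  have \<beta>1: "0 < \<beta> 1" using assms by linarith
  have \<Lambda>: "0 < \<Lambda>" unfolding \<Lambda>_def using \<beta>1 by simp
  have cases2: "v = 0 \<or> v = 1 \<or> v = 2" if "v \<le> 2" for v :: nat using that by linarith
  have le: "real m * \<beta> 1 \<le> \<Lambda>" if "m \<le> n + 2" for m
    unfolding \<Lambda>_def using that \<beta>1 by (intro mult_right_mono) auto
  interpret T: attractive_crystal n \<gamma> \<Lambda>
  proof
    fix v :: nat assume "v \<le> 2"
    from cases2[OF this] have v: "\<gamma> v \<le> \<beta> 1" "0 \<le> \<gamma> v"
      using assms by (auto simp: \<gamma>_def tilde_param_def)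
    show "0 \<le> \<gamma> v" by (rule v)
    have "real n * \<gamma> v \<le> real n * \<beta> 1" using v by (intro mult_left_mono) auto
    then show "real n * \<gamma> v \<le> \<Lambda>" using le[of n] by simp
  qed (use assms \<Lambda> in \<open>auto simp: \<gamma>_def tilde_param_def\<close>)
  interpret X: crystal k \<beta> \<Lambda>
  proof
    fix v :: nat assume "v \<le> 2"
    from cases2[OF this] have v: "\<beta> v \<le> \<beta> 1" "0 \<le> \<beta> v" using assms by auto
    show "0 \<le> \<beta> v" by (rule v)
    have "real k * \<beta> v \<le> real k * \<beta> 1" using v by (intro mult_left_mono) auto
    then show "real k * \<beta> v \<le> \<Lambda>" using le[OF k(2)] by linarith
  qed (use assms \<Lambda> k in auto)
  have \<gamma>: "\<beta> v \<le> \<gamma> v" if "v \<le> 2" for v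
    using cases2[OF that] assms by (auto simp: \<gamma>_def tilde_param_def)
  obtain d C \<alpha> where d: "0 < d" "d < \<beta> 2" "0 < C" "0 < \<alpha>"
    "\<And>t. 0 \<le> t \<Longrightarrow> crystal_tail n \<gamma> t d \<le> C * exp (- \<alpha> * t)"
    using tilde_d_lessD[of n \<beta> \<Lambda> "\<beta> 2"] T.attractive_crystal_axioms assms(5) unfolding \<gamma>_def by blast
  define d' where "d' = (d + \<beta> 2) / 2"
  have d': "d < d'" "d' < \<beta> 2" "0 < d'" using d by (auto simp: d'_def)
  obtain \<theta>0 where \<theta>0: "0 < \<theta>0" "\<And>\<theta>. 0 < \<theta> \<Longrightarrow> \<theta> \<le> \<theta>0 \<Longrightarrow> \<exists>N. T.growth \<theta> N < (1 + \<theta> * d' / \<Lambda>) ^ N"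
    using T.growth_lt_geometric[OF d(1) d'(1) d(3,4,5)] by blast
  \<comment> \<open>Makes \<open>D2\<close>, the speed of low sites after the loss
    \<open>\<kappa>\<close> from the weights, the midpoint of \<open>d'\<close> and
    \<open>\<beta> 2\<close>.\<close>
  define \<kappa> where "\<kappa> = (\<beta> 2 - d') / (2 * \<beta> 2)"
  define \<eta> where "\<eta> = \<kappa> / real k"
  define D2 where "D2 = (1 - \<kappa>) * \<beta> 2"
  define D1 where "D1 = \<beta> 1 - (\<beta> 1 - \<beta> 0) / real k"
  have \<kappa>: "0 < \<kappa>" "\<kappa> \<le> 1" using d' assms by (auto simp: \<kappa>_def field_simps)
  have \<eta>: "0 < \<eta>" "\<eta> \<le> 1" "real k * \<eta> = \<kappa>" using \<kappa> k by (auto simp: \<eta>_def field_simps)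
  have D2: "d' < D2"
  proof -
    have "D2 = (\<beta> 2 + d') / 2" using d' by (simp add: D2_def \<kappa>_def field_simps)
    then show ?thesis using d' by simp
  qed
  have D1: "0 < D1" "D1 < \<beta> 1"
  proof -
    have "(\<beta> 1 - \<beta> 0) / real k \<le> (\<beta> 1 - \<beta> 0) / 1" using k assms by (intro divide_left_mono) auto
    then show "0 < D1" using assms(1) by (simp add: D1_def)
    show "D1 < \<beta> 1" using k assms by (simp add: D1_def)
  qed
  \<comment> \<open>Moment rates match speeds only to first order in \<open>\<theta>\<close>. The
    two new bounds give \<open>d' < (1 - \<theta>) * D2\<close> and
    \<open>exp \<theta> * D1 < \<beta> 1\<close>, from which both contraction conditions
    follow.\<close>
  define \<theta> where "\<theta> = min \<theta>0 (min ((1 - d' / D2) / 2) (ln (\<beta> 1 / D1) / 2))"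
  have pos: "0 < 1 - d' / D2" "0 < ln (\<beta> 1 / D1)" using D1 D2 d' by auto
  have min3: "0 < min a (min (b / 2) (c / 2)) \<and> min a (min (b / 2) (c / 2)) \<le> a
      \<and> min a (min (b / 2) (c / 2)) < b \<and> min a (min (b / 2) (c / 2)) < c"
    if "0 < a" "0 < b" "0 < c" for a b c :: real
    using that by (simp add: min_less_iff_disj)
  have \<theta>: "0 < \<theta>" "\<theta> \<le> \<theta>0" "\<theta> < 1 - d' / D2" "\<theta> < ln (\<beta> 1 / D1)"
    using min3[OF \<theta>0(1) pos] unfolding \<theta>_def by blast+
  obtain N where N: "T.growth \<theta> N < (1 + \<theta> * d' / \<Lambda>) ^ N" using \<theta>0(2) \<theta> by blast
  have prod: "(1 + u) * (1 - v) < 1" if "u < v" "0 \<le> u" for u v :: real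
  proof -
    have "(1 + u) * (1 - v) = 1 + u - v - u * v" by (simp add: algebra_simps)
    moreover have "0 \<le> u * v" using that by (intro mult_nonneg_nonneg) auto
    ultimately show ?thesis using that by linarith
  qed
  have "\<exists>M\<ge>1. \<forall>x. crystal_config k x \<and> real ((k + 1) * M) < X.spread x \<longrightarrow>
    (ustep k \<beta> \<Lambda> ^^ M) (\<lambda>y. \<theta> * X.spread y) x \<le> \<theta> * X.spread x - 1"
  proof (rule X.spread_drift[OF T.attractive_crystal_axioms k(2) \<gamma> \<theta>(1) \<eta>(1,2) _ _ N])
    show "real k * \<eta> \<le> 1" using \<eta> \<kappa> by simp
    show "1 \<le> 1 + \<theta> * d' / \<Lambda>" using \<theta> d' \<Lambda> by simp
    have "\<theta> * d' < (1 - exp (- \<theta>)) * D2"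
    proof -
      have "d' < (1 - \<theta>) * D2" using \<theta>(3) D2 d' by (simp add: field_simps)
      then have "\<theta> * d' < \<theta> * ((1 - \<theta>) * D2)" using \<theta>(1) by simp
      also have "\<dots> = (\<theta> - \<theta>\<^sup>2) * D2" by (simp add: power2_eq_square algebra_simps)
      also have "\<dots> \<le> (1 - exp (- \<theta>)) * D2"
        using exp_minus_le_quadratic[of \<theta>] \<theta>(1) D2 d' by (intro mult_right_mono) auto
      finally show ?thesis .
    qed
    then have "\<theta> * d' / \<Lambda> < (1 - exp (- \<theta>)) * D2 / \<Lambda>" using \<Lambda> by (simp add: divide_strict_right_mono)
    then show "(1 + \<theta> * d' / \<Lambda>) * (1 - (1 - exp (- \<theta>)) * (1 - real k * \<eta>) * \<beta> 2 / \<Lambda>) < 1"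
      using \<theta> d' \<Lambda> unfolding \<eta>(3) by (intro prod) (simp_all add: D2_def mult.assoc)
    have "(exp \<theta> - 1) * D1 < (1 - exp (- \<theta>)) * \<beta> 1"
    proof -
      have "exp \<theta> < exp (ln (\<beta> 1 / D1))" using \<theta>(4) by simp
      also have "\<dots> = \<beta> 1 / D1" using D1 \<beta>1 by (intro exp_ln) simp
      finally have "exp \<theta> * D1 < \<beta> 1" using D1 by (simp add: pos_less_divide_eq)
      then have "(1 - exp (- \<theta>)) * (exp \<theta> * D1) < (1 - exp (- \<theta>)) * \<beta> 1" using \<theta>(1) by simp
      then show ?thesis by (simp add: algebra_simps flip: exp_add mult.assoc)
    qed
    then have "(exp \<theta> - 1) * D1 / \<Lambda> < (1 - exp (- \<theta>)) * \<beta> 1 / \<Lambda>" using \<Lambda> by (simp add: divide_strict_right_mono)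
    then show "(1 + (exp \<theta> - 1) * (\<beta> 1 - (\<beta> 1 - \<beta> 0) / real k) / \<Lambda>) * (1 - (1 - exp (- \<theta>)) * \<beta> 1 / \<Lambda>) < 1"
      using \<theta> D1 \<Lambda> unfolding D1_def[symmetric] by (intro prod) auto
  qed
  then obtain M where M: "\<And>x. crystal_config k x \<Longrightarrow> real ((k + 1) * M) < X.spread x \<Longrightarrow>
    (ustep k \<beta> \<Lambda> ^^ M) (\<lambda>y. \<theta> * X.spread y) x \<le> \<theta> * X.spread x - 1" by blast
  show "shape_ergodic k \<beta>" by (rule X.ergodic_of_spread_drift[OF \<theta>(1) M])
qed

end
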